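(* For $\tau=u+iv$ in the upper half-plane, let $$\tilde\varphi_\tau(x,y):=\varphi^+_\tau(x,y)-\varphi^*_\tau(x,y)=\operatorname{sgn}(x)\,\mathbf{e}\left(\frac{y^2-x^2}{2}\tau\right)\left(\mathds{1}_{y^2>x^2}-\operatorname{erfc}(\sqrt{2\pi v}\,|x|)\right),\qquad (x,y)\in\mathbb{R}^2 .$$ Then $\tilde\varphi_\tau\in L^\infty(\mathbb{R}^{2})$, and for all $(x,y)\in\mathbb{R}^{2}$ and all $\tau$ in the upper half-plane: 1. $\tilde\varphi_{\tau+1}(x,y)=\mathbf{e}\left(\frac{y^2-x^2}{2}\right)\tilde\varphi_\tau(x,y)$; 2. $\mathcal{F}(\tilde\varphi_{-1/\tau})(x,y)=\tau\,\tilde\varphi_\tau(x,y)$; 3. $\xi(\tilde\varphi_\tau(x,y))=\varphi_\tau(x,y)$, where $\varphi_\tau(x,y)=\sqrt{2v}\,x\,\mathbf{e}\left(\frac{x^2}{2}\tau-\frac{y^2}{2}\bar\tau\right)$.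
   Context: Notation: $\mathbf{e}(a)=e^{2\pi ia}$; $\operatorname{sgn}(0)=0$; $\operatorname{erfc}(x)=1-\frac{2}{\sqrt\pi}\int_0^xe^{-r^2}dr$; $\mathds{1}_{y^2>x^2}$ is the characteristic function of $\{(x,y):y^2>x^2\}$. The operator $\xi=\xi_1$ acts in the variable $\tau$ by $\xi(f)=2iv\,\overline{\frac{\partial f}{\partial\bar\tau}}$. $$\varphi^*_\tau(x,y)=\mathbf{e}\left(\tfrac{y^2-x^2}{2}\tau\right)\operatorname{sgn}(x)\operatorname{erfc}(\sqrt{2\pi v}|x|),\qquad \varphi^+_\tau(x,y)=\mathbf{e}\left(\tfrac{y^2-x^2}{2}\tau\right)\operatorname{sgn}(x)\,\mathds{1}_{y^2>x^2}.$$ Fourier transform: $\mathcal{F}(\phi)(x,y)=\int_{\mathbb{R}^2}\phi(w,z)\,\mathbf{e}(-wx+yz)\,dw\,dz$, and $\mathcal{F}(\tilde\varphi_\tau)=\mathcal{F}(\varphi^+_\tau)-\mathcal{F}(\varphi^*_\tau)$. For $\varphi^*_\tau$ the integral converges absolutely. For $\varphi^+_\tau$ it is understood as the improper integral $\lim_{T,T'\to\infty}$ of the integrals over the rectangles $\{|a|\le T',|b|\le T\}$ in the rotated coordinates $a=\frac{w+z}{\sqrt2}$, $b=\frac{z-w}{\sqrt2}$; this converges when $x^2\ne y^2$ (and equals $0$ at $(0,0)$ since $\varphi^+_\tau$ is odd under $(w,z)\mapsto(-w,-z)$). At points with $x^2=y^2>0$, the value $\mathcal{F}(\varphi^+_{-1/\tau})(x,y)$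 is by convention defined to be the one making the function $\varphi^+_\tau(x,y)-\frac{1}{\tau}\mathcal{F}(\varphi^+_{-1/\tau})(x,y)$ continuous at such points. *)

theory Defs
  imports "HOL-Analysis.Analysis"
begin

definition e2pi :: "complex \<Rightarrow> complex"
  where "e2pi a = exp (2 * of_real pi * \<i> * a)"

text \<open>The oriented interval integral makes this the usual error function for negative \<open>x\<close> too.\<close>

definition erfc :: "real \<Rightarrow> real"
  where "erfc x = 1 - 2 / sqrt pi * (LBINT r=ereal 0..ereal x. exp (- (r\<^sup>2)))"

definition phi_star :: "complex \<Rightarrow> real \<Rightarrow> real \<Rightarrow> complex"
  where "phi_star \<tau> x y =
    e2pi (of_real ((y\<^sup>2 - x\<^sup>2) / 2) * \<tau>) * of_real (sgn x)
      * of_real (erfc (sqrt (2 * pi * Im \<tau>) * \<bar>x\<bar>))"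

definition phi_plus :: "complex \<Rightarrow> real \<Rightarrow> real \<Rightarrow> complex"
  where "phi_plus \<tau> x y =
    e2pi (of_real ((y\<^sup>2 - x\<^sup>2) / 2) * \<tau>) * of_real (sgn x) * of_bool (y\<^sup>2 > x\<^sup>2)"

definition phi_tilde :: "complex \<Rightarrow> real \<Rightarrow> real \<Rightarrow> complex"
  where "phi_tilde \<tau> x y = phi_plus \<tau> x y - phi_star \<tau> x y"

lemma phi_tilde_eq:
  "phi_tilde \<tau> x y =
    of_real (sgn x) * e2pi (of_real ((y\<^sup>2 - x\<^sup>2) / 2) * \<tau>)
      * (of_bool (y\<^sup>2 > x\<^sup>2) - of_real (erfc (sqrt (2 * pi * Im \<tau>) * \<bar>x\<bar>)))"
  by (simp add: phi_tilde_def phi_plus_def phi_star_def algebra_simps)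

definition phi :: "complex \<Rightarrow> real \<Rightarrow> real \<Rightarrow> complex"
  where "phi \<tau> x y =
    of_real (sqrt (2 * Im \<tau>) * x)
      * e2pi (of_real (x\<^sup>2 / 2) * \<tau> - of_real (y\<^sup>2 / 2) * cnj \<tau>)"

definition L_infty :: "('a::euclidean_space \<Rightarrow> complex) set"
  where "L_infty = {f. f \<in> borel_measurable lebesgue \<and> (\<exists>C. AE p in lebesgue. norm (f p) \<le> C)}"

definition d_taubar :: "(complex \<Rightarrow> complex) \<Rightarrow> complex \<Rightarrow> complex"
  where "d_taubar f \<tau> =
    (vector_derivative (\<lambda>u. f (Complex u (Im \<tau>))) (at (Re \<tau>))
      + \<i> * vector_derivative (\<lambda>v. f (Complex (Re \<tau>) v)) (at (Im \<tau>))) / 2"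

definition xi :: "(complex \<Rightarrow> complex) \<Rightarrow> complex \<Rightarrow> complex"
  where "xi f \<tau> = 2 * \<i> * of_real (Im \<tau>) * cnj (d_taubar f \<tau>)"

definition FT_integrand :: "(real \<Rightarrow> real \<Rightarrow> complex) \<Rightarrow> real \<Rightarrow> real \<Rightarrow> real \<times> real \<Rightarrow> complex"
  where "FT_integrand \<phi> x y = (\<lambda>(w, z). \<phi> w z * e2pi (of_real (- (w * x) + y * z)))"

definition FT :: "(real \<Rightarrow> real \<Rightarrow> complex) \<Rightarrow> real \<Rightarrow> real \<Rightarrow> complex"
  where "FT \<phi> x y = (LINT p|lborel. FT_integrand \<phi> x y p)"

definition rotated_rect :: "real \<Rightarrow> real \<Rightarrow> (real \<times> real) set"
  where "rotated_rect T' T = {(w, z). \<bar>(w + z) / sqrt 2\<bar> \<le> T' \<and> \<bar>(z - w) / sqrt 2\<bar> \<le> T}"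

definition FT_rect :: "(real \<Rightarrow> real \<Rightarrow> complex) \<Rightarrow> real \<Rightarrow> real \<Rightarrow> real \<times> real \<Rightarrow> complex"
  where "FT_rect \<phi> x y = (\<lambda>(T', T). LINT p:rotated_rect T' T|lborel. FT_integrand \<phi> x y p)"

definition FT_improper :: "(real \<Rightarrow> real \<Rightarrow> complex) \<Rightarrow> real \<Rightarrow> real \<Rightarrow> complex"
  where "FT_improper \<phi> x y = Lim (at_top \<times>\<^sub>F at_top) (FT_rect \<phi> x y)"

text \<open>On the cone \<open>x\<^sup>2 = y\<^sup>2 > 0\<close>, write \<open>\<sigma> = -1/\<tau>\<close>. The value \<open>c\<close> of the transform of
  \<open>phi_plus \<sigma>\<close> there is determined by requiring \<open>phi_plus \<tau> x y - c / \<tau>\<close> to be the limit of the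
  same expression along the (dense) complement of the cone, where the improper integral converges.\<close>

definition FT_plus :: "complex \<Rightarrow> real \<Rightarrow> real \<Rightarrow> complex"
  where "FT_plus \<sigma> x y =
    (if x\<^sup>2 = y\<^sup>2 \<and> y\<^sup>2 > 0 then
       (let \<tau> = - 1 / \<sigma> in
        \<tau> * (phi_plus \<tau> x y
          - Lim (at (x, y) within {(x', y'). x'\<^sup>2 \<noteq> y'\<^sup>2})
              (\<lambda>(x', y'). phi_plus \<tau> x' y' - 1 / \<tau> * FT_improper (phi_plus \<sigma>) x' y')))
     else FT_improper (phi_plus \<sigma>) x y)"

definition FT_tilde :: "complex \<Rightarrow> real \<Rightarrow> real \<Rightarrow> complex"
  where "FT_tilde \<sigma> x y = FT_plus \<sigma> x y - FT (phi_star \<sigma>) x y"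

text \<open>The conventions behind \<open>FT_tilde \<sigma>\<close> are meaningful at \<open>(x, y)\<close>: every integral and limit
  used there exists, so that no default value of \<open>Lim\<close> or of the Bochner integral is involved.\<close>

definition FT_tilde_well_defined :: "complex \<Rightarrow> real \<Rightarrow> real \<Rightarrow> bool"
  where "FT_tilde_well_defined \<sigma> x y \<longleftrightarrow>
    integrable lborel (FT_integrand (phi_star \<sigma>) x y) \<and>
    (\<forall>T' T. set_integrable lborel (rotated_rect T' T) (FT_integrand (phi_plus \<sigma>) x y)) \<and>
    (if x\<^sup>2 = y\<^sup>2 \<and> y\<^sup>2 > 0 then
       isCont (\<lambda>(x', y'). phi_plus (- 1 / \<sigma>) x' y' - 1 / (- 1 / \<sigma>) * FT_plus \<sigma> x' y') (x, y)
     else (FT_rect (phi_plus \<sigma>) x y \<longlongrightarrow> FT_plus \<sigma> x y) (at_top \<times>\<^sub>F at_top))"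

end

theory Submission
  imports Defs "HOL-Probability.Sinc_Integral" "HOL-Real_Asymp.Real_Asymp"
    "HOL-Complex_Analysis.Cauchy_Integral_Formula"
begin

text \<open>
  Let \<open>\<sigma> = -1/\<tau>\<close> and let \<open>C\<close> be the integral of \<open>e(\<sigma> z\<^sup>2 / 2)\<close> over the line, so that
  \<open>C\<close> times the corresponding integral for \<open>\<tau>\<close> is \<open>1\<close>; write \<open>E(x)\<close> for the primitive of
  \<open>e(\<tau> s\<^sup>2 / 2)\<close> vanishing at \<open>0\<close>. Both transforms are evaluated in terms of \<open>E\<close>, which cancels in
  their difference.

  The transform of \<open>phi_star \<sigma>\<close> splits into a Gaussian in \<open>z\<close> and a one-dimensional sine transform
  in \<open>w\<close>; integration by parts gives a first-order linear differential equation for the latter, with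
  solution
  \<open>\<tau> e((y\<^sup>2 - x\<^sup>2) \<tau> / 2) (2 C E(x) - sgn x (1 - erfc (sqrt (2 \<pi> v) \<bar>x\<bar>)))\<close>.

  For \<open>phi_plus \<sigma>\<close> use the rotated coordinates \<open>a\<close>, \<open>b\<close> and their duals \<open>\<alpha> = (y - x) / sqrt 2\<close>,
  \<open>\<beta> = (y + x) / sqrt 2\<close>. The integral over \<open>\<bar>b\<bar> \<le> T\<close> is elementary and, up to an error whose
  integral over \<open>a\<close> is \<open>O(1/T)\<close>, equals
  \<open>e(a \<alpha>) (2 e(a (a \<sigma> + \<beta>)) - 1) / (2 \<pi> \<i> (a \<sigma> + \<beta>))\<close>. The term with \<open>-1\<close> is evaluated by
  residues. The Gaussian term, multiplied by \<open>e(- \<alpha> \<beta> \<tau>)\<close>, has a pure Gaussian as derivative with respect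
  to \<open>\<alpha>\<close>, and it tends to \<open>0\<close> as \<open>\<alpha>\<close> tends to infinity with the sign opposite to \<open>\<beta>\<close>; this fixes
  the constant of integration without a further contour argument. Altogether the transform is
  \<open>\<tau> e((y\<^sup>2 - x\<^sup>2) \<tau> / 2) (2 C E(x) - sgn x [y\<^sup>2 \<le> x\<^sup>2])\<close>.
\<close>

section \<open>Calculus of the character \<open>e2pi\<close>\<close>

lemma e2pi_add: "e2pi (a + b) = e2pi a * e2pi b"
  by (simp add: e2pi_def exp_add[symmetric] algebra_simps)

lemma e2pi_0 [simp]: "e2pi 0 = 1"
  by (simp add: e2pi_def)

lemma norm_e2pi: "norm (e2pi a) = exp (- (2 * pi * Im a))"
  by (simp add: e2pi_def)

lemma cnj_e2pi: "cnj (e2pi a) = e2pi (- cnj a)"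
  by (simp add: e2pi_def exp_cnj)

lemma e2pi_has_field_derivative [derivative_intros]:
  "(f has_field_derivative f') (at x within S) \<Longrightarrow>
    ((\<lambda>x. e2pi (f x)) has_field_derivative 2 * of_real pi * \<i> * f' * e2pi (f x)) (at x within S)"
  unfolding e2pi_def by (auto intro!: derivative_eq_intros)

lemma e2pi_has_vector_derivative [derivative_intros]:
  assumes "(f has_vector_derivative f') (at x within S)"
  shows "((\<lambda>x. e2pi (f x)) has_vector_derivative 2 * of_real pi * \<i> * f' * e2pi (f x)) (at x within S)"
  using field_vector_diff_chain_within[OF assms e2pi_has_field_derivative[OF DERIV_ident]]
  by (simp add: o_def algebra_simps)

lemma continuous_on_e2pi [continuous_intros]:
  "continuous_on S f \<Longrightarrow> continuous_on S (\<lambda>x. e2pi (f x))"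
  unfolding e2pi_def by (intro continuous_intros)

lemma tendsto_e2pi [tendsto_intros]: "(f \<longlongrightarrow> l) F \<Longrightarrow> ((\<lambda>x. e2pi (f x)) \<longlongrightarrow> e2pi l) F"
  unfolding e2pi_def by (intro tendsto_intros)

lemma isCont_e2pi [continuous_intros]: "isCont f x \<Longrightarrow> isCont (\<lambda>x. e2pi (f x)) x"
  unfolding e2pi_def by (intro continuous_intros)

lemma borel_measurable_e2pi [measurable]:
  "f \<in> borel_measurable M \<Longrightarrow> (\<lambda>x. e2pi (f x)) \<in> borel_measurable M"
  unfolding e2pi_def by measurable

section \<open>Differentiation under the integral sign and the fundamental theorem on unbounded
  intervals\<close>

lemma has_vector_derivative_iff_tendsto_quotient:
  "(f has_vector_derivative D) (at x) \<longleftrightarrow> ((\<lambda>t. (f t - f x) /\<^sub>R (t - x)) \<longlongrightarrow> D) (at x)"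
proof -
  have "norm (f t - f x - (t - x) *\<^sub>R D) / norm (t - x) = norm ((f t - f x) /\<^sub>R (t - x) - D)"
    if "t \<noteq> x" for t
  proof -
    have "(f t - f x) /\<^sub>R (t - x) - D = (f t - f x - (t - x) *\<^sub>R D) /\<^sub>R (t - x)"
      using that by (simp add: scaleR_diff_right)
    then show ?thesis
      by (simp add: divide_inverse mult.commute)
  qed
  then have "((\<lambda>t. norm (f t - f x - (t - x) *\<^sub>R D) / norm (t - x)) \<longlongrightarrow> 0) (at x) \<longleftrightarrow>
      ((\<lambda>t. norm ((f t - f x) /\<^sub>R (t - x) - D)) \<longlongrightarrow> 0) (at x)"
    by (intro Lim_cong_within) auto
  then show ?thesis
    by (simp add: has_vector_derivative_def has_derivative_iff_norm bounded_linear_scaleR_left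
        tendsto_norm_zero_iff Lim_null[symmetric])
qed

text \<open>Dominated convergence for the difference quotients along sequences tending to
  \<open>t0\<close>: the mean value inequality turns the bound \<open>g\<close> on the derivative
  into a bound on the quotients. The derivative at \<open>t0\<close> has its own name
  \<open>f'\<close>, so that measurability is asked at this one parameter only.\<close>

lemma has_vector_derivative_integral_dominated:
  fixes f :: "real \<Rightarrow> 'a \<Rightarrow> 'b :: {banach, second_countable_topology}"
  assumes "\<And>t. integrable M (f t)"
    and "f' \<in> borel_measurable M"
    and deriv: "\<And>t a. ((\<lambda>s. f s a) has_vector_derivative F t a) (at t)"
    and "\<And>a. F t0 a = f' a"
    and bound: "\<And>t a. norm (F t a) \<le> g a"
    and g: "integrable M g"
  shows "((\<lambda>t. LINT a|M. f t a) has_vector_derivative (LINT a|M. f' a)) (at t0)"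
proof -
  have "((\<lambda>t. (LINT a|M. (f t a - f t0 a) /\<^sub>R (t - t0))) \<longlongrightarrow> (LINT a|M. f' a)) (at t0)"
    unfolding tendsto_at_iff_sequentially
  proof safe
    fix X :: "nat \<Rightarrow> real"
    assume X: "\<forall>i. X i \<in> UNIV - {t0}" "X \<longlonglongrightarrow> t0"
    have "(\<lambda>i. LINT a|M. (f (X i) a - f t0 a) /\<^sub>R (X i - t0)) \<longlonglongrightarrow> (LINT a|M. f' a)"
    proof (rule integral_dominated_convergence[where w = g])
      show "(\<lambda>a. (f (X i) a - f t0 a) /\<^sub>R (X i - t0)) \<in> borel_measurable M" for i
        using assms(1) by (intro borel_measurable_integrable) auto
      show "AE a in M. norm ((f (X i) a - f t0 a) /\<^sub>R (X i - t0)) \<le> g a" for i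
      proof (rule AE_I2)
        fix a
        have "norm (f (X i) a - f t0 a) \<le> g a * norm (X i - t0)"
        proof (rule differentiable_bound[where S = UNIV])
          show "((\<lambda>s. f s a) has_derivative (\<lambda>h. h *\<^sub>R F t a)) (at t within UNIV)" for t
            using deriv by (simp add: has_vector_derivative_def)
          show "onorm (\<lambda>h. h *\<^sub>R F t a) \<le> g a" for t
            by (rule onorm_le) (use bound in \<open>simp add: mult.commute mult_left_mono\<close>)
        qed auto
        moreover have "X i \<noteq> t0" using X by auto
        ultimately show "norm ((f (X i) a - f t0 a) /\<^sub>R (X i - t0)) \<le> g a"
          unfolding norm_scaleR by (simp add: divide_simps mult.commute)
      qed
      show "AE a in M. (\<lambda>i. (f (X i) a - f t0 a) /\<^sub>R (X i - t0)) \<longlonglongrightarrow> f' a"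
      proof (rule AE_I2)
        fix a
        have "((\<lambda>s. (f s a - f t0 a) /\<^sub>R (s - t0)) \<longlongrightarrow> f' a) (at t0)"
          using deriv[of a t0] assms(4) by (simp add: has_vector_derivative_iff_tendsto_quotient)
        then show "(\<lambda>i. (f (X i) a - f t0 a) /\<^sub>R (X i - t0)) \<longlonglongrightarrow> f' a"
          using X unfolding tendsto_at_iff_sequentially by (auto simp: o_def)
      qed
    qed (use assms in auto)
    then show "((\<lambda>t. (LINT a|M. (f t a - f t0 a) /\<^sub>R (t - t0))) \<circ> X) \<longlonglongrightarrow> (LINT a|M. f' a)"
      by (simp add: o_def)
  qed
  moreover have "(LINT a|M. (f t a - f t0 a) /\<^sub>R (t - t0)) =
      ((LINT a|M. f t a) - (LINT a|M. f t0 a)) /\<^sub>R (t - t0)" for t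
    by (simp only: integral_scaleR_right Bochner_Integration.integral_diff[OF assms(1) assms(1)])
  ultimately show ?thesis
    by (simp only: has_vector_derivative_iff_tendsto_quotient)
qed

lemma integral_FTC_whole_line:
  fixes F f :: "real \<Rightarrow> 'a :: euclidean_space"
  assumes "\<And>x. (F has_vector_derivative f x) (at x)" "continuous_on UNIV f"
    and "integrable lborel f" "(F \<longlongrightarrow> A) at_bot" "(F \<longlongrightarrow> B) at_top"
  shows "(LINT x|lborel. f x) = B - A"
proof -
  have "(LBINT x=-\<infinity>..\<infinity>. f x) = B - A"
    by (rule interval_integral_FTC_integrable)
      (use assms in \<open>auto simp: ereal_tendsto_simps continuous_on_eq_continuous_at set_integrable_def\<close>)
  then show ?thesis
    by (simp add: interval_lebesgue_integral_def set_lebesgue_integral_def)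
qed

lemma integral_FTC_half_line:
  fixes F f :: "real \<Rightarrow> 'a :: euclidean_space"
  assumes "\<And>x. x > 0 \<Longrightarrow> (F has_vector_derivative f x) (at x)" "\<And>x. x > 0 \<Longrightarrow> isCont f x"
    and "set_integrable lborel {0<..} f" "(F \<longlongrightarrow> A) (at_right 0)" "(F \<longlongrightarrow> B) at_top"
  shows "(LINT x:{0<..}|lborel. f x) = B - A"
proof -
  have "(LBINT x=ereal 0..\<infinity>. f x) = B - A"
    by (rule interval_integral_FTC_integrable)
      (use assms in \<open>auto simp: ereal_tendsto_simps\<close>)
  then show ?thesis
    by (simp add: interval_lebesgue_integral_def)
qed

section \<open>Real Gaussians: moments, total mass and decay\<close>

lemma integrable_power_gaussian:
  fixes k :: real
  assumes "k > 0"
  shows "integrable lborel (\<lambda>x. \<bar>x\<bar> ^ n * exp (- (k * x\<^sup>2)))"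
proof -
  \<comment> \<open>The standard deviation for which \<open>normal_density 0 s\<close> is a constant
    multiple of the Gaussian with rate \<open>k\<close>.\<close>
  define s where "s = sqrt (1 / (2 * k))"
  have s: "s > 0" "s\<^sup>2 = 1 / (2 * k)"
    using assms by (auto simp: s_def)
  have "integrable lborel (\<lambda>x. sqrt (2 * pi * s\<^sup>2) * (normal_density 0 s x * \<bar>x - 0\<bar> ^ n))"
    using s by (intro integrable_mult_right integrable_normal_moment_abs)
  also have "(\<lambda>x. sqrt (2 * pi * s\<^sup>2) * (normal_density 0 s x * \<bar>x - 0\<bar> ^ n)) =
      (\<lambda>x. \<bar>x\<bar> ^ n * exp (- (k * x\<^sup>2)))"
    using s assms by (auto simp: normal_density_def fun_eq_iff)
  finally show ?thesis .
qed

lemmas integrable_gaussian = integrable_power_gaussian[where n = 0, simplified]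

lemma integral_gaussian:
  fixes k :: real
  assumes "k > 0"
  shows "(LINT x|lborel. exp (- (k * x\<^sup>2))) = sqrt (pi / k)"
proof -
  define s where "s = sqrt (1 / (2 * k))"
  have s: "s > 0" "s\<^sup>2 = 1 / (2 * k)"
    using assms by (auto simp: s_def)
  have "(LINT x|lborel. sqrt (2 * pi * s\<^sup>2) * normal_density 0 s x) = sqrt (2 * pi * s\<^sup>2)"
    using s by simp
  also have "(\<lambda>x. sqrt (2 * pi * s\<^sup>2) * normal_density 0 s x) = (\<lambda>x. exp (- (k * x\<^sup>2)))"
    using s assms by (auto simp: normal_density_def fun_eq_iff)
  finally show ?thesis
    using s by simp
qed

lemma tendsto_power_gaussian:
  fixes k :: real
  assumes "k > 0"
  shows "((\<lambda>x. \<bar>x\<bar> ^ n * exp (- (k * x\<^sup>2))) \<longlongrightarrow> 0) at_top"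
    and "((\<lambda>x. \<bar>x\<bar> ^ n * exp (- (k * x\<^sup>2))) \<longlongrightarrow> 0) at_bot"
proof -
  show *: "((\<lambda>x. \<bar>x\<bar> ^ n * exp (- (k * x\<^sup>2))) \<longlongrightarrow> 0) at_top"
    using assms by real_asymp
  show "((\<lambda>x. \<bar>x\<bar> ^ n * exp (- (k * x\<^sup>2))) \<longlongrightarrow> 0) at_bot"
    using * by (simp add: at_bot_mirror filterlim_filtermap)
qed

section \<open>Gaussian integrals\<close>

lemma norm_e2pi_quadratic:
  "norm (e2pi (of_real (z\<^sup>2 / 2) * \<sigma> + of_real r)) = exp (- (pi * Im \<sigma> * z\<^sup>2))"
  by (simp add: norm_e2pi)

lemma integrable_e2pi_quadratic:
  assumes "Im \<sigma> > 0"
  shows "integrable lborel (\<lambda>z. of_real (z ^ n) * e2pi (of_real (z\<^sup>2 / 2) * \<sigma> + of_real (y * z)))"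
proof (rule Bochner_Integration.integrable_bound)
  show "integrable lborel (\<lambda>z. \<bar>z\<bar> ^ n * exp (- (pi * Im \<sigma> * z\<^sup>2)))"
    using assms by (intro integrable_power_gaussian) simp
qed (auto simp: norm_mult norm_e2pi_quadratic norm_power power_abs simp del: of_real_mult of_real_power of_real_divide)

lemma tendsto_e2pi_quadratic:
  assumes "Im \<sigma> > 0"
  shows "((\<lambda>z. of_real (z ^ n) * e2pi (of_real (z\<^sup>2 / 2) * \<sigma> + of_real (y * z))) \<longlongrightarrow> 0) at_top"
    and "((\<lambda>z. of_real (z ^ n) * e2pi (of_real (z\<^sup>2 / 2) * \<sigma> + of_real (y * z))) \<longlongrightarrow> 0) at_bot"
proof -
  have *: "norm (of_real (z ^ n) * e2pi (of_real (z\<^sup>2 / 2) * \<sigma> + of_real (y * z))) =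
      \<bar>z\<bar> ^ n * exp (- (pi * Im \<sigma> * z\<^sup>2))" for z
    by (simp only: norm_mult norm_e2pi_quadratic norm_of_real power_abs)
  show "((\<lambda>z. of_real (z ^ n) * e2pi (of_real (z\<^sup>2 / 2) * \<sigma> + of_real (y * z))) \<longlongrightarrow> 0) at_top"
    using tendsto_power_gaussian(1)[of "pi * Im \<sigma>" n] assms
    by (subst tendsto_norm_zero_iff[symmetric]) (simp only: * zero_less_mult_iff pi_gt_zero simp_thms)
  show "((\<lambda>z. of_real (z ^ n) * e2pi (of_real (z\<^sup>2 / 2) * \<sigma> + of_real (y * z))) \<longlongrightarrow> 0) at_bot"
    using tendsto_power_gaussian(2)[of "pi * Im \<sigma>" n] assms
    by (subst tendsto_norm_zero_iff[symmetric]) (simp only: * zero_less_mult_iff pi_gt_zero simp_thms)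
qed

text \<open>A positive factor preserves the half-plane that singles out the principal root.\<close>

lemma csqrt_of_real_mult:
  assumes "a > 0"
  shows "csqrt (of_real a * z) = of_real (sqrt a) * csqrt z"
proof (rule csqrt_unique)
  show "(of_real (sqrt a) * csqrt z)\<^sup>2 = of_real a * z"
    using assms by (simp add: power_mult_distrib flip: of_real_power)
  have "0 < Re (csqrt z) \<or> Re (csqrt z) = 0 \<and> 0 \<le> Im (csqrt z)"
    by (rule csqrt_principal)
  then show "0 < Re (of_real (sqrt a) * csqrt z) \<or>
      Re (of_real (sqrt a) * csqrt z) = 0 \<and> 0 \<le> Im (of_real (sqrt a) * csqrt z)"
    using assms by (auto simp del: csqrt.sel)
qed

definition gauss_const :: "complex \<Rightarrow> complex"
  where "gauss_const \<sigma> = (LINT z|lborel. e2pi (of_real (z\<^sup>2 / 2) * \<sigma>))"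

text \<open>The integral over z of the z-derivative of the integrand vanishes, which expresses the
  first moment through \<open>K\<close>. The y-derivative of \<open>K\<close> is a multiple of that
  moment, so K' = -(2 pi i y / \<sigma>) K. Multiplying by the inverse of the Gaussian solution
  leaves a constant, which is read off at y = 0.\<close>

lemma gaussian_fourier:
  assumes \<sigma>: "Im \<sigma> > 0"
  shows "(LINT z|lborel. e2pi (of_real (z\<^sup>2 / 2) * \<sigma> + of_real (y * z))) =
    gauss_const \<sigma> * e2pi (- of_real (y\<^sup>2 / 2) / \<sigma>)"
proof -
  define f where "f y z = e2pi (of_real (z\<^sup>2 / 2) * \<sigma> + of_real (y * z))" for y z
  define K where "K y = (LINT z|lborel. f y z)" for y
  have int: "integrable lborel (f y)" "integrable lborel (\<lambda>z. of_real z * f y z)" for y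
    using integrable_e2pi_quadratic[OF \<sigma>, of 0 y] integrable_e2pi_quadratic[OF \<sigma>, of 1 y]
    by (simp_all add: f_def[abs_def])
  have K': "(K has_vector_derivative - 2 * of_real pi * \<i> * of_real y / \<sigma> * K y) (at y)" for y
  proof -
    have deriv: "(K has_vector_derivative (LINT z|lborel. 2 * of_real pi * \<i> * (of_real z * f y z))) (at y)"
      unfolding K_def
    proof (rule has_vector_derivative_integral_dominated[where
          g = "\<lambda>z. 2 * pi * (\<bar>z\<bar> ^ 1 * exp (- (pi * Im \<sigma> * z\<^sup>2)))"])
      show "((\<lambda>t. f t z) has_vector_derivative 2 * of_real pi * \<i> * (of_real z * f t z)) (at t)" for t z
        unfolding f_def
        by (auto intro!: derivative_eq_intros simp: scaleR_conv_of_real)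
      show "norm (2 * of_real pi * \<i> * (of_real z * f t z)) \<le> 2 * pi * (\<bar>z\<bar> ^ 1 * exp (- (pi * Im \<sigma> * z\<^sup>2)))"
        for t z
        unfolding f_def by (simp only: norm_mult norm_e2pi_quadratic) simp
      show "integrable lborel (\<lambda>z. 2 * pi * (\<bar>z\<bar> ^ 1 * exp (- (pi * Im \<sigma> * z\<^sup>2))))"
        using \<sigma> by (intro integrable_mult_right integrable_power_gaussian) simp
    qed (use int in auto)
    have "(LINT z|lborel. 2 * of_real pi * \<i> * (of_real z * \<sigma> + of_real y) * f y z) = 0 - 0"
    proof (rule integral_FTC_whole_line)
      show "(f y has_vector_derivative 2 * of_real pi * \<i> * (of_real z * \<sigma> + of_real y) * f y z) (at z)" for z
        unfolding f_def of_real_power of_real_divide of_real_mult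
        by (rule has_vector_derivative_real_field) (auto intro!: derivative_eq_intros simp: algebra_simps)
      show "continuous_on UNIV (\<lambda>z. 2 * of_real pi * \<i> * (of_real z * \<sigma> + of_real y) * f y z)"
        unfolding f_def by (intro continuous_intros) auto
      have "integrable lborel (\<lambda>z. 2 * of_real pi * \<i> * \<sigma> * (of_real z * f y z)
          + 2 * of_real pi * \<i> * of_real y * f y z)"
        using int by (intro Bochner_Integration.integrable_add integrable_mult_right) auto
      then show "integrable lborel (\<lambda>z. 2 * of_real pi * \<i> * (of_real z * \<sigma> + of_real y) * f y z)"
        by (simp add: algebra_simps)
      show "(f y \<longlongrightarrow> 0) at_bot" "(f y \<longlongrightarrow> 0) at_top"
        using tendsto_e2pi_quadratic[OF \<sigma>, of 0 y] by (simp_all add: f_def[abs_def])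
    qed
    moreover have "(LINT z|lborel. 2 * of_real pi * \<i> * (of_real z * \<sigma> + of_real y) * f y z) =
        \<sigma> * (LINT z|lborel. 2 * of_real pi * \<i> * (of_real z * f y z)) + 2 * of_real pi * \<i> * of_real y * K y"
    proof -
      have "(LINT z|lborel. 2 * of_real pi * \<i> * (of_real z * \<sigma> + of_real y) * f y z) =
        (LINT z|lborel. 2 * of_real pi * \<i> * \<sigma> * (of_real z * f y z)
          + 2 * of_real pi * \<i> * of_real y * f y z)"
        by (simp add: algebra_simps)
      also have "\<dots> = 2 * of_real pi * \<i> * \<sigma> * (LINT z|lborel. of_real z * f y z)
          + 2 * of_real pi * \<i> * of_real y * (LINT z|lborel. f y z)"
        using int by (subst Bochner_Integration.integral_add) auto
      finally show ?thesis by (simp add: K_def)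
    qed
    ultimately have "\<sigma> * (LINT z|lborel. 2 * of_real pi * \<i> * (of_real z * f y z)) =
        - 2 * of_real pi * \<i> * of_real y * K y"
      by (simp only: eq_neg_iff_add_eq_0 minus_mult_left[symmetric] diff_self)
    moreover have "\<sigma> \<noteq> 0" using \<sigma> by auto
    ultimately have "(LINT z|lborel. 2 * of_real pi * \<i> * (of_real z * f y z)) =
        - 2 * of_real pi * \<i> * of_real y / \<sigma> * K y"
      by (simp add: field_simps)
    with deriv show ?thesis by simp
  qed
  have "((\<lambda>y. K y * e2pi (of_real (y\<^sup>2 / 2) / \<sigma>)) has_vector_derivative 0) (at y)" for y
  proof -
    have "((\<lambda>y. e2pi (of_real (y\<^sup>2 / 2) / \<sigma>)) has_vector_derivative
        2 * of_real pi * \<i> * of_real y / \<sigma> * e2pi (of_real (y\<^sup>2 / 2) / \<sigma>)) (at y)"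
      unfolding of_real_power of_real_divide
      by (rule has_vector_derivative_real_field) (use \<sigma> in \<open>auto intro!: derivative_eq_intros\<close>)
    from has_vector_derivative_mult[OF K' this] show ?thesis
      by (simp add: algebra_simps)
  qed
  then have "K y * e2pi (of_real (y\<^sup>2 / 2) / \<sigma>) = K 0 * e2pi (of_real (0\<^sup>2 / 2) / \<sigma>)"
    using has_vector_derivative_zero_constant[of UNIV "\<lambda>y. K y * e2pi (of_real (y\<^sup>2 / 2) / \<sigma>)"]
    by (metis UNIV_I convex_UNIV has_vector_derivative_at_within)
  moreover have "K 0 = gauss_const \<sigma>"
    by (simp add: K_def f_def gauss_const_def)
  moreover have "e2pi (of_real (y\<^sup>2 / 2) / \<sigma>) * e2pi (- of_real (y\<^sup>2 / 2) / \<sigma>) = 1"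
    by (simp flip: e2pi_add)
  ultimately have "K y = gauss_const \<sigma> * e2pi (- of_real (y\<^sup>2 / 2) / \<sigma>)"
    by (metis div_0 e2pi_0 mult.assoc mult.right_neutral of_real_0 zero_power2)
  then show ?thesis
    by (simp only: K_def f_def)
qed

lemma gauss_const_eq:
  assumes \<sigma>: "Im \<sigma> > 0"
  shows "gauss_const \<sigma> = 1 / csqrt (- \<i> * \<sigma>)"
proof -
  (* The integral times the square root of the exponent c is constant along the line Re c = p. *)
  define p where "p = pi * Im \<sigma>"
  have p: "p > 0" using \<sigma> by (simp add: p_def)
  define c where "c t = of_real p + \<i> * of_real t" for t
  have Rec: "Re (c t) = p" for t by (simp add: c_def)
  have cne: "c t \<noteq> 0" "c t \<notin> \<real>\<^sub>\<le>\<^sub>0" for t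
    using p Rec[of t] by (auto simp: complex_nonpos_Reals_iff)
  define f where "f t z = exp (- c t * of_real (z\<^sup>2))" for t and z :: real
  define g where "g t = (LINT z|lborel. f t z)" for t
  have norm_f: "norm (f t z) = exp (- (p * z\<^sup>2))" for t z
    by (simp add: f_def Rec)
  have int: "integrable lborel (\<lambda>z. of_real (z ^ n) * f t z)" for t n
  proof (rule Bochner_Integration.integrable_bound)
    show "integrable lborel (\<lambda>z. \<bar>z\<bar> ^ n * exp (- (p * z\<^sup>2)))"
      using p by (intro integrable_power_gaussian) simp
  qed (auto simp: norm_mult norm_f norm_power, simp add: f_def[abs_def])
  have g': "(g has_vector_derivative - \<i> / (2 * c t) * g t) (at t)" for t
  proof -
    have "(g has_vector_derivative (LINT z|lborel. - \<i> * (of_real (z ^ 2) * f t z))) (at t)"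
      unfolding g_def
    proof (rule has_vector_derivative_integral_dominated[where
          g = "\<lambda>z. \<bar>z\<bar> ^ 2 * exp (- (p * z\<^sup>2))"])
      show "((\<lambda>t. f t z) has_vector_derivative - \<i> * (of_real (z ^ 2) * f t z)) (at t)" for t z
        unfolding f_def c_def
        by (rule has_vector_derivative_real_field) (auto intro!: derivative_eq_intros)
      show "integrable lborel (\<lambda>z. \<bar>z\<bar> ^ 2 * exp (- (p * z\<^sup>2)))"
        using p by (intro integrable_power_gaussian) simp
      show "integrable lborel (f t)" for t
        using int[of 0 t] by simp
      show "norm (- \<i> * (of_real (z\<^sup>2) * f t z)) \<le> \<bar>z\<bar> ^ 2 * exp (- (p * z\<^sup>2))" for t z
        by (simp add: norm_mult norm_f norm_power)
    qed (use int[of 2 t] in auto)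
    \<comment> \<open>The integrand is the derivative of z times \<open>f t z\<close>, so the second
      moment equals \<open>g t / (2 * c t)\<close>.\<close>
    moreover have "(LINT z|lborel. (1 - 2 * c t * of_real (z ^ 2)) * f t z) = 0 - 0"
    proof (rule integral_FTC_whole_line)
      show "((\<lambda>z. of_real z * f t z) has_vector_derivative (1 - 2 * c t * of_real (z ^ 2)) * f t z) (at z)" for z
        unfolding f_def of_real_power
        by (rule has_vector_derivative_real_field)
          (auto intro!: derivative_eq_intros simp: algebra_simps power2_eq_square)
      show "continuous_on UNIV (\<lambda>z. (1 - 2 * c t * of_real (z ^ 2)) * f t z)"
        unfolding f_def by (intro continuous_intros)
      have "integrable lborel (\<lambda>z. of_real (z ^ 0) * f t z - 2 * c t * (of_real (z ^ 2) * f t z))"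
        by (intro Bochner_Integration.integrable_diff integrable_mult_right int)
      then show "integrable lborel (\<lambda>z. (1 - 2 * c t * of_real (z ^ 2)) * f t z)"
        by (simp add: algebra_simps)
      have "norm (of_real z * f t z) = \<bar>z\<bar> ^ 1 * exp (- (p * z\<^sup>2))" for z
        by (simp add: norm_mult norm_f)
      then show "((\<lambda>z. of_real z * f t z) \<longlongrightarrow> 0) at_bot" "((\<lambda>z. of_real z * f t z) \<longlongrightarrow> 0) at_top"
        using tendsto_power_gaussian[OF p, of 1]
        by (subst tendsto_norm_zero_iff[symmetric], simp)+
    qed
    moreover have "(LINT z|lborel. (1 - 2 * c t * of_real (z ^ 2)) * f t z) =
        g t - 2 * c t * (LINT z|lborel. of_real (z ^ 2) * f t z)"
    proof -
      have "(LINT z|lborel. (1 - 2 * c t * of_real (z ^ 2)) * f t z) =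
        (LINT z|lborel. of_real (z ^ 0) * f t z - 2 * c t * (of_real (z ^ 2) * f t z))"
        by (simp add: algebra_simps)
      also have "\<dots> = (LINT z|lborel. of_real (z ^ 0) * f t z) - 2 * c t * (LINT z|lborel. of_real (z ^ 2) * f t z)"
        using int[of 0 t] int[of 2 t] by (subst Bochner_Integration.integral_diff) auto
      finally show ?thesis by (simp add: g_def)
    qed
    ultimately have "g t = 2 * c t * (LINT z|lborel. of_real (z ^ 2) * f t z)"
      "(g has_vector_derivative - \<i> * (LINT z|lborel. of_real (z ^ 2) * f t z)) (at t)"
      by (simp_all del: of_real_power)
    then show ?thesis
      using cne(1)[of t] by simp
  qed
  have "((\<lambda>t. g t * csqrt (c t)) has_vector_derivative 0) (at t)" for t
  proof -
    have "((\<lambda>t. csqrt (c t)) has_vector_derivative \<i> / (2 * csqrt (c t))) (at t)"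
      unfolding c_def using cne(2)[of t]
      by (intro has_vector_derivative_real_field) (auto intro!: derivative_eq_intros simp: c_def)
    from has_vector_derivative_mult[OF g' this] have
      "((\<lambda>t. g t * csqrt (c t)) has_vector_derivative
        g t * (\<i> / (2 * csqrt (c t))) + - \<i> / (2 * c t) * g t * csqrt (c t)) (at t)" .
    moreover have "c t = csqrt (c t) * csqrt (c t)"
      by (metis power2_csqrt power2_eq_square)
    then have "g t * (\<i> / (2 * csqrt (c t))) + - \<i> / (2 * c t) * g t * csqrt (c t) = 0"
      using cne(1)[of t] by (simp add: field_simps)
    ultimately show ?thesis by simp
  qed
  then have const: "g t * csqrt (c t) = g 0 * csqrt (c 0)" for t
    using has_vector_derivative_zero_constant[of UNIV "\<lambda>t. g t * csqrt (c t)"]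
    by (metis UNIV_I convex_UNIV has_vector_derivative_at_within)
  have "g 0 = of_real (LINT z|lborel. exp (- (p * z\<^sup>2)))"
    by (simp add: g_def f_def c_def exp_of_real flip: of_real_mult of_real_minus of_real_power)
  then have "g 0 * csqrt (c 0) = of_real (sqrt pi)"
    using p by (simp add: integral_gaussian c_def real_sqrt_divide csqrt_of_real)
  \<comment> \<open>At this parameter the exponent -c z^2 is pi i \<sigma> z^2, as in
    \<open>gauss_const\<close>, while the parameter 0 gives the real Gaussian.\<close>
  moreover have "c (- (pi * Re \<sigma>)) = of_real pi * (- \<i> * \<sigma>)"
    by (simp add: c_def p_def complex_eq_iff)
  moreover have "csqrt (of_real pi * (- \<i> * \<sigma>)) = of_real (sqrt pi) * csqrt (- \<i> * \<sigma>)"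
    by (rule csqrt_of_real_mult) simp
  moreover have "gauss_const \<sigma> = g (- (pi * Re \<sigma>))"
    unfolding gauss_const_def g_def f_def e2pi_def
    by (intro Bochner_Integration.integral_cong refl arg_cong[where f = exp])
      (simp add: c_def p_def complex_eq_iff)
  ultimately have "gauss_const \<sigma> * (of_real (sqrt pi) * csqrt (- \<i> * \<sigma>)) = of_real (sqrt pi)"
    using const[of "- (pi * Re \<sigma>)"] by simp
  then have "gauss_const \<sigma> * csqrt (- \<i> * \<sigma>) = 1"
    by (simp add: field_simps)
  moreover have "csqrt (- \<i> * \<sigma>) \<noteq> 0"
    using \<sigma> by auto
  ultimately show ?thesis
    by (metis nonzero_eq_divide_eq)
qed

text \<open>The number -i \<tau> lies in the right half-plane, off the branch cut, so the principal
  root commutes with inversion there; replacing \<tau> by -1/\<tau> inverts it.\<close>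

lemma gauss_const_inverse:
  assumes "Im \<tau> > 0"
  shows "gauss_const (- 1 / \<tau>) * gauss_const \<tau> = 1"
proof -
  have \<tau>: "\<tau> \<noteq> 0" "- \<i> * \<tau> \<notin> \<real>\<^sub>\<le>\<^sub>0"
    using assms by (auto simp: complex_nonpos_Reals_iff)
  have "Im (- 1 / \<tau>) > 0"
    using assms by (simp add: Im_divide divide_pos_pos complex_eq_iff sum_power2_gt_zero_iff)
  moreover have "- \<i> * (- 1 / \<tau>) = inverse (- \<i> * \<tau>)"
    using \<tau> by (simp add: field_simps)
  ultimately show ?thesis
    using assms \<tau> csqrt_inverse[OF \<tau>(2)] by (simp add: gauss_const_eq)
qed

text \<open>In the rotated coordinate a the Gaussian has parameter 2 \<sigma>; this brings its
  constant back to that of \<sigma>.\<close>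

lemma gauss_const_double:
  assumes "Im \<sigma> > 0"
  shows "gauss_const (2 * \<sigma>) = gauss_const \<sigma> / of_real (sqrt 2)"
proof -
  have "csqrt (of_real 2 * (- \<i> * \<sigma>)) = of_real (sqrt 2) * csqrt (- \<i> * \<sigma>)"
    by (rule csqrt_of_real_mult) simp
  then show ?thesis
    using assms by (simp add: gauss_const_eq field_simps)
qed

text \<open>One factor comes from the z-integral of \<open>phi_star\<close>, its conjugate from
  \<open>cosine_gaussian\<close>. Only the modulus of the principal root matters, and |C|^2 =
  1/|\<sigma>|.\<close>

lemma gauss_const_mult_cnj:
  assumes "Im \<tau> > 0"
  shows "gauss_const (- 1 / \<tau>) * cnj (gauss_const (- 1 / \<tau>)) = of_real (norm \<tau>)"
proof -
  have "Im (- 1 / \<tau>) > 0"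
    using assms by (simp add: Im_divide divide_pos_pos complex_eq_iff sum_power2_gt_zero_iff)
  then have "norm (gauss_const (- 1 / \<tau>)) = sqrt (norm \<tau>)"
    by (simp add: gauss_const_eq norm_divide norm_mult real_sqrt_divide)
  then show ?thesis
    by (simp add: complex_norm_square[symmetric])
qed

section \<open>The complementary error function and Gaussian primitives\<close>

lemma interval_integral_has_vector_derivative:
  fixes f :: "real \<Rightarrow> 'a :: euclidean_space"
  assumes "continuous_on UNIV f"
  shows "((\<lambda>u. LBINT y=ereal c..ereal u. f y) has_vector_derivative f x) (at x)"
proof -
  \<comment> \<open>An interval containing \<open>c\<close> with \<open>x\<close> in its interior,
    so that the derivative within it is two-sided.\<close>
  define a b where "a = min c x - 1" and "b = max c x + 1"
  have "((\<lambda>u. LBINT y=ereal c..ereal u. f y) has_vector_derivative f x) (at x within {a..b})"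
    by (rule interval_integral_FTC2)
      (auto simp: a_def b_def intro: continuous_on_subset[OF assms])
  moreover have "x \<in> interior {a..b}"
    by (auto simp: a_def b_def)
  ultimately show ?thesis
    by (simp only: at_within_interior)
qed

lemma tendsto_interval_integral_at_top:
  fixes f :: "real \<Rightarrow> 'a :: euclidean_space"
  assumes "integrable lborel f"
  shows "((\<lambda>u. LBINT y=ereal c..ereal u. f y) \<longlongrightarrow> (LINT y:{c..}|lborel. f y)) at_top"
proof -
  have "((\<lambda>u. LINT y:{c..u}|lborel. f y) \<longlongrightarrow> (LINT y:{c..}|lborel. f y)) at_top"
    by (rule tendsto_set_lebesgue_integral_at_top)
      (use assms in \<open>auto simp: set_integrable_def intro: integrable_mult_indicator\<close>)
  moreover have "\<forall>\<^sub>F u in at_top. (LINT y:{c..u}|lborel. f y) = (LBINT y=ereal c..ereal u. f y)"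
    using eventually_ge_at_top[of c] by eventually_elim (simp add: interval_integral_Icc)
  ultimately show ?thesis
    by (rule Lim_transform_eventually)
qed

text \<open>Reflection folds the negative half-line onto the positive one, the origin being a null
  set. By parity this turns Fourier integrals into sine and cosine integrals.\<close>

lemma integral_fold_half_line:
  fixes f :: "real \<Rightarrow> 'a :: euclidean_space"
  assumes f: "integrable lborel f"
  shows "set_integrable lborel {0<..} (\<lambda>x. f x + f (- x))"
    and "(LINT x|lborel. f x) = (LINT x:{0<..}|lborel. f x + f (- x))"
proof -
  have f': "integrable lborel (\<lambda>x. f (- x))"
    using lborel_integrable_real_affine[OF f, of "-1" 0] by simp
  have i1: "integrable lborel (\<lambda>x. indicator {0<..} x *\<^sub>R f x)"
      "integrable lborel (\<lambda>x. indicator {0<..} x *\<^sub>R f (- x))"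
      "integrable lborel (\<lambda>x. indicator {..<0} x *\<^sub>R f x)"
    using f f' by (auto intro!: integrable_mult_indicator)
  then show "set_integrable lborel {0<..} (\<lambda>x. f x + f (- x))"
    by (simp add: set_integrable_def scaleR_add_right)
  have "(LINT x|lborel. f x) =
      (LINT x|lborel. indicator {0<..} x *\<^sub>R f x + indicator {..<0} x *\<^sub>R f x)"
  proof (rule integral_cong_AE)
    show "AE x in lborel. f x = indicator {0<..} x *\<^sub>R f x + indicator {..<0} x *\<^sub>R f x"
      using AE_lborel_singleton[of 0] by eventually_elim (auto simp: indicator_def)
  qed (use f i1 in auto)
  also have "\<dots> = (LINT x|lborel. indicator {0<..} x *\<^sub>R f x) + (LINT x|lborel. indicator {..<0} x *\<^sub>R f x)"
    using i1 by (intro Bochner_Integration.integral_add)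
  also have "(LINT x|lborel. indicator {..<0} x *\<^sub>R f x) = (LINT x|lborel. indicator {0<..} x *\<^sub>R f (- x))"
    using lborel_integral_real_affine[of "-1" "\<lambda>x. indicator {..<0} x *\<^sub>R f x" 0]
    by (simp add: indicator_def)
  finally show "(LINT x|lborel. f x) = (LINT x:{0<..}|lborel. f x + f (- x))"
    using i1 by (simp add: set_lebesgue_integral_def scaleR_add_right)
qed

lemma erfc_0 [simp]: "erfc 0 = 1"
  by (simp add: erfc_def zero_ereal_def[symmetric])

lemma erfc_has_real_derivative:
  "(erfc has_real_derivative - 2 / sqrt pi * exp (- (x\<^sup>2))) (at x)"
proof -
  have "((\<lambda>u. LBINT r=ereal 0..ereal u. exp (- (r\<^sup>2))) has_real_derivative exp (- (x\<^sup>2))) (at x)"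
    unfolding has_real_derivative_iff_has_vector_derivative
    by (rule interval_integral_has_vector_derivative) (intro continuous_intros)
  then have "(erfc has_real_derivative 0 - 2 / sqrt pi * exp (- (x\<^sup>2))) (at x)"
    unfolding erfc_def[abs_def] by (intro DERIV_diff DERIV_const DERIV_cmult)
  then show ?thesis by simp
qed

lemmas erfc_has_real_derivative' [derivative_intros] =
  DERIV_chain2[OF erfc_has_real_derivative]

lemma continuous_on_erfc [continuous_intros]:
  "continuous_on S f \<Longrightarrow> continuous_on S (\<lambda>x. erfc (f x))"
  by (rule continuous_on_compose2[OF DERIV_continuous_on, of UNIV erfc])
    (rule erfc_has_real_derivative has_field_derivative_at_within | simp)+

lemma borel_measurable_erfc [measurable]: "erfc \<in> borel_measurable borel"
  by (intro borel_measurable_continuous_onI continuous_on_erfc continuous_on_id)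

lemma erfc_tendsto_0: "(erfc \<longlongrightarrow> 0) at_top"
proof -
  have "((\<lambda>u. LBINT r=ereal 0..ereal u. exp (- (r\<^sup>2))) \<longlongrightarrow> (LINT r:{0..}|lborel. exp (- (r\<^sup>2)))) at_top"
    by (rule tendsto_interval_integral_at_top) (use integrable_gaussian[of 1] in simp)
  also have "(LINT r:{0..}|lborel. exp (- (r\<^sup>2))) = sqrt pi / 2"
    unfolding set_lebesgue_integral_def
    using gaussian_moment_0 by (rule has_bochner_integral_integral_eq)
  finally have "((\<lambda>u. 1 - 2 / sqrt pi * (LBINT r=ereal 0..ereal u. exp (- (r\<^sup>2)))) \<longlongrightarrow>
      1 - 2 / sqrt pi * (sqrt pi / 2)) at_top"
    by (intro tendsto_intros)
  then show ?thesis
    by (simp add: erfc_def[abs_def])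
qed

lemma antimono_limit_nonneg:
  fixes f :: "real \<Rightarrow> real"
  assumes "\<And>x y. a \<le> x \<Longrightarrow> x \<le> y \<Longrightarrow> f y \<le> f x" "(f \<longlongrightarrow> 0) at_top" "a \<le> x"
  shows "0 \<le> f x"
proof (rule tendsto_upperbound[OF assms(2)])
  show "\<forall>\<^sub>F y in at_top. f y \<le> f x"
    using eventually_ge_at_top[of x] by eventually_elim (rule assms(1)[OF assms(3)])
qed simp

lemma erfc_antimono: "x \<le> y \<Longrightarrow> erfc y \<le> erfc x"
  by (erule DERIV_nonpos_imp_nonincreasing[of x y erfc])
    (rule exI, rule conjI[OF erfc_has_real_derivative], simp)

lemma erfc_nonneg: "0 \<le> erfc x"
  using antimono_limit_nonneg[OF erfc_antimono erfc_tendsto_0 order_refl] by simp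

text \<open>The difference \<open>g\<close> vanishes at 0, increases up to 1/sqrt(pi), and decreases
  from there to its limit 0 at infinity, so it is nonnegative on both ranges.\<close>

lemma erfc_le_exp:
  assumes "0 \<le> x"
  shows "erfc x \<le> exp (- (x\<^sup>2))"
proof -
  define g where "g x = exp (- (x\<^sup>2)) - erfc x" for x
  have g': "(g has_real_derivative 2 * exp (- (x\<^sup>2)) * (1 / sqrt pi - x)) (at x)" for x
    unfolding g_def[abs_def] by (auto intro!: derivative_eq_intros simp: algebra_simps)
  have "0 \<le> g x"
  proof (cases "x \<le> 1 / sqrt pi")
    case True
    have "g 0 \<le> g x"
    proof (rule DERIV_nonneg_imp_nondecreasing[OF assms])
      fix t assume "0 \<le> t" "t \<le> x"
      then show "\<exists>y. (g has_real_derivative y) (at t) \<and> 0 \<le> y"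
        using True by (intro exI[of _ "2 * exp (- (t\<^sup>2)) * (1 / sqrt pi - t)"] conjI g') auto
    qed
    then show ?thesis by (simp add: g_def)
  next
    case False
    have mono: "g z \<le> g y" if "x \<le> y" "y \<le> z" for y z
    proof (rule DERIV_nonpos_imp_nonincreasing[OF that(2)])
      fix t assume "y \<le> t" "t \<le> z"
      then have "2 * exp (- (t\<^sup>2)) * (1 / sqrt pi - t) \<le> 0"
        using False that by (intro mult_nonneg_nonpos) auto
      then show "\<exists>w. (g has_real_derivative w) (at t) \<and> w \<le> 0"
        using g' by blast
    qed
    have "((\<lambda>x::real. exp (- (x\<^sup>2))) \<longlongrightarrow> 0) at_top"
      using tendsto_power_gaussian(1)[of 1 0] by simp
    then have "((\<lambda>x. exp (- (x\<^sup>2)) - erfc x) \<longlongrightarrow> 0 - 0) at_top"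
      by (intro tendsto_diff erfc_tendsto_0)
    then have "(g \<longlongrightarrow> 0) at_top"
      by (simp add: g_def[abs_def])
    from antimono_limit_nonneg[OF mono this] show ?thesis
      by blast
  qed
  then show ?thesis by (simp add: g_def)
qed

definition gauss_primitive :: "complex \<Rightarrow> real \<Rightarrow> complex"
  where "gauss_primitive \<tau> x = (LBINT s=ereal 0..ereal x. e2pi (of_real (s\<^sup>2 / 2) * \<tau>))"

lemma gauss_primitive_0 [simp]: "gauss_primitive \<tau> 0 = 0"
  by (simp add: gauss_primitive_def zero_ereal_def[symmetric])

lemma gauss_primitive_has_vector_derivative:
  "(gauss_primitive \<tau> has_vector_derivative e2pi (of_real (x\<^sup>2 / 2) * \<tau>)) (at x)"
  unfolding gauss_primitive_def[abs_def]
  by (rule interval_integral_has_vector_derivative)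
    (intro continuous_on_e2pi continuous_on_mult continuous_on_of_real continuous_intros; simp)

lemma gauss_primitive_minus: "gauss_primitive \<tau> (- x) = - gauss_primitive \<tau> x"
  unfolding gauss_primitive_def
  by (subst interval_integral_reflect) (simp add: interval_integral_endpoints_reverse[of "ereal x" "ereal 0"])

lemma gauss_primitive_tendsto:
  assumes "Im \<tau> > 0"
  shows "(gauss_primitive \<tau> \<longlongrightarrow> gauss_const \<tau> / 2) at_top"
    and "(gauss_primitive \<tau> \<longlongrightarrow> - (gauss_const \<tau> / 2)) at_bot"
proof -
  let ?f = "\<lambda>s. e2pi (of_real (s\<^sup>2 / 2) * \<tau>)"
  have int: "integrable lborel ?f"
    using integrable_e2pi_quadratic[OF assms, of 0 0] by simp
  have "gauss_const \<tau> = 2 * (LINT s:{0<..}|lborel. ?f s)"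
    using integral_fold_half_line(2)[OF int] by (simp add: gauss_const_def set_lebesgue_integral_def)
  moreover have "(LINT s:{0..}|lborel. ?f s) = (LINT s:{0<..}|lborel. ?f s)"
  proof (rule set_integral_null_delta)
    show "integrable lborel ?f" by fact
    have "{0..} - {0<..} \<union> ({0<..} - {0..}) = {0::real}" by auto
    then show "{0..} - {0<..} \<union> ({0<..} - {0::real..}) \<in> null_sets lborel" by (simp add: finite_imp_null_set_lborel)
  qed auto
  ultimately have "(LINT s:{0..}|lborel. ?f s) = gauss_const \<tau> / 2"
    by simp
  moreover have "((\<lambda>u. LBINT s=ereal 0..ereal u. ?f s) \<longlongrightarrow> (LINT s:{0..}|lborel. ?f s)) at_top"
    by (rule tendsto_interval_integral_at_top[OF int])
  ultimately show *: "(gauss_primitive \<tau> \<longlongrightarrow> gauss_const \<tau> / 2) at_top"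
    by (simp only: gauss_primitive_def[abs_def])
  then have "((\<lambda>x. - gauss_primitive \<tau> x) \<longlongrightarrow> - (gauss_const \<tau> / 2)) at_top"
    by (rule tendsto_minus)
  then show "(gauss_primitive \<tau> \<longlongrightarrow> - (gauss_const \<tau> / 2)) at_bot"
    by (simp add: at_bot_mirror filterlim_filtermap gauss_primitive_minus)
qed

section \<open>The transform of \<open>phi_star\<close>\<close>

lemma
  fixes f g :: "real \<Rightarrow> complex"
  assumes f: "integrable lborel f" and g: "integrable lborel g"
  shows integrable_lborel_product: "integrable lborel (\<lambda>(w, z). f w * g z)"
    and integral_lborel_product:
      "(LINT p|lborel. (case p of (w, z) \<Rightarrow> f w * g z)) = (LINT w|lborel. f w) * (LINT z|lborel. g z)"
proof -
  have *: "integrable (lborel \<Otimes>\<^sub>M lborel) (\<lambda>(w, z). f w * g z)"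
  proof (rule lborel_pair.Fubini_integrable)
    show "(\<lambda>(w, z). f w * g z) \<in> borel_measurable (lborel \<Otimes>\<^sub>M lborel)"
      using f g by measurable
    show "integrable lborel (\<lambda>x. LINT y|lborel. norm (case (x, y) of (w, z) \<Rightarrow> f w * g z))"
      using f by (simp add: norm_mult)
    show "AE x in lborel. integrable lborel (\<lambda>y. case (x, y) of (w, z) \<Rightarrow> f w * g z)"
      using g by simp
  qed
  then show "integrable lborel (\<lambda>(w, z). f w * g z)"
    by (simp add: lborel_prod)
  have "(LINT p|lborel. (case p of (w, z) \<Rightarrow> f w * g z)) = (LINT w|lborel. LINT z|lborel. f w * g z)"
    using lborel_pair.integral_fst'[OF *] by (simp add: lborel_prod)
  then show "(LINT p|lborel. (case p of (w, z) \<Rightarrow> f w * g z)) = (LINT w|lborel. f w) * (LINT z|lborel. g z)"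
    by simp
qed

lemma erfc_minus: "erfc (- x) = 2 - erfc x"
proof -
  have "(LBINT r=ereal 0..ereal (- x). exp (- (r\<^sup>2))) = - (LBINT r=ereal 0..ereal x. exp (- (r\<^sup>2)))"
    by (subst interval_integral_reflect) (simp add: interval_integral_endpoints_reverse[of "ereal x" "ereal 0"])
  then show ?thesis by (simp add: erfc_def)
qed

text \<open>The right side is smooth across 0. Differential equations can therefore be checked on
  the whole line, and sign and absolute value restored afterwards.\<close>

lemma sgn_mult_erfc: "sgn x * (1 - erfc (k * \<bar>x\<bar>)) = 1 - erfc (k * x)"
  by (cases "x < 0"; cases "x = 0") (auto simp: erfc_minus)

text \<open>The part of \<open>phi_star\<close> that depends on w alone; the remaining factor is a
  Gaussian in z.\<close>

definition erfc_factor :: "complex \<Rightarrow> real \<Rightarrow> complex"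
  where "erfc_factor \<sigma> w =
    e2pi (- of_real (w\<^sup>2 / 2) * \<sigma>) * of_real (sgn w * erfc (sqrt (2 * pi * Im \<sigma>) * \<bar>w\<bar>))"

lemma erfc_factor_minus: "erfc_factor \<sigma> (- w) = - erfc_factor \<sigma> w"
  by (simp add: erfc_factor_def sgn_minus)

text \<open>The exponential grows like exp(pi Im(\<sigma>) w^2), but by \<open>erfc_le_exp\<close>
  the error function decays at twice that rate.\<close>

lemma norm_erfc_factor_le:
  assumes "Im \<sigma> > 0"
  shows "norm (erfc_factor \<sigma> w) \<le> exp (- (pi * Im \<sigma> * w\<^sup>2))"
proof -
  let ?e = "erfc (sqrt (2 * pi * Im \<sigma>) * \<bar>w\<bar>)"
  have "?e \<le> exp (- ((sqrt (2 * pi * Im \<sigma>) * \<bar>w\<bar>)\<^sup>2))"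
    using assms by (intro erfc_le_exp) auto
  also have "(sqrt (2 * pi * Im \<sigma>) * \<bar>w\<bar>)\<^sup>2 = 2 * pi * Im \<sigma> * w\<^sup>2"
    using assms by (simp add: power_mult_distrib)
  finally have e: "?e \<le> exp (- (2 * pi * Im \<sigma> * w\<^sup>2))" .
  have "norm (erfc_factor \<sigma> w) = exp (pi * Im \<sigma> * w\<^sup>2) * (\<bar>sgn w\<bar> * ?e)"
    by (simp only: erfc_factor_def norm_mult norm_e2pi norm_of_real abs_mult abs_of_nonneg[OF erfc_nonneg])
      (simp add: mult_ac)
  also have "\<dots> \<le> exp (pi * Im \<sigma> * w\<^sup>2) * (1 * exp (- (2 * pi * Im \<sigma> * w\<^sup>2)))"
    using e by (intro mult_left_mono mult_mono) (auto simp: abs_sgn_eq erfc_nonneg)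
  also have "\<dots> = exp (- (pi * Im \<sigma> * w\<^sup>2))"
    by (simp add: exp_add[symmetric] algebra_simps)
  finally show ?thesis .
qed

lemma borel_measurable_erfc_factor [measurable]: "erfc_factor \<sigma> \<in> borel_measurable borel"
  unfolding erfc_factor_def[abs_def] by measurable

lemma integrable_erfc_factor_bounded:
  assumes "Im \<sigma> > 0" and [measurable]: "f \<in> borel_measurable borel"
    and "\<And>w. norm (f w) \<le> \<bar>w\<bar> ^ n"
  shows "integrable lborel (\<lambda>w. erfc_factor \<sigma> w * f w)"
proof (rule Bochner_Integration.integrable_bound)
  show "integrable lborel (\<lambda>w. \<bar>w\<bar> ^ n * exp (- (pi * Im \<sigma> * w\<^sup>2)))"
    using assms(1) by (intro integrable_power_gaussian) simp
  show "AE w in lborel. norm (erfc_factor \<sigma> w * f w) \<le> norm (\<bar>w\<bar> ^ n * exp (- (pi * Im \<sigma> * w\<^sup>2)))"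
  proof (rule AE_I2)
    fix w
    have "norm (erfc_factor \<sigma> w) * norm (f w) \<le> exp (- (pi * Im \<sigma> * w\<^sup>2)) * \<bar>w\<bar> ^ n"
      by (intro mult_mono norm_erfc_factor_le assms) auto
    then show "norm (erfc_factor \<sigma> w * f w) \<le> norm (\<bar>w\<bar> ^ n * exp (- (pi * Im \<sigma> * w\<^sup>2)))"
      by (simp add: norm_mult mult.commute)
  qed
qed measurable

text \<open>\<open>erfc_factor\<close> is odd, so its Fourier transform is -2 i times this integral.
  Restricting to the positive half-line puts the jump at 0 at an endpoint, where it becomes a
  boundary term.\<close>

definition sine_transform :: "complex \<Rightarrow> real \<Rightarrow> complex"
  where "sine_transform \<sigma> x =
    (LINT w|lborel. indicator {0<..} w *\<^sub>R (erfc_factor \<sigma> w * of_real (sin (2 * pi * w * x))))"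

lemma fourier_erfc_factor:
  assumes "Im \<sigma> > 0"
  shows "(LINT w|lborel. erfc_factor \<sigma> w * e2pi (of_real (- (w * x)))) = - 2 * \<i> * sine_transform \<sigma> x"
proof -
  have int: "integrable lborel (\<lambda>w. erfc_factor \<sigma> w * e2pi (of_real (- (w * x))))"
    by (rule integrable_erfc_factor_bounded[OF assms, where n = 0]) (measurable, simp add: norm_e2pi)
  have "erfc_factor \<sigma> w * e2pi (of_real (- (w * x))) + erfc_factor \<sigma> (- w) * e2pi (of_real (- (- w * x))) =
      (- 2 * \<i>) * (erfc_factor \<sigma> w * of_real (sin (2 * pi * w * x)))" for w
  proof -
    have "e2pi (of_real (- (w * x))) - e2pi (of_real (w * x)) = (- 2 * \<i>) * of_real (sin (2 * pi * w * x))"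
      unfolding e2pi_def by (simp add: complex_eq_iff Re_exp Im_exp algebra_simps)
    then have "erfc_factor \<sigma> w * (e2pi (of_real (- (w * x))) - e2pi (of_real (w * x))) =
        erfc_factor \<sigma> w * ((- 2 * \<i>) * of_real (sin (2 * pi * w * x)))"
      by (rule arg_cong)
    then show ?thesis
      by (simp add: erfc_factor_minus right_diff_distrib mult.left_commute)
  qed
  then have "(LINT w|lborel. erfc_factor \<sigma> w * e2pi (of_real (- (w * x)))) =
      (LINT w|lborel. (- 2 * \<i>) * (indicator {0<..} w *\<^sub>R (erfc_factor \<sigma> w * of_real (sin (2 * pi * w * x)))))"
    using integral_fold_half_line(2)[OF int]
    by (simp only: set_lebesgue_integral_def mult_scaleR_right)
  then show ?thesis
    by (simp only: sine_transform_def integral_mult_right_zero)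
qed

text \<open>The derivative of the error function supplies exp(-2 pi Im(\<sigma>) w^2), and this
  factor replaces \<sigma> by its conjugate in the exponential. The inhomogeneous term is thus a
  decaying Gaussian.\<close>

lemma erfc_factor_has_vector_derivative:
  assumes \<sigma>: "Im \<sigma> > 0" and w: "w > 0"
  shows "(erfc_factor \<sigma> has_vector_derivative
    - 2 * of_real pi * \<i> * of_real w * \<sigma> * erfc_factor \<sigma> w
      - of_real (2 * sqrt (2 * Im \<sigma>)) * e2pi (- of_real (w\<^sup>2 / 2) * cnj \<sigma>)) (at w)"
proof -
  define c where "c = sqrt (2 * pi * Im \<sigma>)"
  \<comment> \<open>On the positive half-line \<open>H\<close> is \<open>erfc_factor\<close>
    \<sigma> without sign and absolute value, hence differentiable by the product rule.\<close>
  define H where "H w = e2pi (- of_real (w\<^sup>2 / 2) * \<sigma>) * of_real (erfc (c * w))" for w :: real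
  have c: "c\<^sup>2 = 2 * pi * Im \<sigma>" "c * (2 / sqrt pi) = 2 * sqrt (2 * Im \<sigma>)"
    using \<sigma> by (simp_all add: c_def) (simp add: real_sqrt_mult)
  have "((\<lambda>w. erfc (c * w)) has_real_derivative - 2 / sqrt pi * exp (- ((c * w)\<^sup>2)) * c) (at w)"
    by (auto intro!: derivative_eq_intros)
  then have d1: "((\<lambda>w. complex_of_real (erfc (c * w))) has_vector_derivative
      of_real (- 2 / sqrt pi * exp (- ((c * w)\<^sup>2)) * c)) (at w)"
    by (intro has_vector_derivative_of_real)
      (simp add: has_real_derivative_iff_has_vector_derivative)
  have d2: "((\<lambda>w. e2pi (- of_real (w\<^sup>2 / 2) * \<sigma>)) has_vector_derivative
      - 2 * of_real pi * \<i> * of_real w * \<sigma> * e2pi (- of_real (w\<^sup>2 / 2) * \<sigma>)) (at w)"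
    unfolding of_real_power of_real_divide
    by (rule has_vector_derivative_real_field) (auto intro!: derivative_eq_intros)
  have e: "e2pi (- of_real (w\<^sup>2 / 2) * \<sigma>) * of_real (exp (- ((c * w)\<^sup>2))) = e2pi (- of_real (w\<^sup>2 / 2) * cnj \<sigma>)"
  proof -
    have "of_real (exp (- ((c * w)\<^sup>2))) = e2pi (\<i> * of_real (Im \<sigma> * w\<^sup>2))"
      by (simp add: e2pi_def exp_of_real[symmetric] power_mult_distrib c mult_ac)
    moreover have "- of_real (w\<^sup>2 / 2) * \<sigma> + \<i> * of_real (Im \<sigma> * w\<^sup>2) = - of_real (w\<^sup>2 / 2) * cnj \<sigma>"
      by (simp add: complex_eq_iff)
    ultimately show ?thesis by (simp flip: e2pi_add)
  qed
  have "(H has_vector_derivative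
      e2pi (- of_real (w\<^sup>2 / 2) * \<sigma>) * of_real (- 2 / sqrt pi * exp (- ((c * w)\<^sup>2)) * c)
      + - 2 * of_real pi * \<i> * of_real w * \<sigma> * e2pi (- of_real (w\<^sup>2 / 2) * \<sigma>) * of_real (erfc (c * w))) (at w)"
    unfolding H_def[abs_def] by (rule has_vector_derivative_mult[OF d2 d1])
  also have "e2pi (- of_real (w\<^sup>2 / 2) * \<sigma>) * of_real (- 2 / sqrt pi * exp (- ((c * w)\<^sup>2)) * c)
      = - (of_real (c * (2 / sqrt pi)) * (e2pi (- of_real (w\<^sup>2 / 2) * \<sigma>) * of_real (exp (- ((c * w)\<^sup>2)))))"
    by simp
  also have "\<dots> = - (of_real (2 * sqrt (2 * Im \<sigma>)) * e2pi (- of_real (w\<^sup>2 / 2) * cnj \<sigma>))"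
    by (simp only: c e)
  finally have "(H has_vector_derivative
      - (of_real (2 * sqrt (2 * Im \<sigma>)) * e2pi (- of_real (w\<^sup>2 / 2) * cnj \<sigma>))
      + - 2 * of_real pi * \<i> * of_real w * \<sigma> * e2pi (- of_real (w\<^sup>2 / 2) * \<sigma>) * of_real (erfc (c * w))) (at w)" .
  then have "(H has_vector_derivative
     - 2 * of_real pi * \<i> * of_real w * \<sigma> * H w
      - of_real (2 * sqrt (2 * Im \<sigma>)) * e2pi (- of_real (w\<^sup>2 / 2) * cnj \<sigma>)) (at w)"
    by (rule has_vector_derivative_eq_rhs) (simp add: H_def algebra_simps)
  from this have "(erfc_factor \<sigma> has_vector_derivative
     - 2 * of_real pi * \<i> * of_real w * \<sigma> * H w
      - of_real (2 * sqrt (2 * Im \<sigma>)) * e2pi (- of_real (w\<^sup>2 / 2) * cnj \<sigma>)) (at w)"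
    by (rule has_vector_derivative_transform_within_open[where S = "{0<..}"])
      (use w in \<open>simp_all add: H_def erfc_factor_def c_def\<close>)
  moreover have "H w = erfc_factor \<sigma> w"
    using w by (simp add: H_def erfc_factor_def c_def)
  ultimately show ?thesis by simp
qed

text \<open>The exponential with the conjugate of \<sigma> is the conjugate of the Gaussian in
  \<open>gaussian_fourier\<close>; folding that integral onto the half-line leaves the
  cosine.\<close>

lemma cosine_gaussian:
  assumes "Im \<sigma> > 0"
  shows "set_integrable lborel {0<..} (\<lambda>w. e2pi (- of_real (w\<^sup>2 / 2) * cnj \<sigma>) * of_real (cos (2 * pi * w * x)))"
    and "2 * (LINT w:{0<..}|lborel. e2pi (- of_real (w\<^sup>2 / 2) * cnj \<sigma>) * of_real (cos (2 * pi * w * x))) =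
      cnj (gauss_const \<sigma> * e2pi (- of_real (x\<^sup>2 / 2) / \<sigma>))"
proof -
  let ?f = "\<lambda>w. e2pi (of_real (w\<^sup>2 / 2) * \<sigma> + of_real (x * w))"
  have int: "integrable lborel (\<lambda>w. cnj (?f w))"
    using integrable_e2pi_quadratic[OF assms, of 0 x] by simp
  have eq: "cnj (?f w) + cnj (?f (- w)) =
      2 * (e2pi (- of_real (w\<^sup>2 / 2) * cnj \<sigma>) * of_real (cos (2 * pi * w * x)))" for w
  proof -
    have "cnj (?f w) = e2pi (- of_real (w\<^sup>2 / 2) * cnj \<sigma>) * e2pi (of_real (- (w * x)))" for w
      by (simp add: cnj_e2pi e2pi_add[symmetric] algebra_simps)
    moreover have "e2pi (of_real (- (w * x))) + e2pi (of_real (- (- w * x))) = 2 * of_real (cos (2 * pi * w * x))"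
      unfolding e2pi_def by (simp add: complex_eq_iff Re_exp Im_exp algebra_simps)
    moreover have "cnj (?f (- w)) = e2pi (- of_real (w\<^sup>2 / 2) * cnj \<sigma>) * e2pi (of_real (- (- w * x)))"
      by (simp add: cnj_e2pi e2pi_add[symmetric] algebra_simps)
    ultimately have "cnj (?f w) + cnj (?f (- w)) =
        e2pi (- of_real (w\<^sup>2 / 2) * cnj \<sigma>) * (2 * of_real (cos (2 * pi * w * x)))"
      by (metis distrib_left)
    then show ?thesis by (simp only: mult_ac)
  qed
  have "set_integrable lborel {0<..} (\<lambda>w. (1 / 2) * (cnj (?f w) + cnj (?f (- w))))"
    by (intro set_integrable_mult_right integral_fold_half_line(1) int)
  then show "set_integrable lborel {0<..} (\<lambda>w. e2pi (- of_real (w\<^sup>2 / 2) * cnj \<sigma>) * of_real (cos (2 * pi * w * x)))"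
    unfolding eq by simp
  have "cnj (gauss_const \<sigma> * e2pi (- of_real (x\<^sup>2 / 2) / \<sigma>)) = (LINT w|lborel. cnj (?f w))"
    by (simp only: gaussian_fourier[OF assms, symmetric] Bochner_Integration.integral_cnj)
  also have "\<dots> = (LINT w:{0<..}|lborel. cnj (?f w) + cnj (?f (- w)))"
    by (rule integral_fold_half_line(2)[OF int])
  also have "\<dots> = 2 * (LINT w:{0<..}|lborel. e2pi (- of_real (w\<^sup>2 / 2) * cnj \<sigma>) * of_real (cos (2 * pi * w * x)))"
    unfolding eq by simp
  finally show "2 * (LINT w:{0<..}|lborel. e2pi (- of_real (w\<^sup>2 / 2) * cnj \<sigma>) * of_real (cos (2 * pi * w * x))) =
      cnj (gauss_const \<sigma> * e2pi (- of_real (x\<^sup>2 / 2) / \<sigma>))" by simp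
qed

lemma sine_transform_0 [simp]: "sine_transform \<sigma> 0 = 0"
  by (simp add: sine_transform_def)

text \<open>Differentiation under the integral gives \<open>T\<close>, the integral of 2 pi w cos(2
  pi w x) against \<open>erfc_factor\<close>. Integrating the w-derivative of
  \<open>erfc_factor\<close> times the cosine produces i \<sigma> \<open>T\<close>, the integral of
  \<open>cosine_gaussian\<close> and the sine transform itself, balanced by the boundary term 1 from
  the jump at 0.\<close>

lemma sine_transform_has_vector_derivative:
  assumes \<sigma>: "Im \<sigma> > 0"
  shows "(sine_transform \<sigma> has_vector_derivative
    (1 - of_real (sqrt (2 * Im \<sigma>)) * cnj (gauss_const \<sigma> * e2pi (- of_real (x\<^sup>2 / 2) / \<sigma>))
      - of_real (2 * pi * x) * sine_transform \<sigma> x) / (\<i> * \<sigma>)) (at x)"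
proof -
  let ?h = "erfc_factor \<sigma>"
  let ?D = "\<lambda>x w. indicator {0<..} w *\<^sub>R (?h w * of_real (2 * pi * w * cos (2 * pi * w * x)))"
  let ?g = "\<lambda>w. e2pi (- of_real (w\<^sup>2 / 2) * cnj \<sigma>)"
  define T where "T = (LINT w|lborel. ?D x w)"
  have intS: "integrable lborel (\<lambda>w. indicator {0<..} w *\<^sub>R (?h w * of_real (sin (2 * pi * w * x))))" for x
    by (intro integrable_mult_indicator integrable_erfc_factor_bounded[OF \<sigma>, where n = 0]) auto
  have intD: "integrable lborel (?D x)" for x
  proof -
    have "integrable lborel (\<lambda>w. of_real (2 * pi) *
        (indicator {0<..} w *\<^sub>R (?h w * of_real (w * cos (2 * pi * w * x)))))"
      by (intro integrable_mult_right integrable_mult_indicator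
            integrable_erfc_factor_bounded[OF \<sigma>, where n = 1])
        (auto simp: norm_mult intro: mult_left_le)
    then show ?thesis
      by (simp add: mult_ac)
  qed
  have "(sine_transform \<sigma> has_vector_derivative T) (at x)"
    unfolding T_def sine_transform_def[abs_def]
  proof (rule has_vector_derivative_integral_dominated[where
        g = "\<lambda>w. 2 * pi * (\<bar>w\<bar> ^ 1 * exp (- (pi * Im \<sigma> * w\<^sup>2)))"])
    show "((\<lambda>t. indicator {0<..} w *\<^sub>R (?h w * of_real (sin (2 * pi * w * t)))) has_vector_derivative ?D t w) (at t)"
      for t w
    proof -
      have "((\<lambda>t. sin (2 * pi * w * t)) has_real_derivative 2 * pi * w * cos (2 * pi * w * t)) (at t)"
        by (auto intro!: derivative_eq_intros)
      then have "((\<lambda>t. complex_of_real (sin (2 * pi * w * t))) has_vector_derivative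
          of_real (2 * pi * w * cos (2 * pi * w * t))) (at t)"
        by (intro has_vector_derivative_of_real) (simp add: has_real_derivative_iff_has_vector_derivative)
      then have "((\<lambda>t. ?h w * of_real (sin (2 * pi * w * t))) has_vector_derivative
          ?h w * of_real (2 * pi * w * cos (2 * pi * w * t))) (at t)"
        by (rule has_vector_derivative_mult_right)
      then show ?thesis
        by (auto simp: indicator_def)
    qed
    show "norm (?D t w) \<le> 2 * pi * (\<bar>w\<bar> ^ 1 * exp (- (pi * Im \<sigma> * w\<^sup>2)))" for t w
    proof -
      have "norm (?D t w) \<le> norm (?h w * of_real (2 * pi * w * cos (2 * pi * w * t)))"
        by (simp add: indicator_def)
      also have "\<dots> = norm (?h w) * (2 * pi * \<bar>w\<bar> * \<bar>cos (2 * pi * w * t)\<bar>)"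
        by (simp add: norm_mult abs_mult)
      also have "\<dots> \<le> exp (- (pi * Im \<sigma> * w\<^sup>2)) * (2 * pi * \<bar>w\<bar> * 1)"
        by (intro mult_mono norm_erfc_factor_le \<sigma>) auto
      finally show ?thesis by (simp add: mult_ac)
    qed
    show "integrable lborel (\<lambda>w. 2 * pi * (\<bar>w\<bar> ^ 1 * exp (- (pi * Im \<sigma> * w\<^sup>2))))"
      using \<sigma> by (intro integrable_mult_right integrable_power_gaussian) simp
  qed (use intS intD in auto)
  moreover have "T = (1 - of_real (sqrt (2 * Im \<sigma>)) * cnj (gauss_const \<sigma> * e2pi (- of_real (x\<^sup>2 / 2) / \<sigma>))
      - of_real (2 * pi * x) * sine_transform \<sigma> x) / (\<i> * \<sigma>)"
  proof -
    let ?F' = "\<lambda>w. - (\<i> * \<sigma>) * (?h w * of_real (2 * pi * w * cos (2 * pi * w * x)))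
        - of_real (2 * sqrt (2 * Im \<sigma>)) * (?g w * of_real (cos (2 * pi * w * x)))
        - of_real (2 * pi * x) * (?h w * of_real (sin (2 * pi * w * x)))"
    have int': "set_integrable lborel {0<..} (\<lambda>w. ?h w * of_real (2 * pi * w * cos (2 * pi * w * x)))"
      "set_integrable lborel {0<..} (\<lambda>w. ?h w * of_real (sin (2 * pi * w * x)))"
      using intS[of x] intD[of x] by (simp_all add: set_integrable_def)
    have "(LINT w:{0<..}|lborel. ?F' w) = 0 - 1"
    proof (rule integral_FTC_half_line)
      fix w :: real assume w: "w > 0"
      have "((\<lambda>w. cos (2 * pi * w * x)) has_real_derivative - (2 * pi * x) * sin (2 * pi * w * x)) (at w)"
        by (auto intro!: derivative_eq_intros)
      then have "((\<lambda>w. complex_of_real (cos (2 * pi * w * x))) has_vector_derivative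
          of_real (- (2 * pi * x) * sin (2 * pi * w * x))) (at w)"
        by (intro has_vector_derivative_of_real) (simp add: has_real_derivative_iff_has_vector_derivative)
      from has_vector_derivative_mult[OF erfc_factor_has_vector_derivative[OF \<sigma> w] this]
      show "((\<lambda>w. ?h w * of_real (cos (2 * pi * w * x))) has_vector_derivative ?F' w) (at w)"
        by (rule has_vector_derivative_eq_rhs) (simp add: algebra_simps)
      have "isCont ?h w"
        using erfc_factor_has_vector_derivative[OF \<sigma> w] has_vector_derivative_continuous by blast
      then show "isCont ?F' w"
        by (intro continuous_intros) auto
    next
      show "set_integrable lborel {0<..} ?F'"
        by (intro set_integral_diff set_integrable_mult_right int' cosine_gaussian \<sigma>)
    next
      \<comment> \<open>Since \<open>sgn 0 = 0\<close>, \<open>erfc_factor\<close> vanishes at 0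
        although its right limit is 1; the limit is computed from the continuous expression without
        the sign.\<close>
      have "((\<lambda>w. e2pi (- of_real (w\<^sup>2 / 2) * \<sigma>) * of_real (erfc (sqrt (2 * pi * Im \<sigma>) * w))
          * of_real (cos (2 * pi * w * x))) \<longlongrightarrow>
          e2pi (- of_real (0\<^sup>2 / 2) * \<sigma>) * of_real (erfc (sqrt (2 * pi * Im \<sigma>) * 0))
          * of_real (cos (2 * pi * 0 * x))) (at_right 0)"
        by (intro tendsto_intros isCont_tendsto_compose[OF DERIV_isCont[OF erfc_has_real_derivative]]) simp_all
      moreover have "\<forall>\<^sub>F w in at_right 0. e2pi (- of_real (w\<^sup>2 / 2) * \<sigma>) *
          of_real (erfc (sqrt (2 * pi * Im \<sigma>) * w)) * of_real (cos (2 * pi * w * x)) =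
          ?h w * of_real (cos (2 * pi * w * x))"
        using eventually_at_right_less[of 0] by eventually_elim (simp add: erfc_factor_def)
      ultimately have "((\<lambda>w. ?h w * of_real (cos (2 * pi * w * x))) \<longlongrightarrow>
          e2pi (- of_real (0\<^sup>2 / 2) * \<sigma>) * of_real (erfc (sqrt (2 * pi * Im \<sigma>) * 0))
          * of_real (cos (2 * pi * 0 * x))) (at_right 0)"
        by (rule Lim_transform_eventually)
      then show "((\<lambda>w. ?h w * of_real (cos (2 * pi * w * x))) \<longlongrightarrow> 1) (at_right 0)"
        by simp
    next
      have lim: "((\<lambda>w. exp (- (pi * Im \<sigma> * w\<^sup>2))) \<longlongrightarrow> 0) at_top"
        using tendsto_power_gaussian(1)[of "pi * Im \<sigma>" 0] \<sigma> by simp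
      have bound: "norm (?h w * of_real (cos (2 * pi * w * x))) \<le> exp (- (pi * Im \<sigma> * w\<^sup>2))" for w
      proof -
        have "norm (?h w * of_real (cos (2 * pi * w * x))) \<le> exp (- (pi * Im \<sigma> * w\<^sup>2)) * 1"
          unfolding norm_mult by (intro mult_mono norm_erfc_factor_le \<sigma>) auto
        then show ?thesis by simp
      qed
      show "((\<lambda>w. ?h w * of_real (cos (2 * pi * w * x))) \<longlongrightarrow> 0) at_top"
        by (rule Lim_null_comparison[OF _ lim], rule always_eventually, rule allI, rule bound)
    qed
    also have "(LINT w:{0<..}|lborel. ?F' w) =
        - (\<i> * \<sigma>) * (LINT w:{0<..}|lborel. ?h w * of_real (2 * pi * w * cos (2 * pi * w * x)))
        - of_real (2 * sqrt (2 * Im \<sigma>)) * (LINT w:{0<..}|lborel. ?g w * of_real (cos (2 * pi * w * x)))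
        - of_real (2 * pi * x) * (LINT w:{0<..}|lborel. ?h w * of_real (sin (2 * pi * w * x)))"
      by (subst set_integral_diff, intro set_integral_diff set_integrable_mult_right int' cosine_gaussian \<sigma>,
          intro set_integral_diff set_integrable_mult_right int' cosine_gaussian \<sigma>,
          subst set_integral_diff, intro set_integral_diff set_integrable_mult_right int' cosine_gaussian \<sigma>,
          intro set_integral_diff set_integrable_mult_right int' cosine_gaussian \<sigma>,
          simp only: set_integral_mult_right)
    also have "(LINT w:{0<..}|lborel. ?h w * of_real (2 * pi * w * cos (2 * pi * w * x))) = T"
      by (simp add: T_def set_lebesgue_integral_def)
    also have "(LINT w:{0<..}|lborel. ?h w * of_real (sin (2 * pi * w * x))) = sine_transform \<sigma> x"
      by (simp add: sine_transform_def set_lebesgue_integral_def)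
    also have "of_real (2 * sqrt (2 * Im \<sigma>)) * (LINT w:{0<..}|lborel. ?g w * of_real (cos (2 * pi * w * x))) =
        of_real (sqrt (2 * Im \<sigma>)) * cnj (gauss_const \<sigma> * e2pi (- of_real (x\<^sup>2 / 2) / \<sigma>))"
      by (simp only: cosine_gaussian(2)[OF \<sigma>, symmetric] of_real_mult of_real_numeral mult_ac)
    finally have "\<i> * \<sigma> * T = 1 - of_real (sqrt (2 * Im \<sigma>)) * cnj (gauss_const \<sigma> * e2pi (- of_real (x\<^sup>2 / 2) / \<sigma>))
        - of_real (2 * pi * x) * sine_transform \<sigma> x"
      by (simp add: algebra_simps)
    moreover have "\<i> * \<sigma> \<noteq> 0" using \<sigma> by auto
    ultimately show ?thesis
      by (metis nonzero_mult_div_cancel_left)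
  qed
  ultimately show ?thesis by simp
qed

text \<open>Both sides vanish at x = 0 and have the same derivative. The factor e(x^2 \<tau> / 2) is
  an integrating factor: its derivative cancels the term of
  \<open>sine_transform_has_vector_derivative\<close> that contains the sine transform. The rest is
  2 \<tau> C e(x^2 \<tau> / 2) minus a real Gaussian times \<tau>, and these integrate to the
  primitive and to the error function.\<close>

lemma sine_transform_eq:
  assumes \<tau>: "Im \<tau> > 0"
  shows "gauss_const (- 1 / \<tau>) * (- 2 * \<i> * sine_transform (- 1 / \<tau>) x) * e2pi (of_real (x\<^sup>2 / 2) * \<tau>) =
    \<tau> * (2 * gauss_const (- 1 / \<tau>) * gauss_primitive \<tau> x - (1 - of_real (erfc (sqrt (2 * pi * Im \<tau>) * x))))"
proof -
  define \<sigma> where "\<sigma> = - 1 / \<tau>"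
  define C where "C = gauss_const \<sigma>"
  define k where "k = sqrt (2 * pi * Im \<tau>)"
  have [simp]: "\<tau> \<noteq> 0" using \<tau> by auto
  have \<sigma>: "Im \<sigma> > 0" "\<sigma> \<noteq> 0" "1 / \<sigma> = - \<tau>"
    and Im_\<sigma>: "Im \<sigma> = Im \<tau> / (norm \<tau>)\<^sup>2"
    using \<tau> by (simp_all add: \<sigma>_def Im_divide cmod_power2 divide_pos_pos complex_eq_iff sum_power2_gt_zero_iff)
  have k: "k\<^sup>2 = 2 * pi * Im \<tau>" "2 / sqrt pi * k = 2 * sqrt (2 * Im \<tau>)"
    using \<tau> by (simp_all add: k_def) (simp add: real_sqrt_mult)
  let ?E = "\<lambda>x. e2pi (of_real (x\<^sup>2 / 2) * \<tau>)"
  let ?S = "sine_transform \<sigma>"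
  define D where "D x = C * (- 2 * \<i> * ?S x) * ?E x
    - \<tau> * (2 * C * gauss_primitive \<tau> x - (1 - of_real (erfc (k * x))))" for x
  have "(D has_vector_derivative 0) (at x)" for x
  proof -
    have dE: "(?E has_vector_derivative 2 * of_real pi * \<i> * of_real x * \<tau> * ?E x) (at x)"
      unfolding of_real_power of_real_divide
      by (rule has_vector_derivative_real_field) (auto intro!: derivative_eq_intros)
    have dS: "(?S has_vector_derivative \<i> * \<tau> * (1 - of_real (sqrt (2 * Im \<sigma>)) * cnj (C * ?E x)
        - of_real (2 * pi * x) * ?S x)) (at x)"
    proof (rule has_vector_derivative_eq_rhs[OF sine_transform_has_vector_derivative[OF \<sigma>(1)]])
      have "- of_real (x\<^sup>2 / 2) / \<sigma> = of_real (x\<^sup>2 / 2) * \<tau>"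
        by (simp add: \<sigma>_def)
      moreover have "z / (\<i> * \<sigma>) = \<i> * \<tau> * z" for z
        by (simp add: \<sigma>_def field_simps)
      ultimately show "(1 - of_real (sqrt (2 * Im \<sigma>)) * cnj (gauss_const \<sigma> * e2pi (- of_real (x\<^sup>2 / 2) / \<sigma>))
          - of_real (2 * pi * x) * ?S x) / (\<i> * \<sigma>) =
        \<i> * \<tau> * (1 - of_real (sqrt (2 * Im \<sigma>)) * cnj (C * ?E x) - of_real (2 * pi * x) * ?S x)"
        by (simp only: C_def)
    qed
    have "((\<lambda>x. erfc (k * x)) has_real_derivative - 2 / sqrt pi * exp (- ((k * x)\<^sup>2)) * k) (at x)"
      by (auto intro!: derivative_eq_intros)
    then have derfc: "((\<lambda>x. complex_of_real (erfc (k * x))) has_vector_derivative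
        of_real (- 2 / sqrt pi * exp (- ((k * x)\<^sup>2)) * k)) (at x)"
      by (intro has_vector_derivative_of_real) (simp add: has_real_derivative_iff_has_vector_derivative)
    have dD: "(D has_vector_derivative
        C * (- 2 * \<i> * ?S x) * (2 * of_real pi * \<i> * of_real x * \<tau> * ?E x) +
        C * (- 2 * \<i> * (\<i> * \<tau> * (1 - of_real (sqrt (2 * Im \<sigma>)) * cnj (C * ?E x)
          - of_real (2 * pi * x) * ?S x))) * ?E x
        - \<tau> * (2 * C * ?E x - (0 - of_real (- 2 / sqrt pi * exp (- ((k * x)\<^sup>2)) * k)))) (at x)"
      unfolding D_def[abs_def]
      by (intro has_vector_derivative_diff has_vector_derivative_mult has_vector_derivative_mult_right
          has_vector_derivative_const dE dS derfc gauss_primitive_has_vector_derivative)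
    \<comment> \<open>Im(\<sigma>) = Im(\<tau>)/|\<tau>|^2 and |C|^2 = |\<tau>| combine to exactly
      the coefficient in the derivative of the error function.\<close>
    have e1: "of_real (sqrt (2 * Im \<sigma>)) * C * cnj C = of_real (sqrt (2 * Im \<tau>))"
    proof -
      have "C * cnj C = of_real (norm \<tau>)"
        unfolding C_def \<sigma>_def by (rule gauss_const_mult_cnj[OF \<tau>])
      moreover have "sqrt (2 * Im \<sigma>) * norm \<tau> = sqrt (2 * Im \<tau>)"
        by (simp add: Im_\<sigma> real_sqrt_divide)
      ultimately show ?thesis
        by (simp only: mult.assoc flip: of_real_mult)
    qed
    have e2: "?E x * cnj (?E x) = of_real (exp (- ((k * x)\<^sup>2)))"
      by (simp add: complex_norm_square[symmetric] norm_e2pi power_mult_distrib k flip: exp_double of_real_power)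
    have e3: "of_real (2 / sqrt pi * exp (- ((k * x)\<^sup>2)) * k) =
        complex_of_real (2 * sqrt (2 * Im \<tau>)) * of_real (exp (- ((k * x)\<^sup>2)))"
      unfolding k(2)[symmetric] by simp
    have "C * (- 2 * \<i> * ?S x) * (2 * of_real pi * \<i> * of_real x * \<tau> * ?E x) +
        C * (- 2 * \<i> * (\<i> * \<tau> * (1 - of_real (sqrt (2 * Im \<sigma>)) * cnj (C * ?E x)
          - of_real (2 * pi * x) * ?S x))) * ?E x
        - \<tau> * (2 * C * ?E x - (0 - of_real (- 2 / sqrt pi * exp (- ((k * x)\<^sup>2)) * k))) =
      \<tau> * (of_real (2 / sqrt pi * exp (- ((k * x)\<^sup>2)) * k)
        - 2 * (of_real (sqrt (2 * Im \<sigma>)) * C * cnj C) * (?E x * cnj (?E x)))"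
      by (simp add: algebra_simps)
    also have "\<dots> = 0"
      unfolding e1 e2 e3 by simp
    finally show ?thesis
      using dD by simp
  qed
  then have "D x = D 0"
    using has_vector_derivative_zero_constant[of UNIV D]
    by (metis UNIV_I convex_UNIV has_vector_derivative_at_within)
  also have "D 0 = 0"
    by (simp add: D_def)
  finally show ?thesis
    by (simp add: D_def C_def \<sigma>_def k_def)
qed

lemma FT_integrand_phi_star:
  "FT_integrand (phi_star \<sigma>) x y = (\<lambda>(w, z).
    (erfc_factor \<sigma> w * e2pi (of_real (- (w * x)))) * e2pi (of_real (z\<^sup>2 / 2) * \<sigma> + of_real (y * z)))"
proof -
  have "e2pi (of_real ((z\<^sup>2 - w\<^sup>2) / 2) * \<sigma>) * e2pi (of_real (- (w * x) + y * z)) =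
      e2pi (- of_real (w\<^sup>2 / 2) * \<sigma>) * e2pi (of_real (- (w * x))) * e2pi (of_real (z\<^sup>2 / 2) * \<sigma> + of_real (y * z))"
    for w z
    by (simp add: e2pi_add[symmetric] diff_divide_distrib algebra_simps)
  then show ?thesis
    by (simp add: FT_integrand_def phi_star_def erfc_factor_def fun_eq_iff mult_ac)
qed

text \<open>The integrand is a product of a function of w and a function of z. The Gaussian in z
  contributes e(y^2 \<tau> / 2), which is split into the integrating factor of
  \<open>sine_transform_eq\<close> and the exponential of the claim.\<close>

lemma
  assumes \<tau>: "Im \<tau> > 0"
  shows integrable_FT_integrand_phi_star: "integrable lborel (FT_integrand (phi_star (- 1 / \<tau>)) x y)"
    and FT_phi_star: "FT (phi_star (- 1 / \<tau>)) x y = \<tau> * e2pi (of_real ((y\<^sup>2 - x\<^sup>2) / 2) * \<tau>) *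
      (2 * gauss_const (- 1 / \<tau>) * gauss_primitive \<tau> x -
        of_real (sgn x * (1 - erfc (sqrt (2 * pi * Im \<tau>) * \<bar>x\<bar>))))"
proof -
  define \<sigma> where "\<sigma> = - 1 / \<tau>"
  have \<sigma>: "Im \<sigma> > 0"
    using \<tau> by (simp add: \<sigma>_def Im_divide divide_pos_pos complex_eq_iff sum_power2_gt_zero_iff)
  have i1: "integrable lborel (\<lambda>w. erfc_factor \<sigma> w * e2pi (of_real (- (w * x))))"
    by (rule integrable_erfc_factor_bounded[OF \<sigma>, where n = 0]) (measurable, simp add: norm_e2pi)
  have i2: "integrable lborel (\<lambda>z. e2pi (of_real (z\<^sup>2 / 2) * \<sigma> + of_real (y * z)))"
    using integrable_e2pi_quadratic[OF \<sigma>, of 0 y] by simp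
  show "integrable lborel (FT_integrand (phi_star (- 1 / \<tau>)) x y)"
    using integrable_lborel_product[OF i1 i2] unfolding FT_integrand_phi_star \<sigma>_def .
  have "FT (phi_star \<sigma>) x y = - 2 * \<i> * sine_transform \<sigma> x * (gauss_const \<sigma> * e2pi (- of_real (y\<^sup>2 / 2) / \<sigma>))"
    unfolding FT_def FT_integrand_phi_star integral_lborel_product[OF i1 i2]
    by (simp only: fourier_erfc_factor[OF \<sigma>] gaussian_fourier[OF \<sigma>])
  also have "e2pi (- of_real (y\<^sup>2 / 2) / \<sigma>) = e2pi (of_real (x\<^sup>2 / 2) * \<tau>) * e2pi (of_real ((y\<^sup>2 - x\<^sup>2) / 2) * \<tau>)"
    by (simp add: \<sigma>_def e2pi_add[symmetric] diff_divide_distrib algebra_simps)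
  also have "- 2 * \<i> * sine_transform \<sigma> x * (gauss_const \<sigma> *
      (e2pi (of_real (x\<^sup>2 / 2) * \<tau>) * e2pi (of_real ((y\<^sup>2 - x\<^sup>2) / 2) * \<tau>))) =
      (gauss_const \<sigma> * (- 2 * \<i> * sine_transform \<sigma> x) * e2pi (of_real (x\<^sup>2 / 2) * \<tau>)) *
        e2pi (of_real ((y\<^sup>2 - x\<^sup>2) / 2) * \<tau>)"
    by (simp only: mult_ac)
  also have "gauss_const \<sigma> * (- 2 * \<i> * sine_transform \<sigma> x) * e2pi (of_real (x\<^sup>2 / 2) * \<tau>) =
      \<tau> * (2 * gauss_const \<sigma> * gauss_primitive \<tau> x - of_real (sgn x * (1 - erfc (sqrt (2 * pi * Im \<tau>) * \<bar>x\<bar>))))"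
    unfolding \<sigma>_def sine_transform_eq[OF \<tau>] sgn_mult_erfc by simp
  finally show "FT (phi_star (- 1 / \<tau>)) x y = \<tau> * e2pi (of_real ((y\<^sup>2 - x\<^sup>2) / 2) * \<tau>) *
      (2 * gauss_const (- 1 / \<tau>) * gauss_primitive \<tau> x -
        of_real (sgn x * (1 - erfc (sqrt (2 * pi * Im \<tau>) * \<bar>x\<bar>))))"
    unfolding \<sigma>_def by (simp only: mult_ac)
qed

section \<open>Rotated coordinates\<close>

text \<open>The map from (a, b) back to (w, z), inverse to the coordinates in which
  \<open>rotated_rect\<close> is a rectangle.\<close>

definition rotation :: "real \<times> real \<Rightarrow> real \<times> real"
  where "rotation = (\<lambda>(a, b). ((a - b) / sqrt 2, (a + b) / sqrt 2))"

lemma measurable_rotation [measurable]: "rotation \<in> borel \<rightarrow>\<^sub>M borel"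
  unfolding rotation_def by (simp add: borel_prod[symmetric])

text \<open>Two one-dimensional affine substitutions: for fixed w replace z by -w + sqrt(2) a,
  exchange the integrals, and for fixed a replace w by (a - b)/sqrt(2). The scale factors sqrt(2)
  and 1/sqrt(2) cancel.\<close>

lemma distr_lborel_rotation: "distr lborel lborel rotation = lborel"
proof (rule measure_eqI)
  fix A :: "(real \<times> real) set"
  assume "A \<in> sets (distr lborel lborel rotation)"
  then have A [measurable]: "A \<in> sets borel" by simp
  define f where "f w z = (indicator A (w, z) :: ennreal)" for w z :: real
  have [measurable]: "case_prod f \<in> borel_measurable borel"
    unfolding f_def by simp
  have [measurable]: "case_prod f \<in> borel_measurable (borel \<Otimes>\<^sub>M borel)"
    by (simp add: borel_prod)
  have "emeasure lborel A = (\<integral>\<^sup>+p. case_prod f p \<partial>(lborel \<Otimes>\<^sub>M lborel))"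
    by (simp add: lborel_prod f_def split_def)
  also have "\<dots> = (\<integral>\<^sup>+w. \<integral>\<^sup>+z. f w z \<partial>lborel \<partial>lborel)"
    by (subst lborel.nn_integral_fst[symmetric]) auto
  also have "\<dots> = (\<integral>\<^sup>+w. sqrt 2 * (\<integral>\<^sup>+a. f w (- w + sqrt 2 * a) \<partial>lborel) \<partial>lborel)"
  proof (rule nn_integral_cong)
    fix w
    show "(\<integral>\<^sup>+z. f w z \<partial>lborel) = sqrt 2 * (\<integral>\<^sup>+a. f w (- w + sqrt 2 * a) \<partial>lborel)"
      by (subst nn_integral_real_affine[where c = "sqrt 2" and t = "- w"]) auto
  qed
  also have "\<dots> = sqrt 2 * (\<integral>\<^sup>+w. \<integral>\<^sup>+a. f w (- w + sqrt 2 * a) \<partial>lborel \<partial>lborel)"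
    by (rule nn_integral_cmult) measurable
  also have "\<dots> = sqrt 2 * (\<integral>\<^sup>+a. \<integral>\<^sup>+w. f w (- w + sqrt 2 * a) \<partial>lborel \<partial>lborel)"
    by (subst lborel_pair.Fubini'[symmetric]) auto
  also have "\<dots> = sqrt 2 * (\<integral>\<^sup>+a. (1 / sqrt 2) * (\<integral>\<^sup>+b. f ((a - b) / sqrt 2) ((a + b) / sqrt 2) \<partial>lborel) \<partial>lborel)"
  proof -
    have "(\<integral>\<^sup>+w. f w (- w + sqrt 2 * a) \<partial>lborel) =
        (1 / sqrt 2) * (\<integral>\<^sup>+b. f ((a - b) / sqrt 2) ((a + b) / sqrt 2) \<partial>lborel)" for a
    proof -
      have "(\<integral>\<^sup>+w. f w (- w + sqrt 2 * a) \<partial>lborel) = \<bar>- (1 / sqrt 2)\<bar> *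
          (\<integral>\<^sup>+b. f (a / sqrt 2 + - (1 / sqrt 2) * b) (- (a / sqrt 2 + - (1 / sqrt 2) * b) + sqrt 2 * a) \<partial>lborel)"
        by (rule nn_integral_real_affine) auto
      also have "(\<lambda>b. - (a / sqrt 2 + - (1 / sqrt 2) * b) + sqrt 2 * a) = (\<lambda>b. (a + b) / sqrt 2)"
        by (auto simp: field_simps)
      also have "(\<lambda>b. a / sqrt 2 + - (1 / sqrt 2) * b) = (\<lambda>b. (a - b) / sqrt 2)"
        by (auto simp: field_simps)
      finally show ?thesis by simp
    qed
    then show ?thesis by simp
  qed
  also have "\<dots> = (sqrt 2 * ennreal (1 / sqrt 2)) *
      (\<integral>\<^sup>+a. \<integral>\<^sup>+b. f ((a - b) / sqrt 2) ((a + b) / sqrt 2) \<partial>lborel \<partial>lborel)"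
    by (subst nn_integral_cmult) (auto simp: mult.assoc)
  also have "sqrt 2 * ennreal (1 / sqrt 2) = 1"
    by (simp flip: ennreal_mult)
  also have "(\<integral>\<^sup>+a. \<integral>\<^sup>+b. f ((a - b) / sqrt 2) ((a + b) / sqrt 2) \<partial>lborel \<partial>lborel) =
      (\<integral>\<^sup>+p. case_prod f (rotation p) \<partial>(lborel \<Otimes>\<^sub>M lborel))"
    by (subst lborel.nn_integral_fst[symmetric]) (auto simp: rotation_def)
  also have "\<dots> = (\<integral>\<^sup>+p. indicator (rotation -` A \<inter> space lborel) p \<partial>lborel)"
    by (simp add: lborel_prod f_def rotation_def split_def indicator_def)
  also have "\<dots> = emeasure (distr lborel lborel rotation) A"
    by (simp add: emeasure_distr measurable_sets_borel[OF measurable_rotation])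
  finally show "emeasure (distr lborel lborel rotation) A = emeasure lborel A"
    by simp
qed simp

lemma integral_lborel_rotation:
  fixes f :: "real \<times> real \<Rightarrow> 'b :: {banach, second_countable_topology}"
  assumes "f \<in> borel_measurable borel"
  shows "(LINT p|lborel. f p) = (LINT p|lborel. f (rotation p))"
proof -
  have "(LINT p|lborel. f p) = (LINT p|distr lborel lborel rotation. f p)"
    by (simp add: distr_lborel_rotation)
  also have "\<dots> = (LINT p|lborel. f (rotation p))"
    using assms by (intro integral_distr) auto
  finally show ?thesis .
qed

lemma norm_phi_plus_le:
  assumes "Im \<sigma> \<ge> 0"
  shows "norm (phi_plus \<sigma> w z) \<le> 1"
proof (cases "z\<^sup>2 > w\<^sup>2")
  case True
  then have "norm (e2pi (of_real ((z\<^sup>2 - w\<^sup>2) / 2) * \<sigma>)) \<le> 1"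
    using assms by (simp add: norm_e2pi)
  then show ?thesis
    by (auto simp: phi_plus_def norm_mult abs_sgn_eq mult_le_one)
qed (simp add: phi_plus_def)

lemma borel_measurable_FT_integrand_phi_plus [measurable]:
  "FT_integrand (phi_plus \<sigma>) x y \<in> borel_measurable borel"
  unfolding FT_integrand_def phi_plus_def of_bool_def
  by (simp add: borel_prod[symmetric])

lemma sets_rotated_rect [measurable]: "rotated_rect T' T \<in> sets borel"
proof -
  have "closed (rotated_rect T' T)"
    unfolding rotated_rect_def split_def
    by (intro closed_Collect_conj closed_Collect_le continuous_intros) auto
  then show ?thesis by (rule borel_closed)
qed

lemma set_integrable_phi_plus:
  assumes "Im \<sigma> \<ge> 0"
  shows "set_integrable lborel (rotated_rect T' T) (FT_integrand (phi_plus \<sigma>) x y)"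
proof -
  define M where "M = sqrt 2 * (\<bar>T'\<bar> + \<bar>T\<bar>)"
  have "rotated_rect T' T \<subseteq> cbox (- M, - M) (M, M)"
  proof (clarsimp simp: rotated_rect_def cbox_Pair_eq)
    fix w z assume "\<bar>w + z\<bar> / sqrt 2 \<le> T'" "\<bar>z - w\<bar> / sqrt 2 \<le> T"
    then have "\<bar>w + z\<bar> \<le> sqrt 2 * \<bar>T'\<bar>" "\<bar>z - w\<bar> \<le> sqrt 2 * \<bar>T\<bar>"
      by (auto simp: field_simps intro: order_trans)
    then show "- M \<le> w \<and> w \<le> M \<and> - M \<le> z \<and> z \<le> M"
      by (auto simp: M_def algebra_simps)
  qed
  then have "emeasure lborel (rotated_rect T' T) \<le> emeasure lborel (cbox (- M, - M) (M, M))"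
    by (intro emeasure_mono) auto
  also have "\<dots> < \<infinity>"
    using emeasure_lborel_cbox_finite by blast
  finally have "emeasure lborel (rotated_rect T' T) < \<infinity>" .
  moreover have "norm (FT_integrand (phi_plus \<sigma>) x y p) \<le> 1" for p
    by (cases p) (simp add: FT_integrand_def norm_mult norm_e2pi norm_phi_plus_le assms)
  ultimately show ?thesis
    unfolding set_integrable_def
    by (intro integrableI_bounded_set_indicator[where B = 1]) auto
qed

text \<open>The integrand of the transform of \<open>phi_plus\<close> in rotated coordinates. Since
  z^2 - w^2 = 2 a b, the cone becomes a b > 0, and w has the sign of a - b. The exponent is arranged
  as linear in b for fixed a, which makes the b-integral elementary.\<close>

definition cone_kernel :: "complex \<Rightarrow> real \<Rightarrow> real \<Rightarrow> real \<Rightarrow> real \<Rightarrow> complex"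
  where "cone_kernel \<sigma> \<alpha> \<beta> a b =
    of_real (sgn (a - b)) * of_bool (a * b > 0) * (e2pi (of_real (a * \<alpha>)) * e2pi (of_real b * (of_real a * \<sigma> + of_real \<beta>)))"

lemma FT_integrand_rotation:
  "FT_integrand (phi_plus \<sigma>) x y (rotation (a, b)) = cone_kernel \<sigma> ((y - x) / sqrt 2) ((y + x) / sqrt 2) a b"
proof -
  let ?w = "(a - b) / sqrt 2" and ?z = "(a + b) / sqrt 2"
  have sq: "?z\<^sup>2 - ?w\<^sup>2 = 2 * a * b"
    by (simp add: power_divide power2_eq_square algebra_simps diff_divide_distrib[symmetric])
  have "(?z\<^sup>2 > ?w\<^sup>2) = (0 < 2 * (a * b))"
    unfolding diff_gt_0_iff_gt[of "?z\<^sup>2" "?w\<^sup>2", symmetric] sq by (simp only: mult.assoc)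
  then have "(?z\<^sup>2 > ?w\<^sup>2) = (a * b > 0)"
    by (simp only: zero_less_mult_iff[of 2] zero_less_numeral) simp
  moreover have "sgn ?w = sgn (a - b)"
    by (simp add: sgn_divide)
  moreover have "- (?w * x) + y * ?z = a * ((y - x) / sqrt 2) + b * ((y + x) / sqrt 2)"
    by (simp add: field_simps)
  moreover have "(?z\<^sup>2 - ?w\<^sup>2) / 2 = a * b"
    unfolding sq by simp
  ultimately have "FT_integrand (phi_plus \<sigma>) x y (rotation (a, b)) =
      e2pi (of_real (a * b) * \<sigma>) * of_real (sgn (a - b)) * of_bool (a * b > 0) *
      e2pi (of_real (a * ((y - x) / sqrt 2) + b * ((y + x) / sqrt 2)))"
    by (simp only: FT_integrand_def phi_plus_def rotation_def split)
  also have "\<dots> = of_real (sgn (a - b)) * of_bool (a * b > 0) *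
      (e2pi (of_real (a * b) * \<sigma>) * e2pi (of_real (a * ((y - x) / sqrt 2) + b * ((y + x) / sqrt 2))))"
    by (simp only: mult_ac)
  also have "e2pi (of_real (a * b) * \<sigma>) * e2pi (of_real (a * p + b * q)) =
      e2pi (of_real (a * p)) * e2pi (of_real b * (of_real a * \<sigma> + of_real q))" for p q
    by (simp add: e2pi_add[symmetric] algebra_simps)
  finally show ?thesis
    by (simp only: cone_kernel_def)
qed

text \<open>Rotated rectangles become products of intervals, so Fubini applies with the elementary
  b-integral inside.\<close>

lemma FT_rect_eq:
  assumes "Im \<sigma> \<ge> 0" and \<alpha>: "\<alpha> = (y - x) / sqrt 2" and \<beta>: "\<beta> = (y + x) / sqrt 2"
  defines "I \<equiv> \<lambda>T a. LINT b|lborel. indicator {- T..T} b *\<^sub>R cone_kernel \<sigma> \<alpha> \<beta> a b"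
  shows "set_integrable lborel {- T'..T'} (I T)"
    and "FT_rect (phi_plus \<sigma>) x y (T', T) = (LINT a:{- T'..T'}|lborel. I T a)"
proof -
  let ?F = "FT_integrand (phi_plus \<sigma>) x y"
  let ?g = "\<lambda>(a, b). indicator {- T'..T'} a *\<^sub>R (indicator {- T..T} b *\<^sub>R cone_kernel \<sigma> \<alpha> \<beta> a b)"
  have eq: "indicator (rotated_rect T' T) (rotation p) *\<^sub>R ?F (rotation p) = ?g p" for p
  proof (cases p)
    case (Pair a b)
    have "rotation (a, b) \<in> rotated_rect T' T \<longleftrightarrow> a \<in> {- T'..T'} \<and> b \<in> {- T..T}"
      by (auto simp: rotation_def rotated_rect_def field_simps)
    then show ?thesis
      unfolding Pair FT_integrand_rotation \<alpha> \<beta> by (simp add: indicator_def)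
  qed
  have "integrable (distr lborel lborel rotation) (\<lambda>p. indicator (rotated_rect T' T) p *\<^sub>R ?F p)"
    using set_integrable_phi_plus[OF assms(1)] by (simp add: distr_lborel_rotation set_integrable_def)
  then have "integrable lborel (\<lambda>p. indicator (rotated_rect T' T) (rotation p) *\<^sub>R ?F (rotation p))"
    by (subst (asm) integrable_distr_eq) auto
  then have int: "integrable (lborel \<Otimes>\<^sub>M lborel) ?g"
    unfolding eq by (simp add: lborel_prod)
  from lborel_pair.integrable_fst'[OF int]
  show "set_integrable lborel {- T'..T'} (I T)"
    by (simp add: set_integrable_def I_def del: scaleR_scaleR)
  have "FT_rect (phi_plus \<sigma>) x y (T', T) = (LINT p|lborel. ?g p)"
    unfolding FT_rect_def set_lebesgue_integral_def split
    by (subst integral_lborel_rotation) (auto simp: eq)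
  also have "\<dots> = (LINT a|lborel. LINT b|lborel. ?g (a, b))"
    using lborel_pair.integral_fst'[OF int] by (simp add: lborel_prod)
  also have "\<dots> = (LINT a:{- T'..T'}|lborel. I T a)"
    by (simp add: set_lebesgue_integral_def I_def del: scaleR_scaleR)
  finally show "FT_rect (phi_plus \<sigma>) x y (T', T) = (LINT a:{- T'..T'}|lborel. I T a)" .
qed

section \<open>Integration over one rotated coordinate\<close>

text \<open>After multiplication by the conjugate of \<sigma> the imaginary part is -\<beta>
  Im(\<sigma>), independent of a. For nonzero \<beta> this keeps the denominators away from 0
  uniformly in a.\<close>

lemma norm_linear_lower_bound:
  assumes "Im \<sigma> > 0"
  shows "\<bar>\<beta>\<bar> * Im \<sigma> / norm \<sigma> \<le> norm (of_real a * \<sigma> + of_real \<beta>)"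
proof -
  have "\<bar>\<beta>\<bar> * Im \<sigma> = \<bar>Im ((of_real a * \<sigma> + of_real \<beta>) * cnj \<sigma>)\<bar>"
    using assms by (simp add: algebra_simps abs_mult)
  also have "\<dots> \<le> norm (of_real a * \<sigma> + of_real \<beta>) * norm \<sigma>"
    using abs_Im_le_cmod[of "(of_real a * \<sigma> + of_real \<beta>) * cnj \<sigma>"] by (simp only: norm_mult complex_mod_cnj)
  finally show ?thesis
    using assms by (subst pos_divide_le_eq) auto
qed

lemma integral_e2pi_linear:
  assumes "c \<noteq> 0" "p \<le> q"
  shows "(LINT b|lborel. indicator {p..q} b *\<^sub>R e2pi (of_real b * c)) =
    (e2pi (of_real q * c) - e2pi (of_real p * c)) / (2 * of_real pi * \<i> * c)"
proof -
  let ?F = "\<lambda>b. e2pi (of_real b * c) / (2 * of_real pi * \<i> * c)"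
  have "(LINT b|lborel. indicator {p..q} b *\<^sub>R e2pi (of_real b * c)) = ?F q - ?F p"
  proof (rule integral_FTC_atLeastAtMost[OF assms(2)])
    fix b :: real
    show "(?F has_vector_derivative e2pi (of_real b * c)) (at b within {p..q})"
    proof (rule has_vector_derivative_at_within, rule has_vector_derivative_real_field)
      show "((\<lambda>w. e2pi (w * c) / (2 * of_real pi * \<i> * c)) has_field_derivative e2pi (of_real b * c)) (at (of_real b))"
        using assms(1) by (auto intro!: derivative_eq_intros)
    qed
    show "continuous_on {p..q} (\<lambda>b. e2pi (of_real b * c))"
      by (intro continuous_intros)
  qed
  then show ?thesis
    by (simp add: diff_divide_distrib)
qed

lemma integrable_e2pi_linear:
  "integrable lborel (\<lambda>b. indicator {p..q::real} b *\<^sub>R e2pi (of_real b * c))"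
  using borel_integrable_atLeastAtMost'[of p q "\<lambda>b. e2pi (of_real b * c)"]
  by (simp add: set_integrable_def continuous_intros)

text \<open>For a > 0 this is the limit, as T tends to infinity, of the b-integral of
  \<open>cone_kernel\<close>: the integral over 0 < b < a minus the one over b > a. The same formula
  serves negative a by oddness.\<close>

definition slice :: "complex \<Rightarrow> real \<Rightarrow> real \<Rightarrow> real \<Rightarrow> complex"
  where "slice \<sigma> \<alpha> \<beta> a = e2pi (of_real (a * \<alpha>)) *
    (2 * e2pi (of_real a * (of_real a * \<sigma> + of_real \<beta>)) - 1) /
    (2 * of_real pi * \<i> * (of_real a * \<sigma> + of_real \<beta>))"

lemma slice_minus: "slice \<sigma> (- \<alpha>) (- \<beta>) (- a) = - slice \<sigma> \<alpha> \<beta> a"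
proof -
  define c where "c = of_real a * \<sigma> + of_real \<beta>"
  have "of_real (- a) * \<sigma> + of_real (- \<beta>) = - c"
    by (simp add: c_def)
  then show ?thesis
    unfolding slice_def c_def[symmetric] by simp
qed

lemma cone_kernel_minus: "cone_kernel \<sigma> (- \<alpha>) (- \<beta>) (- a) (- b) = - cone_kernel \<sigma> \<alpha> \<beta> a b"
proof -
  have "of_real (- b) * (of_real (- a) * \<sigma> + of_real (- \<beta>)) = of_real b * (of_real a * \<sigma> + of_real \<beta>)"
    by (simp add: algebra_simps)
  moreover have "sgn (- a - - b) = - sgn (a - b)"
    by (simp add: sgn_if)
  ultimately show ?thesis
    unfolding cone_kernel_def by simp
qed

text \<open>If a \<le> T, only the tail beyond T is missing, an error of one exponential at T. If a
  > T, the sign change at b = a is never reached and the error is the exponential at T minus twice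
  the one at a. The latter is no larger in modulus than the one at T, whence the constant 3.\<close>

lemma cone_kernel_integral_pos:
  assumes \<sigma>: "Im \<sigma> > 0" and "a > 0" "T \<ge> 0"
  shows "norm ((LINT b|lborel. indicator {- T..T} b *\<^sub>R cone_kernel \<sigma> \<alpha> \<beta> a b) - slice \<sigma> \<alpha> \<beta> a) \<le>
    3 * exp (- (2 * pi * Im \<sigma> * T * a)) / (2 * pi * norm (of_real a * \<sigma> + of_real \<beta>))"
proof -
  define c where "c = of_real a * \<sigma> + of_real \<beta>"
  define e where "e b = e2pi (of_real b * c)" for b :: real
  define A where "A = e2pi (of_real (a * \<alpha>))"
  let ?I = "LINT b|lborel. indicator {- T..T} b *\<^sub>R cone_kernel \<sigma> \<alpha> \<beta> a b"
  define d where "d = 2 * of_real pi * \<i> * c"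
  have "Im c = a * Im \<sigma>" by (simp add: c_def)
  then have c: "c \<noteq> 0" using assms by auto
  have d: "d \<noteq> 0" using c by (simp add: d_def)
  have norm_e: "norm (e b) = exp (- (2 * pi * Im \<sigma> * b * a))" for b
    by (simp add: e_def norm_e2pi c_def mult_ac)
  have norm_A: "norm A = 1"
    by (simp add: A_def norm_e2pi)
  have slice: "slice \<sigma> \<alpha> \<beta> a = A * (2 * e a - 1) / d"
    by (simp add: slice_def A_def e_def c_def d_def)
  have kernel: "cone_kernel \<sigma> \<alpha> \<beta> a b = A * (of_real (sgn (a - b)) * of_bool (b > 0) * e b)" for b
    using \<open>a > 0\<close> by (simp add: cone_kernel_def A_def e_def c_def zero_less_mult_iff)
  have int: "integrable lborel (\<lambda>b. indicator {p..q::real} b *\<^sub>R e b)" for p q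
    unfolding e_def by (rule integrable_e2pi_linear)
  have val: "(LINT b|lborel. indicator {p..q::real} b *\<^sub>R e b) = (e q - e p) / d" if "p \<le> q" for p q
    unfolding e_def d_def by (rule integral_e2pi_linear[OF c that])
  have "\<exists>r. ?I - slice \<sigma> \<alpha> \<beta> a = A * r / d \<and> norm r \<le> 3 * exp (- (2 * pi * Im \<sigma> * T * a))"
  proof (cases "a \<le> T")
    case True
    have "?I = (LINT b|lborel. A * (indicator {0..a} b *\<^sub>R e b - indicator {a..T} b *\<^sub>R e b))"
    proof (rule integral_cong_AE)
      show "AE b in lborel. indicator {- T..T} b *\<^sub>R cone_kernel \<sigma> \<alpha> \<beta> a b =
          A * (indicator {0..a} b *\<^sub>R e b - indicator {a..T} b *\<^sub>R e b)"
        using AE_lborel_singleton[of 0] AE_lborel_singleton[of a]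
        by eventually_elim (use True \<open>a > 0\<close> in \<open>auto simp: kernel indicator_def sgn_if\<close>)
    qed (auto simp: cone_kernel_def e_def)
    also have "\<dots> = A * ((LINT b|lborel. indicator {0..a} b *\<^sub>R e b) - (LINT b|lborel. indicator {a..T} b *\<^sub>R e b))"
      by (simp only: integral_mult_right_zero Bochner_Integration.integral_diff[OF int int])
    also have "\<dots> = A * ((e a - e 0) / d - (e T - e a) / d)"
      using val[of 0 a] val[of a T] True \<open>a > 0\<close> by simp
    finally have "?I - slice \<sigma> \<alpha> \<beta> a = A * (- e T) / d"
      unfolding slice using d by (simp add: e_def[of 0] field_simps)
    then show ?thesis
      by (intro exI[of _ "- e T"]) (simp add: norm_e)
  next
    case False
    have "?I = (LINT b|lborel. A * (indicator {0..T} b *\<^sub>R e b))"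
    proof (rule integral_cong_AE)
      show "AE b in lborel. indicator {- T..T} b *\<^sub>R cone_kernel \<sigma> \<alpha> \<beta> a b = A * (indicator {0..T} b *\<^sub>R e b)"
        using AE_lborel_singleton[of 0]
        by eventually_elim (use False in \<open>auto simp: kernel indicator_def sgn_if\<close>)
    qed (auto simp: cone_kernel_def e_def)
    also have "\<dots> = A * ((e T - e 0) / d)"
      by (simp only: integral_mult_right_zero val[OF \<open>T \<ge> 0\<close>])
    finally have "?I - slice \<sigma> \<alpha> \<beta> a = A * (e T - 2 * e a) / d"
      unfolding slice using d by (simp add: e_def[of 0] field_simps)
    moreover have "norm (e T - 2 * e a) \<le> norm (e T) + 2 * norm (e a)"
      using norm_triangle_ineq4[of "e T" "2 * e a"] by (simp add: norm_mult)
    moreover have "norm (e a) \<le> norm (e T)"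
      using False assms by (simp add: norm_e mult_left_mono mult_right_mono)
    ultimately have "?I - slice \<sigma> \<alpha> \<beta> a = A * (e T - 2 * e a) / d \<and> norm (e T - 2 * e a) \<le> 3 * norm (e T)"
      by (intro conjI) linarith+
    then show ?thesis
      by (intro exI[of _ "e T - 2 * e a"]) (simp only: norm_e)
  qed
  then obtain r where r: "?I - slice \<sigma> \<alpha> \<beta> a = A * r / d" "norm r \<le> 3 * exp (- (2 * pi * Im \<sigma> * T * a))"
    by blast
  have "norm (?I - slice \<sigma> \<alpha> \<beta> a) = norm r / (2 * pi * norm c)"
    unfolding r(1) by (simp add: norm_mult norm_divide norm_A d_def)
  also have "\<dots> \<le> 3 * exp (- (2 * pi * Im \<sigma> * T * a)) / (2 * pi * norm c)"
    using r(2) by (intro divide_right_mono) auto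
  finally show ?thesis by (simp add: c_def)
qed

text \<open>Kernel and slice both change sign when a, b, \<alpha>, \<beta> are negated together, so
  reflecting b reduces negative a to the positive case.\<close>

lemma cone_kernel_integral:
  assumes \<sigma>: "Im \<sigma> > 0" and "a \<noteq> 0" "T \<ge> 0"
  shows "norm ((LINT b|lborel. indicator {- T..T} b *\<^sub>R cone_kernel \<sigma> \<alpha> \<beta> a b) - slice \<sigma> \<alpha> \<beta> a) \<le>
    3 * exp (- (2 * pi * Im \<sigma> * T * \<bar>a\<bar>)) / (2 * pi * norm (of_real a * \<sigma> + of_real \<beta>))"
proof (cases "a > 0")
  case True
  then show ?thesis using cone_kernel_integral_pos[OF \<sigma> True \<open>T \<ge> 0\<close>] by simp
next
  case False
  then have "- a > 0" using assms by simp
  let ?J = "LINT b|lborel. indicator {- T..T} b *\<^sub>R cone_kernel \<sigma> (- \<alpha>) (- \<beta>) (- a) b"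
  have "?J = (LINT b|lborel. indicator {- T..T} (- b) *\<^sub>R cone_kernel \<sigma> (- \<alpha>) (- \<beta>) (- a) (- b))"
    using lborel_integral_real_affine[of "-1" "\<lambda>b. indicator {- T..T} b *\<^sub>R cone_kernel \<sigma> (- \<alpha>) (- \<beta>) (- a) b" 0]
    by simp
  also have "\<dots> = (LINT b|lborel. - (indicator {- T..T} b *\<^sub>R cone_kernel \<sigma> \<alpha> \<beta> a b))"
    by (intro Bochner_Integration.integral_cong refl) (auto simp: cone_kernel_minus indicator_def)
  also have "\<dots> = - (LINT b|lborel. indicator {- T..T} b *\<^sub>R cone_kernel \<sigma> \<alpha> \<beta> a b)"
    by simp
  finally have J: "?J - slice \<sigma> (- \<alpha>) (- \<beta>) (- a) =
      - ((LINT b|lborel. indicator {- T..T} b *\<^sub>R cone_kernel \<sigma> \<alpha> \<beta> a b) - slice \<sigma> \<alpha> \<beta> a)"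
    by (simp add: slice_minus)
  have "of_real (- a) * \<sigma> + of_real (- \<beta>) = - (of_real a * \<sigma> + of_real \<beta>)"
    by simp
  with cone_kernel_integral_pos[OF \<sigma> \<open>- a > 0\<close> \<open>T \<ge> 0\<close>, of "- \<alpha>" "- \<beta>"]
  show ?thesis
    unfolding J norm_minus_cancel using False by (simp only: norm_minus_cancel abs_of_nonpos)
qed

lemma integrable_exp_abs:
  fixes k :: real
  assumes "k > 0"
  shows "integrable lborel (\<lambda>x. exp (- (k * \<bar>x\<bar>)))"
proof -
  define f where "f x = indicator {0<..} x *\<^sub>R exp (- (x * k))" for x :: real
  have f: "integrable lborel f"
    using integrable_I0i_exp_mscale[OF assms] by (simp add: set_integrable_def f_def[abs_def])
  have "integrable lborel (\<lambda>x. f x + f (- x))"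
    using f lborel_integrable_real_affine[OF f, of "-1" 0] by simp
  moreover have "AE x in lborel. f x + f (- x) = exp (- (k * \<bar>x\<bar>))"
    using AE_lborel_singleton[of 0] by eventually_elim (auto simp: f_def indicator_def mult.commute)
  ultimately show ?thesis
    by (subst integrable_cong_AE[where g = "\<lambda>x. f x + f (- x)"]) (auto elim: eventually_mono)
qed

lemma integral_exp_abs_scale:
  fixes k T :: real
  assumes "T > 0"
  shows "(LINT x|lborel. exp (- (k * T * \<bar>x\<bar>))) = (LINT x|lborel. exp (- (k * \<bar>x\<bar>))) / T"
  using lborel_integral_real_affine[of T "\<lambda>x. exp (- (k * \<bar>x\<bar>))" 0] assms
  by (simp add: abs_mult mult_ac)

lemma continuous_on_slice:
  assumes "Im \<sigma> > 0" "\<beta> \<noteq> 0"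
  shows "continuous_on S (slice \<sigma> \<alpha> \<beta>)"
proof -
  have "\<bar>\<beta>\<bar> * Im \<sigma> / norm \<sigma> > 0"
    using assms by (intro divide_pos_pos mult_pos_pos) auto
  then have "of_real a * \<sigma> + of_real \<beta> \<noteq> 0" for a
    using norm_linear_lower_bound[OF assms(1), of \<beta> a] by auto
  then show ?thesis
    unfolding slice_def[abs_def] by (intro continuous_intros) auto
qed

text \<open>The error of each slice is bounded by a multiple of exp(-k T |a|), whose integral over
  the whole line is a multiple of 1/T. The resulting bound does not depend on T', so the double
  limit reduces to a limit in T' alone.\<close>

lemma FT_rect_slice:
  assumes \<sigma>: "Im \<sigma> > 0" and \<alpha>: "\<alpha> = (y - x) / sqrt 2" and \<beta>: "\<beta> = (y + x) / sqrt 2" "\<beta> \<noteq> 0"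
  shows "\<exists>K. \<forall>T' T. T > 0 \<longrightarrow>
    norm (FT_rect (phi_plus \<sigma>) x y (T', T) - (LINT a:{- T'..T'}|lborel. slice \<sigma> \<alpha> \<beta> a)) \<le> K / T"
proof -
  define \<delta> where "\<delta> = \<bar>\<beta>\<bar> * Im \<sigma> / norm \<sigma>"
  have "\<sigma> \<noteq> 0" using \<sigma> by auto
  then have \<delta>: "\<delta> > 0" using \<sigma> \<beta> by (simp add: \<delta>_def)
  define k where "k = 2 * pi * Im \<sigma>"
  have k: "k > 0" using \<sigma> by (simp add: k_def)
  define K where "K = 3 / (2 * pi * \<delta>) * (LINT a|lborel. exp (- (k * \<bar>a\<bar>)))"
  have "norm (FT_rect (phi_plus \<sigma>) x y (T', T) - (LINT a:{- T'..T'}|lborel. slice \<sigma> \<alpha> \<beta> a)) \<le> K / T"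
    if T: "T > 0" for T' T
  proof -
    define I where "I a = (LINT b|lborel. indicator {- T..T} b *\<^sub>R cone_kernel \<sigma> \<alpha> \<beta> a b)" for a
    have I: "set_integrable lborel {- T'..T'} I" "FT_rect (phi_plus \<sigma>) x y (T', T) = (LINT a:{- T'..T'}|lborel. I a)"
      using FT_rect_eq[OF _ \<alpha> \<beta>(1), of \<sigma> T' T] \<sigma> by (simp_all add: I_def[abs_def])
    have s: "set_integrable lborel {- T'..T'} (slice \<sigma> \<alpha> \<beta>)"
      by (intro borel_integrable_atLeastAtMost' continuous_on_slice \<sigma> \<beta>)
    have dom: "integrable lborel (\<lambda>a. 3 / (2 * pi * \<delta>) * exp (- (k * T * \<bar>a\<bar>)))"
      using k T by (intro integrable_mult_right integrable_exp_abs) simp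
    have "norm (FT_rect (phi_plus \<sigma>) x y (T', T) - (LINT a:{- T'..T'}|lborel. slice \<sigma> \<alpha> \<beta> a)) =
        norm (LINT a|lborel. indicator {- T'..T'} a *\<^sub>R (I a - slice \<sigma> \<alpha> \<beta> a))"
      unfolding I(2) set_integral_diff(2)[OF I(1) s, symmetric] by (simp add: set_lebesgue_integral_def)
    also have "\<dots> \<le> (LINT a|lborel. 3 / (2 * pi * \<delta>) * exp (- (k * T * \<bar>a\<bar>)))"
    proof (rule Bochner_Integration.integral_norm_bound_integral)
      show "integrable lborel (\<lambda>a. indicator {- T'..T'} a *\<^sub>R (I a - slice \<sigma> \<alpha> \<beta> a))"
        using set_integral_diff(1)[OF I(1) s] by (simp add: set_integrable_def)
      show "integrable lborel (\<lambda>a. 3 / (2 * pi * \<delta>) * exp (- (k * T * \<bar>a\<bar>)))"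
        by (rule dom)
      fix a :: real
      have "norm (I a - slice \<sigma> \<alpha> \<beta> a) \<le>
          3 * exp (- (k * T * \<bar>a\<bar>)) / (2 * pi * norm (of_real a * \<sigma> + of_real \<beta>))"
      proof (cases "a = 0")
        case True
        \<comment> \<open>At a = 0 the kernel vanishes and the numerator of the slice has modulus 1,
          which is within the bound 3.\<close>
        then show ?thesis
          by (simp add: I_def cone_kernel_def slice_def norm_mult norm_divide divide_right_mono)
      next
        case False
        with cone_kernel_integral[OF \<sigma>, of a T] T show ?thesis
          by (simp add: I_def k_def)
      qed
      also have "\<dots> \<le> 3 * exp (- (k * T * \<bar>a\<bar>)) / (2 * pi * \<delta>)"
        using norm_linear_lower_bound[OF \<sigma>, of \<beta> a] \<delta>
        by (intro divide_left_mono mult_left_mono mult_pos_pos) (auto simp: \<delta>_def)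
      finally show "norm (indicator {- T'..T'} a *\<^sub>R (I a - slice \<sigma> \<alpha> \<beta> a)) \<le>
          3 / (2 * pi * \<delta>) * exp (- (k * T * \<bar>a\<bar>))"
        using \<delta> by (simp add: indicator_def)
    qed
    also have "\<dots> = K / T"
      by (simp add: integral_exp_abs_scale[OF T] K_def)
    finally show ?thesis .
  qed
  then show ?thesis by blast
qed

section \<open>The Fourier integral of a simple pole\<close>

text \<open>Cauchy's formula on the rectangle over [-R, R] of height sqrt(R). On the vertical sides
  the integrand is O(1/R) and the length is sqrt(R); on the top the decay exp(-2 pi \<alpha>
  sqrt(R)) beats the length 2 R. For large R the pole lies inside exactly when Im(p) > 0.\<close>

lemma fourier_simple_pole_pos:
  assumes \<alpha>: "\<alpha> > 0" and p: "Im p \<noteq> 0"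
  shows "((\<lambda>R. LINT a:{- R..R}|lborel. e2pi (of_real (a * \<alpha>)) / (of_real a - p)) \<longlongrightarrow>
    2 * of_real pi * \<i> * e2pi (of_real \<alpha> * p) * of_bool (Im p > 0)) at_top"
proof -
  define f where "f w = e2pi (of_real \<alpha> * w) / (w - p)" for w
  define L where "L = 2 * of_real pi * \<i> * e2pi (of_real \<alpha> * p) * of_bool (Im p > 0)"
  \<comment> \<open>The bounds for the right side, the top and the left side, in this order.\<close>
  define B where "B R = sqrt R / (R - norm p) + 2 * R * exp (- (2 * pi * \<alpha> * sqrt R)) / (sqrt R - norm p)
    + sqrt R / (R - norm p)" for R
  have bound: "norm ((LINT a:{- R..R}|lborel. f (of_real a)) - L) \<le> B R"
    if R: "R > norm p + 1" "sqrt R > norm p" for R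
  proof -
    have R0: "R > 0" "sqrt R > 0" using R norm_ge_zero[of p] by linarith+
    define z1 z2 z3 z4 where "z1 = complex_of_real (- R)" and "z2 = complex_of_real R"
      and "z3 = Complex R (sqrt R)" and "z4 = Complex (- R) (sqrt R)"
    note z_defs = z1_def z2_def z3_def z4_def
    have Rp: "\<bar>Re p\<bar> < R" "\<bar>Im p\<bar> < sqrt R"
      using abs_Re_le_cmod[of p] abs_Im_le_cmod[of p] R by linarith+
    have rect: "rectpath z1 z3 = linepath z1 z2 +++ linepath z2 z3 +++ linepath z3 z4 +++ linepath z4 z1"
      by (simp add: rectpath_def Let_def z_defs complex_eq_iff Complex_eq)
    have z13: "Re z1 \<le> Re z3" "Im z1 \<le> Im z3"
      using R0 by (auto simp: z_defs)
    have image: "path_image (rectpath z1 z3) =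
        closed_segment z1 z2 \<union> closed_segment z2 z3 \<union> closed_segment z3 z4 \<union> closed_segment z4 z1"
      unfolding rect by (simp add: path_image_join Un_assoc)
    have p_notin: "p \<notin> path_image (rectpath z1 z3)"
      using Rp R0 p unfolding path_image_rectpath[OF z13] by (auto simp: z_defs)
    have "((\<lambda>w. e2pi (of_real \<alpha> * w) / (w - p)) has_contour_integral
        (2 * pi * \<i> * winding_number (rectpath z1 z3) p * e2pi (of_real \<alpha> * p))) (rectpath z1 z3)"
    proof (rule Cauchy_integral_formula_convex_simple)
      show "(\<lambda>w. e2pi (of_real \<alpha> * w)) holomorphic_on UNIV"
        unfolding e2pi_def by (intro holomorphic_intros)
    qed (use p_notin in auto)
    moreover have "winding_number (rectpath z1 z3) p = of_bool (Im p > 0)"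
    proof (cases "Im p > 0")
      case True
      then have "p \<in> box z1 z3"
        using Rp by (auto simp: in_box_complex_iff z_defs)
      then show ?thesis using True by (simp add: winding_number_rectpath)
    next
      case False
      then have "p \<notin> cbox z1 z3"
        using p by (auto simp: in_cbox_complex_iff z_defs)
      then show ?thesis using False z13 by (simp add: winding_number_rectpath_outside)
    qed
    ultimately have "(f has_contour_integral L) (rectpath z1 z3)"
      by (simp add: f_def[abs_def] L_def mult_ac)
    then have L: "contour_integral (rectpath z1 z3) f = L"
      by (rule contour_integral_unique)
    have ci: "f contour_integrable_on linepath u v"
      if "closed_segment u v \<subseteq> path_image (rectpath z1 z3)" for u v
      unfolding f_def e2pi_def using that p_notin
      by (intro contour_integrable_continuous_linepath continuous_intros) auto
    have cis: "f contour_integrable_on linepath z1 z2" "f contour_integrable_on linepath z2 z3"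
      "f contour_integrable_on linepath z3 z4" "f contour_integrable_on linepath z4 z1"
      by (intro ci; force simp: image)+
    have sum: "L = contour_integral (linepath z1 z2) f + (contour_integral (linepath z2 z3) f +
        (contour_integral (linepath z3 z4) f + contour_integral (linepath z4 z1) f))"
      unfolding L[symmetric] rect using cis
      by (simp add: contour_integral_join contour_integrable_join)
    have "(LINT a:{- R..R}|lborel. f (of_real a)) = contour_integral (linepath z1 z2) f"
    proof -
      have "(f has_contour_integral contour_integral (linepath z1 z2) f) (linepath z1 z2)"
        by (rule has_contour_integral_integral[OF cis(1)])
      then have "((\<lambda>x. f (of_real x)) has_integral contour_integral (linepath z1 z2) f) {- R..R}"
        using R0 by (subst (asm) has_contour_integral_linepath_Reals_iff) (auto simp: z_defs)
      moreover have "set_integrable lborel {- R..R} (\<lambda>a. f (of_real a))"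
      proof (rule borel_integrable_atLeastAtMost')
        have "of_real a \<noteq> p" for a using p by auto
        then show "continuous_on {- R..R} (\<lambda>a. f (of_real a))"
          unfolding f_def by (intro continuous_intros) auto
      qed
      then have "((\<lambda>x. f (of_real x)) has_integral (LINT a:{- R..R}|lborel. f (of_real a))) {- R..R}"
        using set_borel_integral_eq_integral by (metis integrable_integral)
      ultimately show ?thesis by (metis has_integral_unique)
    qed
    then have "(LINT a:{- R..R}|lborel. f (of_real a)) - L =
        - (contour_integral (linepath z2 z3) f +
        (contour_integral (linepath z3 z4) f + contour_integral (linepath z4 z1) f))"
      unfolding sum by simp
    then have "norm ((LINT a:{- R..R}|lborel. f (of_real a)) - L) =
        norm (contour_integral (linepath z2 z3) f +
        (contour_integral (linepath z3 z4) f + contour_integral (linepath z4 z1) f))"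
      by (simp only: norm_minus_cancel)
    also have "\<dots> \<le> norm (contour_integral (linepath z2 z3) f) +
        (norm (contour_integral (linepath z3 z4) f) + norm (contour_integral (linepath z4 z1) f))"
      by (intro order_trans[OF norm_triangle_ineq] add_mono norm_triangle_ineq order_refl)
    also have "\<dots> \<le> B R"
    proof -
      have side: "norm (f w) \<le> 1 / (R - norm p)" if "\<bar>Re w\<bar> = R" "Im w \<ge> 0" for w
      proof -
        have "norm (e2pi (of_real \<alpha> * w)) \<le> 1"
          using that \<alpha> by (simp add: norm_e2pi)
        moreover have "R - norm p \<le> norm (w - p)"
          using norm_triangle_ineq2[of w p] abs_Re_le_cmod[of w] that by linarith
        ultimately show ?thesis
          using R unfolding f_def norm_divide by (intro frac_le) auto
      qed
      have top: "norm (f w) \<le> exp (- (2 * pi * \<alpha> * sqrt R)) / (sqrt R - norm p)" if "Im w = sqrt R" for w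
      proof -
        have "norm (e2pi (of_real \<alpha> * w)) = exp (- (2 * pi * \<alpha> * sqrt R))"
          using that by (simp add: norm_e2pi)
        moreover have "sqrt R - norm p \<le> norm (w - p)"
          using norm_triangle_ineq2[of w p] abs_Im_le_cmod[of w] that R0 by linarith
        ultimately show ?thesis
          using R unfolding f_def norm_divide by (intro frac_le) auto
      qed
      have seg: "w \<in> closed_segment z2 z3 \<Longrightarrow> \<bar>Re w\<bar> = R \<and> Im w \<ge> 0"
          "w \<in> closed_segment z4 z1 \<Longrightarrow> \<bar>Re w\<bar> = R \<and> Im w \<ge> 0"
          "w \<in> closed_segment z3 z4 \<Longrightarrow> Im w = sqrt R" for w
        using R0 by (auto simp: z_defs closed_segment_same_Re closed_segment_same_Im closed_segment_eq_real_ivl)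
      have "norm (contour_integral (linepath z2 z3) f) \<le> 1 / (R - norm p) * norm (z3 - z2)"
        by (rule contour_integral_bound_linepath[OF cis(2)])
          (use R R0 side seg in auto)
      moreover have "norm (z3 - z2) = sqrt R" "norm (z1 - z4) = sqrt R" "norm (z4 - z3) = 2 * R"
        using R0 by (auto simp: z_defs cmod_def Complex_eq real_sqrt_mult)
      moreover have "norm (contour_integral (linepath z4 z1) f) \<le> 1 / (R - norm p) * norm (z1 - z4)"
        by (rule contour_integral_bound_linepath[OF cis(4)])
          (use R R0 side seg in auto)
      moreover have "norm (contour_integral (linepath z3 z4) f) \<le>
          exp (- (2 * pi * \<alpha> * sqrt R)) / (sqrt R - norm p) * norm (z4 - z3)"
        by (rule contour_integral_bound_linepath[OF cis(3)])
          (use R R0 top seg in auto)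
      ultimately have "norm (contour_integral (linepath z2 z3) f) +
          (norm (contour_integral (linepath z3 z4) f) + norm (contour_integral (linepath z4 z1) f)) \<le>
          sqrt R / (R - norm p) + (2 * R * exp (- (2 * pi * \<alpha> * sqrt R)) / (sqrt R - norm p)
            + sqrt R / (R - norm p))"
        by (intro add_mono) (simp_all add: mult_ac)
      then show ?thesis
        by (simp only: B_def add.assoc)
    qed
    finally show ?thesis .
  qed
  have "(B \<longlongrightarrow> 0) at_top"
    unfolding B_def[abs_def] using \<alpha> by real_asymp
  moreover have "\<forall>\<^sub>F R in at_top. norm ((LINT a:{- R..R}|lborel. f (of_real a)) - L) \<le> B R"
  proof -
    have "filterlim (sqrt :: real \<Rightarrow> real) at_top at_top" by (rule sqrt_at_top)
    then have "\<forall>\<^sub>F R in at_top. sqrt R > norm p"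
      by (simp add: filterlim_at_top_dense)
    with eventually_gt_at_top[of "norm p + 1"] show ?thesis
      by eventually_elim (rule bound)
  qed
  ultimately have "((\<lambda>R. (LINT a:{- R..R}|lborel. f (of_real a)) - L) \<longlongrightarrow> 0) at_top"
    by (rule Lim_null_comparison[rotated])
  then have "((\<lambda>R. LINT a:{- R..R}|lborel. f (of_real a)) \<longlongrightarrow> L) at_top"
    by (rule Lim_null[THEN iffD2])
  then show ?thesis
    by (simp add: f_def L_def mult.commute)
qed

text \<open>Complex conjugation changes the sign of \<alpha> and moves the pole to the other
  half-plane, which reduces negative \<alpha> to the positive case.\<close>

lemma fourier_simple_pole:
  assumes \<alpha>: "\<alpha> \<noteq> 0" and p: "Im p \<noteq> 0"
  shows "((\<lambda>R. LINT a:{- R..R}|lborel. e2pi (of_real (a * \<alpha>)) / (of_real a - p)) \<longlongrightarrow>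
    2 * of_real pi * \<i> * e2pi (of_real \<alpha> * p) * (of_real (sgn \<alpha>) * of_bool (\<alpha> * Im p > 0))) at_top"
proof (cases "\<alpha> > 0")
  case True
  then show ?thesis
    using fourier_simple_pole_pos[OF True p] by (simp add: zero_less_mult_iff)
next
  case False
  then have \<alpha>: "\<alpha> < 0" using \<alpha> by simp
  have "((\<lambda>R. cnj (LINT a:{- R..R}|lborel. e2pi (of_real (a * - \<alpha>)) / (of_real a - cnj p))) \<longlongrightarrow>
    cnj (2 * of_real pi * \<i> * e2pi (of_real (- \<alpha>) * cnj p) * of_bool (Im (cnj p) > 0))) at_top"
    using \<alpha> p by (intro tendsto_cnj fourier_simple_pole_pos) auto
  moreover have "cnj (LINT a:{- R..R}|lborel. e2pi (of_real (a * - \<alpha>)) / (of_real a - cnj p)) =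
      (LINT a:{- R..R}|lborel. e2pi (of_real (a * \<alpha>)) / (of_real a - p))" for R
    unfolding set_lebesgue_integral_def Bochner_Integration.integral_cnj[symmetric]
    by (simp add: cnj_e2pi)
  moreover have "cnj (2 * of_real pi * \<i> * e2pi (of_real (- \<alpha>) * cnj p) * of_bool (Im (cnj p) > 0)) =
      2 * of_real pi * \<i> * e2pi (of_real \<alpha> * p) * (of_real (sgn \<alpha>) * of_bool (\<alpha> * Im p > 0))"
    using \<alpha> by (auto simp: cnj_e2pi zero_less_mult_iff)
  ultimately show ?thesis by (simp only:)
qed

section \<open>A Gaussian integral with a pole\<close>

text \<open>Differentiation in \<alpha> multiplies the integrand by 2 pi i a, and the factor
  e(-\<alpha> \<beta> \<tau>) replaces a by a - \<beta> \<tau>. This is the denominator divided by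
  \<sigma>, so the pole cancels and a Gaussian of parameter 2 \<sigma> remains, whose integral is
  known. The constant of integration is found as \<alpha> tends to infinity away from \<beta>, where
  the primitive tends to half of a Gaussian constant with the sign of \<beta>.\<close>

lemma slice_gaussian_integral:
  assumes \<tau>: "Im \<tau> > 0" and \<beta>: "\<beta> \<noteq> 0"
  defines "\<sigma> \<equiv> - 1 / \<tau>"
  defines "f \<equiv> \<lambda>\<alpha> a. 2 * e2pi (of_real (a\<^sup>2 / 2) * (2 * \<sigma>) + of_real ((\<alpha> + \<beta>) * a)) /
    (2 * of_real pi * \<i> * (of_real a * \<sigma> + of_real \<beta>))"
  shows "integrable lborel (f \<alpha>)"
    and "(LINT a|lborel. f \<alpha> a) = \<tau> * e2pi (of_real (\<alpha> * \<beta>) * \<tau>) *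
      (2 * gauss_const \<sigma> * gauss_primitive \<tau> ((\<beta> - \<alpha>) / sqrt 2) - of_real (sgn \<beta>))"
proof -
  have [simp]: "\<tau> \<noteq> 0" using \<tau> by auto
  have \<sigma>: "Im \<sigma> > 0" "Im (2 * \<sigma>) > 0"
    using \<tau> by (simp_all add: \<sigma>_def Im_divide divide_pos_pos complex_eq_iff sum_power2_gt_zero_iff)
  have [simp]: "\<sigma> \<noteq> 0" using \<sigma> by auto
  define \<delta> where "\<delta> = \<bar>\<beta>\<bar> * Im \<sigma> / norm \<sigma>"
  have \<delta>: "\<delta> > 0" using \<sigma> \<beta> by (simp add: \<delta>_def)
  define c where "c a = of_real a * \<sigma> + of_real \<beta>" for a
  have c_eq: "c a = \<sigma> * (of_real a - of_real \<beta> * \<tau>)" for a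
    by (simp add: c_def \<sigma>_def field_simps)
  have c_ge: "\<delta> \<le> norm (c a)" for a
    unfolding \<delta>_def c_def by (rule norm_linear_lower_bound[OF \<sigma>(1)])
  then have c_ne: "c a \<noteq> 0" for a
    using \<delta> by (metis norm_zero not_le)
  define q where "q \<alpha> a = e2pi (of_real (a\<^sup>2 / 2) * (2 * \<sigma>) + of_real ((\<alpha> + \<beta>) * a))" for \<alpha> a
  have norm_q: "norm (q \<alpha> a) = exp (- (2 * pi * Im \<sigma> * a\<^sup>2))" for \<alpha> a
    unfolding q_def norm_e2pi_quadratic by simp
  have f_eq: "f \<alpha> a = q \<alpha> a / (of_real pi * \<i> * c a)" for \<alpha> a
    by (simp add: f_def q_def c_def)
  have norm_f: "norm (f \<alpha> a) \<le> exp (- (2 * pi * Im \<sigma> * a\<^sup>2)) / (pi * \<delta>)" for \<alpha> a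
    unfolding f_eq norm_divide norm_mult norm_q using c_ge[of a] \<delta>
    by (intro divide_left_mono mult_pos_pos) auto
  have [measurable]: "f \<alpha> \<in> borel_measurable borel" for \<alpha>
    unfolding f_def by measurable
  have int_af: "integrable lborel (\<lambda>a. of_real (a ^ n) * f \<alpha> a)" for \<alpha> n
  proof (rule Bochner_Integration.integrable_bound)
    show "integrable lborel (\<lambda>a. \<bar>a\<bar> ^ n * exp (- (2 * pi * Im \<sigma> * a\<^sup>2)) / (pi * \<delta>))"
      using \<sigma> by (intro integrable_divide integrable_power_gaussian) simp
    show "AE a in lborel. norm (of_real (a ^ n) * f \<alpha> a) \<le>
        norm (\<bar>a\<bar> ^ n * exp (- (2 * pi * Im \<sigma> * a\<^sup>2)) / (pi * \<delta>))"
    proof (rule AE_I2)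
      fix a :: real
      have "norm (of_real (a ^ n) * f \<alpha> a) \<le> \<bar>a\<bar> ^ n * (exp (- (2 * pi * Im \<sigma> * a\<^sup>2)) / (pi * \<delta>))"
        unfolding norm_mult using norm_f[of \<alpha> a]
        by (intro mult_mono) (auto simp: norm_power power_abs)
      then show "norm (of_real (a ^ n) * f \<alpha> a) \<le>
          norm (\<bar>a\<bar> ^ n * exp (- (2 * pi * Im \<sigma> * a\<^sup>2)) / (pi * \<delta>))"
        using \<delta> by simp
    qed
  qed measurable
  have int_f: "integrable lborel (f \<alpha>)" for \<alpha>
    using int_af[of 0 \<alpha>] by simp
  show "integrable lborel (f \<alpha>)" by (rule int_f)
  define M where "M \<alpha> = (LINT a|lborel. f \<alpha> a)" for \<alpha>
  define e where "e \<alpha> = e2pi (- of_real (\<alpha> * \<beta>) * \<tau>)" for \<alpha>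
  define C where "C = gauss_const \<sigma>"
  define N where "N \<alpha> = e \<alpha> * M \<alpha> - \<tau> * (2 * C * gauss_primitive \<tau> ((\<beta> - \<alpha>) / sqrt 2) - of_real (sgn \<beta>))" for \<alpha>
  have dN: "(N has_vector_derivative 0) (at \<alpha>)" for \<alpha>
  proof -
    let ?df = "\<lambda>\<alpha> a. 2 * of_real pi * \<i> * (of_real (a ^ 1) * f \<alpha> a)"
    have dM: "(M has_vector_derivative (LINT a|lborel. ?df \<alpha> a)) (at \<alpha>)"
      unfolding M_def
    proof (rule has_vector_derivative_integral_dominated[where
          g = "\<lambda>a. 2 * pi * (\<bar>a\<bar> ^ 1 * exp (- (2 * pi * Im \<sigma> * a\<^sup>2)) / (pi * \<delta>))"])
      show "((\<lambda>t. f t a) has_vector_derivative ?df t a) (at t)" for t a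
      proof -
        have "((\<lambda>t. q t a) has_vector_derivative 2 * of_real pi * \<i> * of_real a * q t a) (at t)"
          unfolding q_def of_real_mult of_real_add
          by (rule has_vector_derivative_real_field) (auto intro!: derivative_eq_intros)
        from has_vector_derivative_divide[OF this, of "of_real pi * \<i> * c a"]
        show ?thesis
          unfolding f_eq by (rule has_vector_derivative_eq_rhs) simp
      qed
      show "norm (?df t a) \<le> 2 * pi * (\<bar>a\<bar> ^ 1 * exp (- (2 * pi * Im \<sigma> * a\<^sup>2)) / (pi * \<delta>))" for t a
      proof -
        have "norm (?df t a) = 2 * pi * (\<bar>a\<bar> * norm (f t a))"
          by (simp add: norm_mult)
        also have "\<dots> \<le> 2 * pi * (\<bar>a\<bar> * (exp (- (2 * pi * Im \<sigma> * a\<^sup>2)) / (pi * \<delta>)))"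
          using norm_f[of t a] by (intro mult_left_mono) auto
        finally show ?thesis by simp
      qed
      show "integrable lborel (\<lambda>a. 2 * pi * (\<bar>a\<bar> ^ 1 * exp (- (2 * pi * Im \<sigma> * a\<^sup>2)) / (pi * \<delta>)))"
        using \<sigma> by (intro integrable_mult_right integrable_divide integrable_power_gaussian) simp
      show "?df \<alpha> \<in> borel_measurable lborel"
        by (intro borel_measurable_integrable integrable_mult_right int_af)
    qed (use int_f in auto)
    have "(LINT a|lborel. ?df \<alpha> a) - 2 * of_real pi * \<i> * of_real \<beta> * \<tau> * M \<alpha> =
        (LINT a|lborel. ?df \<alpha> a - 2 * of_real pi * \<i> * of_real \<beta> * \<tau> * f \<alpha> a)"
      unfolding M_def
      by (subst Bochner_Integration.integral_diff)
        (auto intro!: integrable_mult_right int_f int_af[of 1, simplified])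
    also have "\<dots> = (LINT a|lborel. (2 / \<sigma>) * q \<alpha> a)"
    proof (rule Bochner_Integration.integral_cong[OF refl])
      fix a
      have "?df \<alpha> a - 2 * of_real pi * \<i> * of_real \<beta> * \<tau> * f \<alpha> a =
          2 * of_real pi * \<i> * (of_real a - of_real \<beta> * \<tau>) * f \<alpha> a"
        by (simp add: algebra_simps)
      also have "\<dots> = (2 / \<sigma>) * q \<alpha> a"
      proof -
        have "of_real a - of_real \<beta> * \<tau> = c a / \<sigma>"
          by (simp add: c_eq)
        then show ?thesis
          unfolding f_eq using c_ne[of a] by simp
      qed
      finally show "?df \<alpha> a - 2 * of_real pi * \<i> * of_real \<beta> * \<tau> * f \<alpha> a = (2 / \<sigma>) * q \<alpha> a" .
    qed
    also have "\<dots> = (2 / \<sigma>) * (gauss_const (2 * \<sigma>) * e2pi (- of_real ((\<alpha> + \<beta>)\<^sup>2 / 2) / (2 * \<sigma>)))"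
      unfolding q_def by (simp only: integral_mult_right_zero gaussian_fourier[OF \<sigma>(2)])
    also have "\<dots> = - \<tau> * of_real (sqrt 2) * C * e2pi (of_real ((\<alpha> + \<beta>)\<^sup>2 / 4) * \<tau>)"
    proof -
      have e1: "- of_real ((\<alpha> + \<beta>)\<^sup>2 / 2) / (2 * \<sigma>) = of_real ((\<alpha> + \<beta>)\<^sup>2 / 4) * \<tau>"
        by (simp add: \<sigma>_def)
      have e2: "2 / complex_of_real (sqrt 2) = of_real (sqrt 2)"
        by (simp add: field_simps flip: of_real_mult)
      have e3: "2 / \<sigma> = - 2 * \<tau>" by (simp add: \<sigma>_def)
      have "- 2 * \<tau> * (C / of_real (sqrt 2) * z) = - \<tau> * (2 / of_real (sqrt 2)) * C * z" for z
        by simp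
      then show ?thesis
        unfolding gauss_const_double[OF \<sigma>(1)] C_def[symmetric] e1 e3 by (simp only: e2)
    qed
    finally have M': "(LINT a|lborel. ?df \<alpha> a) - 2 * of_real pi * \<i> * of_real \<beta> * \<tau> * M \<alpha> =
        - \<tau> * of_real (sqrt 2) * C * e2pi (of_real ((\<alpha> + \<beta>)\<^sup>2 / 4) * \<tau>)" .
    have de: "(e has_vector_derivative - 2 * of_real pi * \<i> * of_real \<beta> * \<tau> * e \<alpha>) (at \<alpha>)"
      unfolding e_def of_real_mult
      by (rule has_vector_derivative_real_field) (auto intro!: derivative_eq_intros)
    have dE: "((\<lambda>\<alpha>. gauss_primitive \<tau> ((\<beta> - \<alpha>) / sqrt 2)) has_vector_derivative
        (- 1 / sqrt 2) *\<^sub>R e2pi (of_real (((\<beta> - \<alpha>) / sqrt 2)\<^sup>2 / 2) * \<tau>)) (at \<alpha>)"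
    proof -
      have "((\<lambda>\<alpha>. (\<beta> - \<alpha>) / sqrt 2) has_vector_derivative - 1 / sqrt 2) (at \<alpha>)"
        using DERIV_cdivide[OF DERIV_diff[OF DERIV_const[of \<beta>] DERIV_ident], of "sqrt 2" \<alpha> UNIV]
        by (simp add: has_real_derivative_iff_has_vector_derivative)
      from vector_diff_chain_at[OF this gauss_primitive_has_vector_derivative]
      show ?thesis by (simp add: o_def)
    qed
    \<comment> \<open>Completing the square: -\<alpha> \<beta> + (\<alpha> + \<beta>)^2 / 4 =
      (\<beta> - \<alpha>)^2 / 4, so the derivative is a pure Gaussian in \<beta> -
      \<alpha>.\<close>
    have e_shift: "e \<alpha> * e2pi (of_real ((\<alpha> + \<beta>)\<^sup>2 / 4) * \<tau>) = e2pi (of_real (((\<beta> - \<alpha>) / sqrt 2)\<^sup>2 / 2) * \<tau>)"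
    proof -
      have "- (\<alpha> * \<beta>) + (\<alpha> + \<beta>)\<^sup>2 / 4 = ((\<beta> - \<alpha>) / sqrt 2)\<^sup>2 / 2"
        by (simp add: power_divide power2_eq_square field_simps)
      then have "- of_real (\<alpha> * \<beta>) * \<tau> + of_real ((\<alpha> + \<beta>)\<^sup>2 / 4) * \<tau> = of_real (((\<beta> - \<alpha>) / sqrt 2)\<^sup>2 / 2) * \<tau>"
        by (metis distrib_right of_real_add of_real_minus)
      then show ?thesis
        by (simp only: e_def e2pi_add[symmetric])
    qed
    have "(N has_vector_derivative
        (e \<alpha> * (LINT a|lborel. ?df \<alpha> a) + - 2 * of_real pi * \<i> * of_real \<beta> * \<tau> * e \<alpha> * M \<alpha>)
        - \<tau> * (2 * C * ((- 1 / sqrt 2) *\<^sub>R e2pi (of_real (((\<beta> - \<alpha>) / sqrt 2)\<^sup>2 / 2) * \<tau>)) - 0)) (at \<alpha>)"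
      unfolding N_def[abs_def]
      by (intro has_vector_derivative_diff has_vector_derivative_mult has_vector_derivative_mult_right
          has_vector_derivative_const de dM dE)
    then show ?thesis
    proof (rule has_vector_derivative_eq_rhs)
      have "e \<alpha> * (LINT a|lborel. ?df \<alpha> a) + - 2 * of_real pi * \<i> * of_real \<beta> * \<tau> * e \<alpha> * M \<alpha> =
          e \<alpha> * ((LINT a|lborel. ?df \<alpha> a) - 2 * of_real pi * \<i> * of_real \<beta> * \<tau> * M \<alpha>)"
        by (simp add: algebra_simps)
      also have "\<dots> = - \<tau> * of_real (sqrt 2) * C * (e \<alpha> * e2pi (of_real ((\<alpha> + \<beta>)\<^sup>2 / 4) * \<tau>))"
        unfolding M' by (simp only: mult_ac)
      also have "\<dots> = \<tau> * (2 * C * ((- 1 / sqrt 2) *\<^sub>R e2pi (of_real (((\<beta> - \<alpha>) / sqrt 2)\<^sup>2 / 2) * \<tau>)) - 0)"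
      proof -
        have "2 * (- 1 / sqrt 2) = - sqrt 2" by (simp add: field_simps)
        then have "2 * complex_of_real (- 1 / sqrt 2) = - of_real (sqrt 2)"
          by (metis of_real_minus of_real_mult of_real_numeral)
        moreover have "\<tau> * (2 * C * (r * z) - 0) = \<tau> * C * (2 * r) * z" for r z
          by simp
        ultimately show ?thesis
          unfolding e_shift scaleR_conv_of_real by (simp only:) simp
      qed
      finally show "(e \<alpha> * (LINT a|lborel. ?df \<alpha> a) + - 2 * of_real pi * \<i> * of_real \<beta> * \<tau> * e \<alpha> * M \<alpha>)
        - \<tau> * (2 * C * ((- 1 / sqrt 2) *\<^sub>R e2pi (of_real (((\<beta> - \<alpha>) / sqrt 2)\<^sup>2 / 2) * \<tau>)) - 0) = 0"
        by simp
    qed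
  qed
  then have N_const: "N s = N t" for s t
    using has_vector_derivative_zero_constant[of UNIV N]
    by (metis UNIV_I convex_UNIV has_vector_derivative_at_within)
  define K where "K = (LINT a|lborel. exp (- (2 * pi * Im \<sigma> * a\<^sup>2)) / (pi * \<delta>))"
  \<comment> \<open>\<open>M\<close> is bounded independently of \<alpha>, since \<alpha> enters its
    integrand only through a factor of modulus 1; all decay comes from \<open>e\<close>.\<close>
  have norm_eM: "norm (e \<alpha> * M \<alpha>) \<le> exp (2 * pi * Im \<tau> * \<beta> * \<alpha>) * K" for \<alpha>
  proof -
    have "norm (M \<alpha>) \<le> K"
      unfolding M_def K_def
      by (rule Bochner_Integration.integral_norm_bound_integral)
        (use int_f norm_f \<sigma> in \<open>auto intro!: integrable_divide integrable_gaussian\<close>)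
    then show ?thesis
      unfolding norm_mult by (intro mult_mono) (auto simp: e_def norm_e2pi mult_ac)
  qed
  have CC: "C * gauss_const \<tau> = 1"
    unfolding C_def \<sigma>_def by (rule gauss_const_inverse[OF \<tau>])
  have "N \<alpha> = 0"
  proof (cases "\<beta> > 0")
    case True
    have "((\<lambda>t. exp (2 * pi * Im \<tau> * \<beta> * t) * K) \<longlongrightarrow> 0) at_bot"
      using True \<tau> by real_asymp
    then have "((\<lambda>t. e t * M t) \<longlongrightarrow> 0) at_bot"
      by (rule Lim_null_comparison[rotated]) (rule always_eventually, rule allI, rule norm_eM)
    moreover have "filterlim (\<lambda>t. (\<beta> - t) / sqrt 2) at_top at_bot"
      by real_asymp
    then have "((\<lambda>t. gauss_primitive \<tau> ((\<beta> - t) / sqrt 2)) \<longlongrightarrow> gauss_const \<tau> / 2) at_bot"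
      by (rule filterlim_compose[OF gauss_primitive_tendsto(1)[OF \<tau>]])
    ultimately have "(N \<longlongrightarrow> 0 - \<tau> * (2 * C * (gauss_const \<tau> / 2) - of_real (sgn \<beta>))) at_bot"
      unfolding N_def[abs_def] by (intro tendsto_intros)
    moreover have "0 - \<tau> * (2 * C * (gauss_const \<tau> / 2) - of_real (sgn \<beta>)) = 0"
      using CC True by simp
    moreover have "N = (\<lambda>_. N \<alpha>)" using N_const by blast
    ultimately have "((\<lambda>_::real. N \<alpha>) \<longlongrightarrow> 0) at_bot" by metis
    then show ?thesis by (simp add: tendsto_const_iff)
  next
    case False
    then have neg: "\<beta> < 0" using \<beta> by simp
    define b where "b = - \<beta>"
    have "b > 0" using neg by (simp add: b_def)
    then have "((\<lambda>t. exp (- (2 * pi * Im \<tau> * b * t)) * K) \<longlongrightarrow> 0) at_top"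
      using \<tau> by real_asymp
    then have "((\<lambda>t. exp (2 * pi * Im \<tau> * \<beta> * t) * K) \<longlongrightarrow> 0) at_top"
      by (simp add: b_def)
    then have "((\<lambda>t. e t * M t) \<longlongrightarrow> 0) at_top"
      by (rule Lim_null_comparison[rotated]) (rule always_eventually, rule allI, rule norm_eM)
    moreover have "filterlim (\<lambda>t. (\<beta> - t) / sqrt 2) at_bot at_top"
      by real_asymp
    then have "((\<lambda>t. gauss_primitive \<tau> ((\<beta> - t) / sqrt 2)) \<longlongrightarrow> - (gauss_const \<tau> / 2)) at_top"
      by (rule filterlim_compose[OF gauss_primitive_tendsto(2)[OF \<tau>]])
    ultimately have "(N \<longlongrightarrow> 0 - \<tau> * (2 * C * (- (gauss_const \<tau> / 2)) - of_real (sgn \<beta>))) at_top"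
      unfolding N_def[abs_def] by (intro tendsto_intros)
    moreover have "0 - \<tau> * (2 * C * (- (gauss_const \<tau> / 2)) - of_real (sgn \<beta>)) = 0"
      using CC neg by simp
    moreover have "N = (\<lambda>_. N \<alpha>)" using N_const by blast
    ultimately have "((\<lambda>_::real. N \<alpha>) \<longlongrightarrow> 0) at_top" by metis
    then show ?thesis by (simp add: tendsto_const_iff)
  qed
  then have "e \<alpha> * M \<alpha> = \<tau> * (2 * C * gauss_primitive \<tau> ((\<beta> - \<alpha>) / sqrt 2) - of_real (sgn \<beta>))"
    by (simp add: N_def)
  moreover have "e2pi (of_real (\<alpha> * \<beta>) * \<tau>) * e \<alpha> = 1"
    by (simp add: e_def e2pi_add[symmetric])
  then have "M \<alpha> = e2pi (of_real (\<alpha> * \<beta>) * \<tau>) * (e \<alpha> * M \<alpha>)"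
    by (simp only: mult.assoc[symmetric] mult_1_left)
  ultimately show "(LINT a|lborel. f \<alpha> a) = \<tau> * e2pi (of_real (\<alpha> * \<beta>) * \<tau>) *
      (2 * gauss_const \<sigma> * gauss_primitive \<tau> ((\<beta> - \<alpha>) / sqrt 2) - of_real (sgn \<beta>))"
    unfolding M_def[symmetric] C_def[symmetric] by (simp only: mult.assoc mult.left_commute)
qed

section \<open>The transform of \<open>phi_plus\<close>\<close>

lemma tendsto_integral_symmetric_interval:
  fixes f :: "real \<Rightarrow> 'b :: {banach, second_countable_topology}"
  assumes f: "integrable lborel f"
  shows "((\<lambda>R. LINT a:{- R..R}|lborel. f a) \<longlongrightarrow> (LINT a|lborel. f a)) at_top"
  unfolding set_lebesgue_integral_def
proof (rule integral_dominated_convergence_at_top[where w = "\<lambda>a. norm (f a)"])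
  show "AE a in lborel. ((\<lambda>R. indicator {- R..R} a *\<^sub>R f a) \<longlongrightarrow> f a) at_top"
  proof (rule AE_I2)
    fix a :: real
    have "\<forall>\<^sub>F R in at_top. indicator {- R..R} a *\<^sub>R f a = f a"
      using eventually_ge_at_top[of "\<bar>a\<bar>"] by eventually_elim (auto simp: indicator_def)
    then show "((\<lambda>R. indicator {- R..R} a *\<^sub>R f a) \<longlongrightarrow> f a) at_top"
      by (rule tendsto_eventually)
  qed
qed (use f in \<open>auto simp: indicator_def\<close>)

text \<open>The slice is the absolutely integrable Gaussian term minus a multiple of e(a
  \<alpha>)/(a - p) with pole p = \<beta> \<tau>. The second term converges only over symmetric
  intervals, and its residue carries the same exponential e(\<alpha> \<beta> \<tau>) as the
  first.\<close>

lemma slice_integral_tendsto: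
  assumes \<tau>: "Im \<tau> > 0" and \<alpha>: "\<alpha> \<noteq> 0" and \<beta>: "\<beta> \<noteq> 0"
  defines "\<sigma> \<equiv> - 1 / \<tau>"
  shows "((\<lambda>R. LINT a:{- R..R}|lborel. slice \<sigma> \<alpha> \<beta> a) \<longlongrightarrow>
    \<tau> * e2pi (of_real (\<alpha> * \<beta>) * \<tau>) * (2 * gauss_const \<sigma> * gauss_primitive \<tau> ((\<beta> - \<alpha>) / sqrt 2)
      - of_real (sgn (\<beta> - \<alpha>)) * of_bool (\<alpha> * \<beta> < 0))) at_top"
proof -
  have [simp]: "\<tau> \<noteq> 0" using \<tau> by auto
  have \<sigma>: "\<sigma> \<noteq> 0" "1 / \<sigma> = - \<tau>" by (simp_all add: \<sigma>_def)
  define f where "f a = 2 * e2pi (of_real (a\<^sup>2 / 2) * (2 * \<sigma>) + of_real ((\<alpha> + \<beta>) * a)) /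
    (2 * of_real pi * \<i> * (of_real a * \<sigma> + of_real \<beta>))" for a
  define p where "p = of_real \<beta> * \<tau>"
  define g where "g a = e2pi (of_real (a * \<alpha>)) / (of_real a - p)" for a
  define k where "k = 1 / (2 * of_real pi * \<i> * \<sigma>)"
  have p: "Im p \<noteq> 0" using \<tau> \<beta> by (simp add: p_def)
  have f: "integrable lborel f" "(LINT a|lborel. f a) = \<tau> * e2pi (of_real (\<alpha> * \<beta>) * \<tau>) *
      (2 * gauss_const \<sigma> * gauss_primitive \<tau> ((\<beta> - \<alpha>) / sqrt 2) - of_real (sgn \<beta>))"
    unfolding f_def \<sigma>_def using slice_gaussian_integral[OF \<tau> \<beta>, of \<alpha>] by simp_all
  have slice: "slice \<sigma> \<alpha> \<beta> a = f a - k * g a" for a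
  proof -
    have "of_real a * \<sigma> + of_real \<beta> = \<sigma> * (of_real a - p)"
      by (simp add: p_def \<sigma>_def field_simps)
    then have "k * g a = e2pi (of_real (a * \<alpha>)) / (2 * of_real pi * \<i> * (of_real a * \<sigma> + of_real \<beta>))"
      by (simp add: k_def g_def)
    moreover have "e2pi (of_real (a * \<alpha>)) * e2pi (of_real a * (of_real a * \<sigma> + of_real \<beta>)) =
        e2pi (of_real (a\<^sup>2 / 2) * (2 * \<sigma>) + of_real ((\<alpha> + \<beta>) * a))"
      by (simp add: e2pi_add[symmetric] power2_eq_square algebra_simps)
    then have "e2pi (of_real (a * \<alpha>)) * (2 * e2pi (of_real a * (of_real a * \<sigma> + of_real \<beta>)) - 1) =
        2 * e2pi (of_real (a\<^sup>2 / 2) * (2 * \<sigma>) + of_real ((\<alpha> + \<beta>) * a)) - e2pi (of_real (a * \<alpha>))"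
      by (simp only: right_diff_distrib mult.left_commute mult_1_right)
    ultimately show ?thesis
      unfolding slice_def f_def by (simp only: diff_divide_distrib)
  qed
  have g_int: "set_integrable lborel {- R..R} g" for R
  proof (rule borel_integrable_atLeastAtMost')
    have "of_real a \<noteq> p" for a using p by auto
    then show "continuous_on {- R..R} g"
      unfolding g_def by (intro continuous_intros) auto
  qed
  have f_int: "set_integrable lborel {- R..R} f" for R
    using f(1) by (auto simp: set_integrable_def intro: integrable_mult_indicator)
  have "(LINT a:{- R..R}|lborel. slice \<sigma> \<alpha> \<beta> a) =
      (LINT a:{- R..R}|lborel. f a) - k * (LINT a:{- R..R}|lborel. g a)" for R
    unfolding slice using f_int g_int
    by (subst set_integral_diff) (auto intro!: set_integrable_mult_right)
  moreover have "((\<lambda>R. (LINT a:{- R..R}|lborel. f a) - k * (LINT a:{- R..R}|lborel. g a)) \<longlongrightarrow>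
      \<tau> * e2pi (of_real (\<alpha> * \<beta>) * \<tau>) * (2 * gauss_const \<sigma> * gauss_primitive \<tau> ((\<beta> - \<alpha>) / sqrt 2) - of_real (sgn \<beta>))
      - k * (2 * of_real pi * \<i> * e2pi (of_real \<alpha> * p) * (of_real (sgn \<alpha>) * of_bool (\<alpha> * Im p > 0)))) at_top"
    unfolding f(2)[symmetric] g_def
    by (intro tendsto_intros tendsto_integral_symmetric_interval f fourier_simple_pole \<alpha> p)
  moreover have "\<tau> * e2pi (of_real (\<alpha> * \<beta>) * \<tau>) * (2 * gauss_const \<sigma> * gauss_primitive \<tau> ((\<beta> - \<alpha>) / sqrt 2) - of_real (sgn \<beta>))
      - k * (2 * of_real pi * \<i> * e2pi (of_real \<alpha> * p) * (of_real (sgn \<alpha>) * of_bool (\<alpha> * Im p > 0))) =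
      \<tau> * e2pi (of_real (\<alpha> * \<beta>) * \<tau>) * (2 * gauss_const \<sigma> * gauss_primitive \<tau> ((\<beta> - \<alpha>) / sqrt 2)
      - of_real (sgn (\<beta> - \<alpha>)) * of_bool (\<alpha> * \<beta> < 0))"
  proof -
    have k1: "k * (2 * of_real pi * \<i> * e2pi (of_real \<alpha> * p) * z) = - \<tau> * e2pi (of_real (\<alpha> * \<beta>) * \<tau>) * z" for z
    proof -
      have "k * (2 * of_real pi * \<i>) = 1 / \<sigma>"
        by (simp add: k_def)
      then have "k * (2 * of_real pi * \<i>) = - \<tau>"
        by (simp only: \<sigma>)
      moreover have "of_real \<alpha> * p = of_real (\<alpha> * \<beta>) * \<tau>"
        by (simp add: p_def)
      ultimately show ?thesis
        by (simp only: mult.assoc[symmetric])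
    qed
    have k2: "\<alpha> * Im p > 0 \<longleftrightarrow> \<alpha> * \<beta> > 0"
      using \<tau> by (auto simp: p_def zero_less_mult_iff mult_less_0_iff)
    \<comment> \<open>If \<alpha> and \<beta> have equal signs the two terms cancel; otherwise
      \<beta> - \<alpha> has the sign of \<beta>.\<close>
    have k3: "of_real (sgn \<beta>) - of_real (sgn \<alpha>) * of_bool (\<alpha> * \<beta> > 0) =
        (of_real (sgn (\<beta> - \<alpha>)) * of_bool (\<alpha> * \<beta> < 0) :: complex)"
      using \<alpha> \<beta> by (auto simp: sgn_if zero_less_mult_iff mult_less_0_iff)
    show ?thesis
      unfolding k1 k2 k3[symmetric] by (simp only: algebra_simps) (simp add: algebra_simps)
  qed
  ultimately show ?thesis by simp
qed

lemma prod_at_top_neq_bot: "(at_top \<times>\<^sub>F at_top :: (real \<times> real) filter) \<noteq> bot"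
  by (simp add: prod_filter_eq_bot)

text \<open>Here \<alpha> \<beta> = (y^2 - x^2)/2 and (\<beta> - \<alpha>)/sqrt(2) = x, so the limit
  of the slice integrals is the claimed value. The error K/T is uniform in T' and vanishes along the
  product filter.\<close>

lemma FT_rect_tendsto:
  assumes \<tau>: "Im \<tau> > 0" and xy: "x\<^sup>2 \<noteq> y\<^sup>2"
  shows "(FT_rect (phi_plus (- 1 / \<tau>)) x y \<longlongrightarrow>
    \<tau> * e2pi (of_real ((y\<^sup>2 - x\<^sup>2) / 2) * \<tau>) *
      (2 * gauss_const (- 1 / \<tau>) * gauss_primitive \<tau> x - of_real (sgn x) * of_bool (y\<^sup>2 \<le> x\<^sup>2)))
    (at_top \<times>\<^sub>F at_top)"
proof -
  define \<sigma> where "\<sigma> = - 1 / \<tau>"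
  define \<alpha> \<beta> where "\<alpha> = (y - x) / sqrt 2" and "\<beta> = (y + x) / sqrt 2"
  have \<sigma>: "Im \<sigma> > 0"
    using \<tau> by (simp add: \<sigma>_def Im_divide divide_pos_pos complex_eq_iff sum_power2_gt_zero_iff)
  have \<alpha>\<beta>: "\<alpha> * \<beta> = (y\<^sup>2 - x\<^sup>2) / 2"
    by (simp add: \<alpha>_def \<beta>_def power2_eq_square algebra_simps)
  then have nz: "\<alpha> \<noteq> 0" "\<beta> \<noteq> 0" using xy by auto
  have x: "(\<beta> - \<alpha>) / sqrt 2 = x"
    by (simp add: \<alpha>_def \<beta>_def field_simps)
  have sgn: "sgn (\<beta> - \<alpha>) = sgn x"
    by (metis sgn_divide sgn_1_pos real_sqrt_gt_zero zero_less_numeral div_by_1 x)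
  have bool: "\<alpha> * \<beta> < 0 \<longleftrightarrow> y\<^sup>2 \<le> x\<^sup>2"
    using xy unfolding \<alpha>\<beta> by auto
  define A where "A T' = (LINT a:{- T'..T'}|lborel. slice \<sigma> \<alpha> \<beta> a)" for T'
  define L where "L = \<tau> * e2pi (of_real ((y\<^sup>2 - x\<^sup>2) / 2) * \<tau>) *
      (2 * gauss_const \<sigma> * gauss_primitive \<tau> x - of_real (sgn x) * of_bool (y\<^sup>2 \<le> x\<^sup>2))"
  have "(A \<longlongrightarrow> L) at_top"
    using slice_integral_tendsto[OF \<tau> nz] unfolding \<sigma>_def[symmetric] x sgn \<alpha>\<beta> bool[unfolded \<alpha>\<beta>]
    by (simp only: A_def[abs_def] L_def)
  then have lim1: "((\<lambda>p. A (fst p)) \<longlongrightarrow> L) (at_top \<times>\<^sub>F at_top)"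
    by (rule filterlim_compose) (rule filterlim_fst)
  obtain K where K: "T > 0 \<Longrightarrow> norm (FT_rect (phi_plus \<sigma>) x y (T', T) - A T') \<le> K / T" for T' T
    using FT_rect_slice[OF \<sigma> \<alpha>_def \<beta>_def nz(2)] unfolding A_def by blast
  have "((\<lambda>T. K / T) \<longlongrightarrow> 0) at_top"
    by real_asymp
  then have "((\<lambda>p. K / snd p) \<longlongrightarrow> 0) (at_top \<times>\<^sub>F at_top)"
    by (rule filterlim_compose) (rule filterlim_snd)
  moreover have "\<forall>\<^sub>F p in at_top \<times>\<^sub>F at_top. norm (FT_rect (phi_plus \<sigma>) x y p - A (fst p)) \<le> K / snd p"
  proof -
    have "\<forall>\<^sub>F p in at_top \<times>\<^sub>F at_top. snd p > (0::real)"
      by (rule eventually_compose_filterlim[OF eventually_gt_at_top filterlim_snd])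
    then show ?thesis
      by eventually_elim (use K in force)
  qed
  ultimately have "((\<lambda>p. FT_rect (phi_plus \<sigma>) x y p - A (fst p)) \<longlongrightarrow> 0) (at_top \<times>\<^sub>F at_top)"
    by (rule Lim_null_comparison[rotated])
  from tendsto_add[OF this lim1] show ?thesis
    by (simp add: L_def \<sigma>_def)
qed

text \<open>The integrand is odd at the origin and the rectangle is symmetric. This settles the
  point where \<alpha> and \<beta> both vanish, to which the slice estimates do not apply.\<close>

lemma FT_rect_origin: "FT_rect (phi_plus \<sigma>) 0 0 p = 0"
proof (cases p)
  case (Pair T' T)
  let ?f = "\<lambda>p. indicator (rotated_rect T' T) p *\<^sub>R FT_integrand (phi_plus \<sigma>) 0 0 p"
  have odd: "?f (- p) = - ?f p" for p
  proof (cases p)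
    case (Pair w z)
    have "(- w + - z) / sqrt 2 = - ((w + z) / sqrt 2)" "(- z - - w) / sqrt 2 = - ((z - w) / sqrt 2)"
      by (simp_all add: field_simps)
    then have "(- w, - z) \<in> rotated_rect T' T \<longleftrightarrow> (w, z) \<in> rotated_rect T' T"
      unfolding rotated_rect_def mem_Collect_eq split by (simp only: abs_minus_cancel)
    moreover have "FT_integrand (phi_plus \<sigma>) 0 0 (- w, - z) = - FT_integrand (phi_plus \<sigma>) 0 0 (w, z)"
      by (simp add: FT_integrand_def phi_plus_def sgn_minus)
    ultimately show ?thesis
      by (simp add: Pair indicator_def)
  qed
  have "distr lborel borel uminus = (lborel :: (real \<times> real) measure)"
    by (subst lborel_affine[of "-1" 0]) (auto simp: density_1 one_ennreal_def[symmetric])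
  then have "(LINT p|lborel. ?f p) = (LINT p|distr lborel borel uminus. ?f p)"
    by (simp only:)
  also have "\<dots> = (LINT p|lborel. ?f (- p))"
    by (rule integral_distr) auto
  also have "\<dots> = - (LINT p|lborel. ?f p)"
    unfolding odd by simp
  finally show ?thesis
    by (simp add: Pair FT_rect_def set_lebesgue_integral_def eq_neg_iff_add_eq_0 flip: mult_2)
qed

lemma FT_improper_eq:
  assumes \<tau>: "Im \<tau> > 0" and xy: "x\<^sup>2 \<noteq> y\<^sup>2"
  shows "FT_improper (phi_plus (- 1 / \<tau>)) x y = \<tau> * e2pi (of_real ((y\<^sup>2 - x\<^sup>2) / 2) * \<tau>) *
    (2 * gauss_const (- 1 / \<tau>) * gauss_primitive \<tau> x - of_real (sgn x) * of_bool (y\<^sup>2 \<le> x\<^sup>2))"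
  unfolding FT_improper_def by (rule tendsto_Lim[OF prod_at_top_neq_bot FT_rect_tendsto[OF \<tau> xy]])

lemma FT_improper_origin: "FT_improper (phi_plus \<sigma>) 0 0 = 0"
proof -
  have "FT_rect (phi_plus \<sigma>) 0 0 = (\<lambda>_. 0)"
    using FT_rect_origin by blast
  then show ?thesis
    unfolding FT_improper_def by (simp add: tendsto_Lim[OF prod_at_top_neq_bot tendsto_const])
qed

section \<open>Values on the cone x^2 = y^2\<close>

text \<open>The common formula for \<open>phi_plus\<close> \<tau> minus 1/\<tau> times the transform
  on both sides of the cone: the indicators of y^2 > x^2 and y^2 \<le> x^2 add up to 1, so the jump
  disappears. Only the sign is discontinuous, at x = 0, which meets the cone at the origin
  alone.\<close>

definition cone_extension :: "complex \<Rightarrow> real \<times> real \<Rightarrow> complex"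
  where "cone_extension \<tau> = (\<lambda>(x, y). e2pi (of_real ((y\<^sup>2 - x\<^sup>2) / 2) * \<tau>) *
    (of_real (sgn x) - 2 * gauss_const (- 1 / \<tau>) * gauss_primitive \<tau> x))"

lemma isCont_cone_extension:
  assumes "x \<noteq> 0"
  shows "isCont (cone_extension \<tau>) (x, y)"
proof -
  have "isCont sgn x"
    using assms by (simp add: isCont_def tendsto_sgn)
  moreover have "isCont (gauss_primitive \<tau>) x"
    using gauss_primitive_has_vector_derivative has_vector_derivative_continuous by blast
  ultimately show ?thesis
    using assms unfolding cone_extension_def split_def
    by (intro continuous_intros isCont_o2[where g = sgn and f = fst] isCont_o2[where g = "gauss_primitive \<tau>" and f = fst])
      auto
qed

text \<open>The value \<open>F\<close> is left free so that the computation serves both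
  \<open>FT_improper\<close> off the cone and \<open>FT_plus\<close> everywhere.\<close>

lemma phi_plus_minus_FT_plus:
  fixes F :: complex
  assumes "\<tau> \<noteq> 0"
    and "F = \<tau> * e2pi (of_real ((y\<^sup>2 - x\<^sup>2) / 2) * \<tau>) *
      (2 * gauss_const (- 1 / \<tau>) * gauss_primitive \<tau> x - of_real (sgn x) * of_bool (y\<^sup>2 \<le> x\<^sup>2))"
  shows "phi_plus \<tau> x y - 1 / \<tau> * F = cone_extension \<tau> (x, y)"
proof -
  have "of_bool (y\<^sup>2 > x\<^sup>2) + of_bool (y\<^sup>2 \<le> x\<^sup>2) = (1 :: complex)"
    by auto
  then have "of_real (sgn x) * of_bool (y\<^sup>2 > x\<^sup>2) = of_real (sgn x) - of_real (sgn x) * (of_bool (y\<^sup>2 \<le> x\<^sup>2) :: complex)"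
    by (auto simp: not_less)
  then show ?thesis
    using assms(1) unfolding assms(2) phi_plus_def cone_extension_def split mult.assoc
    by (simp add: algebra_simps)
qed

text \<open>This makes the limit in the definition of \<open>FT_plus\<close> unique, so that
  convergence determines the value of \<open>Lim\<close>.\<close>

lemma at_within_off_cone_neq_bot:
  fixes x y :: real
  assumes "x\<^sup>2 = y\<^sup>2" "y\<^sup>2 > 0"
  shows "at (x, y) within {(x', y'). x'\<^sup>2 \<noteq> y'\<^sup>2} \<noteq> bot"
proof -
  have xy: "x \<noteq> 0" "y \<noteq> 0" using assms by auto
  have "\<exists>p\<in>{(x', y'). x'\<^sup>2 \<noteq> y'\<^sup>2}. p \<noteq> (x, y) \<and> dist p (x, y) < e" if "e > 0" for e :: real
  proof -
    \<comment> \<open>With the sign of y, this shift strictly increases y^2, so (x, y + h) leaves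
      the cone.\<close>
    define h where "h = e / 2 * sgn y"
    have h: "\<bar>h\<bar> = e / 2" "y * h > 0"
      using xy \<open>e > 0\<close> by (auto simp: h_def abs_mult abs_sgn_eq sgn_if zero_less_mult_iff mult_less_0_iff)
    then have "(y + h)\<^sup>2 = y\<^sup>2 + (2 * (y * h) + h\<^sup>2)"
      by (simp add: power2_eq_square algebra_simps)
    moreover have "2 * (y * h) + h\<^sup>2 > 0"
      using h by (simp add: add_pos_nonneg)
    ultimately have "x\<^sup>2 \<noteq> (y + h)\<^sup>2"
      using assms by linarith
    then show ?thesis
      using h \<open>e > 0\<close> by (intro bexI[of _ "(x, y + h)"]) (auto simp: dist_Pair_Pair dist_real_def)
  qed
  then have "(x, y) islimpt {(x', y'). x'\<^sup>2 \<noteq> y'\<^sup>2}"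
    unfolding islimpt_approachable by blast
  then show ?thesis
    by (simp add: trivial_limit_within)
qed

text \<open>At the origin both sides vanish, because sign and primitive do. Elsewhere on the cone
  the limit is the value of the continuous function \<open>cone_extension\<close>; there
  \<open>phi_plus\<close> is 0, the exponential is 1 and y^2 \<le> x^2 holds, so the convention
  gives the same formula as off the cone.\<close>

lemma FT_plus_eq:
  assumes \<tau>: "Im \<tau> > 0"
  shows "FT_plus (- 1 / \<tau>) x y = \<tau> * e2pi (of_real ((y\<^sup>2 - x\<^sup>2) / 2) * \<tau>) *
    (2 * gauss_const (- 1 / \<tau>) * gauss_primitive \<tau> x - of_real (sgn x) * of_bool (y\<^sup>2 \<le> x\<^sup>2))"
proof -
  have \<tau>0 [simp]: "\<tau> \<noteq> 0" using \<tau> by auto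
  consider "x\<^sup>2 \<noteq> y\<^sup>2" | "x = 0" "y = 0" | "x\<^sup>2 = y\<^sup>2" "y\<^sup>2 > 0"
    by (cases "x\<^sup>2 = y\<^sup>2"; cases "y = 0") auto
  then show ?thesis
  proof cases
    case 1
    then have "FT_plus (- 1 / \<tau>) x y = FT_improper (phi_plus (- 1 / \<tau>)) x y"
      by (simp add: FT_plus_def)
    then show ?thesis by (simp only: FT_improper_eq[OF \<tau> 1])
  next
    case 2
    then show ?thesis by (simp add: FT_plus_def FT_improper_origin)
  next
    case 3
    then have "x \<noteq> 0" by auto
    let ?S = "{(x', y'). x'\<^sup>2 \<noteq> y'\<^sup>2} :: (real \<times> real) set"
    let ?f = "\<lambda>(x', y'). phi_plus \<tau> x' y' - 1 / \<tau> * FT_improper (phi_plus (- 1 / \<tau>)) x' y'"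
    have "(cone_extension \<tau> \<longlongrightarrow> cone_extension \<tau> (x, y)) (at (x, y) within ?S)"
      using isCont_cone_extension[OF \<open>x \<noteq> 0\<close>, of y \<tau>]
      by (simp add: continuous_within[symmetric] continuous_at_imp_continuous_at_within)
    moreover have "\<forall>\<^sub>F p in at (x, y) within ?S. cone_extension \<tau> p = ?f p"
      unfolding eventually_at_filter
      using phi_plus_minus_FT_plus[OF \<tau>0 FT_improper_eq[OF \<tau>]] by (auto intro!: always_eventually)
    ultimately have "(?f \<longlongrightarrow> cone_extension \<tau> (x, y)) (at (x, y) within ?S)"
      by (rule Lim_transform_eventually)
    then have "Lim (at (x, y) within ?S) ?f = cone_extension \<tau> (x, y)"
      by (intro tendsto_Lim at_within_off_cone_neq_bot 3)
    then have "FT_plus (- 1 / \<tau>) x y = \<tau> * (phi_plus \<tau> x y - cone_extension \<tau> (x, y))"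
      using 3 unfolding FT_plus_def by simp
    moreover have "phi_plus \<tau> x y = 0" "e2pi (of_real ((y\<^sup>2 - x\<^sup>2) / 2) * \<tau>) = 1"
      using 3 by (simp_all add: phi_plus_def del: of_real_diff)
    ultimately show ?thesis
      using 3 by (simp add: cone_extension_def algebra_simps del: of_real_diff of_real_divide)
  qed
qed

section \<open>Meaningfulness and value of the transform of \<open>phi_tilde\<close>\<close>

lemma FT_tilde_well_defined_neg_inverse:
  assumes \<tau>: "Im \<tau> > 0"
  shows "FT_tilde_well_defined (- 1 / \<tau>) x y"
proof -
  have \<tau>0 [simp]: "\<tau> \<noteq> 0" using \<tau> by auto
  have \<sigma>: "Im (- 1 / \<tau>) \<ge> 0"
    using \<tau> by (simp add: Im_divide)
  have "isCont (\<lambda>(x', y'). phi_plus (- 1 / (- 1 / \<tau>)) x' y' - 1 / (- 1 / (- 1 / \<tau>)) * FT_plus (- 1 / \<tau>) x' y') (x, y)"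
    if "y\<^sup>2 > 0" "x\<^sup>2 = y\<^sup>2"
  proof -
    have "x \<noteq> 0" using that by auto
    moreover have "- 1 / (- 1 / \<tau>) = \<tau>" by simp
    then have "(\<lambda>(x', y'). phi_plus (- 1 / (- 1 / \<tau>)) x' y' - 1 / (- 1 / (- 1 / \<tau>)) * FT_plus (- 1 / \<tau>) x' y') =
        cone_extension \<tau>"
      using phi_plus_minus_FT_plus[OF \<tau>0 FT_plus_eq[OF \<tau>]] by (simp only: fun_eq_iff split_paired_all split) simp
    ultimately show ?thesis
      using isCont_cone_extension by simp
  qed
  moreover have "(FT_rect (phi_plus (- 1 / \<tau>)) x y \<longlongrightarrow> FT_plus (- 1 / \<tau>) x y) (at_top \<times>\<^sub>F at_top)"
    if "\<not> (x\<^sup>2 = y\<^sup>2 \<and> y\<^sup>2 > 0)"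
  proof (cases "x\<^sup>2 = y\<^sup>2")
    case True
    then have "x = 0" "y = 0" using that by auto
    moreover have "FT_rect (phi_plus (- 1 / \<tau>)) 0 0 = (\<lambda>_. 0)"
      using FT_rect_origin by blast
    moreover have "FT_plus (- 1 / \<tau>) 0 0 = 0"
      using FT_plus_eq[OF \<tau>, of 0 0] by simp
    ultimately show ?thesis by simp
  next
    case False
    then show ?thesis
      unfolding FT_plus_eq[OF \<tau>] by (rule FT_rect_tendsto[OF \<tau>])
  qed
  ultimately show ?thesis
    unfolding FT_tilde_well_defined_def
    using integrable_FT_integrand_phi_star[OF \<tau>] set_integrable_phi_plus[OF \<sigma>] by auto
qed

text \<open>The terms with \<open>gauss_primitive\<close> cancel. The remaining bracket is the sign
  of x times 1 - [y^2 \<le> x^2] - erfc, and the first two terms form the indicator of y^2 >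
  x^2.\<close>

lemma FT_tilde_neg_inverse:
  assumes \<tau>: "Im \<tau> > 0"
  shows "FT_tilde (- 1 / \<tau>) x y = \<tau> * phi_tilde \<tau> x y"
proof -
  have b: "of_bool (y\<^sup>2 \<le> x\<^sup>2) = 1 - (of_bool (y\<^sup>2 > x\<^sup>2) :: complex)"
    by auto
  show ?thesis
    unfolding FT_tilde_def FT_plus_eq[OF \<tau>] FT_phi_star[OF \<tau>] phi_tilde_eq b of_real_mult of_real_diff
    by (simp add: algebra_simps)
qed

section \<open>Boundedness, translation by 1 and the \<xi>-operator\<close>

text \<open>The growth of the exponential in x is absorbed by the error function through
  \<open>norm_erfc_factor_le\<close>; the factor in y has modulus at most 1.\<close>

lemma norm_phi_star_le:
  assumes "Im \<tau> > 0"
  shows "norm (phi_star \<tau> x y) \<le> 1"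
proof -
  have "phi_star \<tau> x y = erfc_factor \<tau> x * e2pi (of_real (y\<^sup>2 / 2) * \<tau>)"
  proof -
    have "e2pi (of_real ((y\<^sup>2 - x\<^sup>2) / 2) * \<tau>) = e2pi (- of_real (x\<^sup>2 / 2) * \<tau>) * e2pi (of_real (y\<^sup>2 / 2) * \<tau>)"
      by (simp add: e2pi_add[symmetric] diff_divide_distrib algebra_simps)
    then show ?thesis
      unfolding phi_star_def erfc_factor_def by (simp only: of_real_mult mult_ac)
  qed
  moreover have "norm (erfc_factor \<tau> x) \<le> 1"
    by (rule order_trans[OF norm_erfc_factor_le[OF assms]]) (use assms in simp)
  moreover have "norm (e2pi (of_real (y\<^sup>2 / 2) * \<tau>)) \<le> 1"
    using assms by (simp add: norm_e2pi)
  ultimately show ?thesis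
    by (simp only: norm_mult mult_le_one norm_ge_zero)
qed

lemma phi_tilde_in_L_infty:
  assumes "Im \<tau> > 0"
  shows "(\<lambda>(x, y). phi_tilde \<tau> x y) \<in> L_infty"
proof -
  have "(\<lambda>(x, y). phi_tilde \<tau> x y) \<in> borel_measurable lborel"
    unfolding phi_tilde_def phi_plus_def phi_star_def of_bool_def
    by (simp add: borel_prod[symmetric])
  then have "(\<lambda>(x, y). phi_tilde \<tau> x y) \<in> borel_measurable lebesgue"
    by (rule measurable_completion)
  moreover have "norm (phi_tilde \<tau> x y) \<le> 1 + 1" for x y
    unfolding phi_tilde_def
    using assms by (intro order_trans[OF norm_triangle_ineq4] add_mono norm_phi_plus_le norm_phi_star_le) auto
  then have "AE p in lebesgue. norm ((\<lambda>(x, y). phi_tilde \<tau> x y) p) \<le> 1 + 1"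
    by (intro AE_I2) (simp add: split_def)
  ultimately show ?thesis
    unfolding L_infty_def by blast
qed

lemma phi_tilde_add_one: "phi_tilde (\<tau> + 1) x y = e2pi (of_real ((y\<^sup>2 - x\<^sup>2) / 2)) * phi_tilde \<tau> x y"
  unfolding phi_tilde_eq distrib_left e2pi_add by simp

text \<open>The exponential is holomorphic in \<tau> and the indicator is constant, so the
  derivative in the conjugate variable acts only on the error function, through Im(\<tau>). Real
  differentiability is recorded as well, since \<open>d_taubar\<close> is defined through
  \<open>vector_derivative\<close>, which has a value in any case.\<close>

lemma phi_tilde_derivatives:
  assumes \<tau>: "Im \<tau> > 0"
  shows "(\<lambda>\<tau>'. phi_tilde \<tau>' x y) differentiable (at \<tau>)"
    and "xi (\<lambda>\<tau>'. phi_tilde \<tau>' x y) \<tau> = phi \<tau> x y"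
proof -
  define u v where "u = Re \<tau>" and "v = Im \<tau>"
  have \<tau>_eq: "Complex u v = \<tau>" by (simp add: u_def v_def)
  have v: "v > 0" using \<tau> by (simp add: v_def)
  define r where "r = complex_of_real ((y\<^sup>2 - x\<^sup>2) / 2)"
  define b where "b = (of_bool (y\<^sup>2 > x\<^sup>2) :: complex)"
  define s where "s = complex_of_real (sgn x)"
  define g where "g v = erfc (sqrt (2 * pi * v) * \<bar>x\<bar>)" for v
  define g' where "g' = - (sqrt 2 * \<bar>x\<bar> * exp (- (2 * pi * v * x\<^sup>2)) / sqrt v)"
  define F where "F z = s * e2pi (r * z) * (b - of_real (g (Im z)))" for z
  have F: "(\<lambda>\<tau>'. phi_tilde \<tau>' x y) = F"
    by (simp add: fun_eq_iff phi_tilde_eq F_def s_def r_def b_def g_def)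
  have g: "(g has_real_derivative g') (at v)"
  proof -
    have d: "(g has_real_derivative - 2 / sqrt pi * exp (- ((sqrt (2 * pi * v) * \<bar>x\<bar>)\<^sup>2)) *
        (2 * pi * (inverse (sqrt (2 * pi * v)) / 2) * \<bar>x\<bar>)) (at v)"
      unfolding g_def[abs_def] using v by (auto intro!: derivative_eq_intros simp: mult_less_0_iff)
    have sq: "(sqrt (2 * pi * v) * \<bar>x\<bar>)\<^sup>2 = 2 * pi * v * x\<^sup>2"
      using v by (simp add: power_mult_distrib)
    have k: "2 / sqrt pi * (2 * pi * (inverse (sqrt (2 * pi * v)) / 2)) = sqrt 2 / sqrt v"
      using v by (simp add: real_sqrt_mult field_simps)
    have k': "- 2 / sqrt pi * z * (2 * pi * (inverse (sqrt (2 * pi * v)) / 2) * \<bar>x\<bar>) =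
        - (sqrt 2 / sqrt v * z * \<bar>x\<bar>)" for z
      unfolding k[symmetric] by simp
    from d[unfolded sq k'] show ?thesis
      by (rule DERIV_cong) (simp add: g'_def)
  qed
  have "(g \<circ> Im has_derivative (\<lambda>h. Im h * g')) (at \<tau>)"
  proof -
    have "(g has_derivative (\<lambda>h. h * g')) (at (Im \<tau>))"
      using g by (simp add: has_field_derivative_def v_def mult_commute_abs)
    from diff_chain_at[OF bounded_linear.has_derivative[OF bounded_linear_Im has_derivative_ident] this]
    show ?thesis by (simp add: o_def)
  qed
  then have dg: "(\<lambda>z. complex_of_real (g (Im z))) differentiable (at \<tau>)"
    using bounded_linear.has_derivative[OF bounded_linear_of_real] unfolding differentiable_def o_def by blast
  have de: "(\<lambda>z. s * e2pi (r * z)) differentiable (at \<tau>)"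
  proof -
    have "((\<lambda>z. s * e2pi (r * z)) has_field_derivative s * (2 * of_real pi * \<i> * r * e2pi (r * \<tau>))) (at \<tau>)"
      by (auto intro!: derivative_eq_intros)
    then show ?thesis
      unfolding has_field_derivative_def differentiable_def by blast
  qed
  have "F differentiable (at \<tau>)"
    unfolding F_def[abs_def] by (intro differentiable_mult[OF de] differentiable_diff differentiable_const dg)
  then show "(\<lambda>\<tau>'. phi_tilde \<tau>' x y) differentiable (at \<tau>)"
    by (simp only: F)
  let ?A = "s * e2pi (r * \<tau>)"
  have du: "((\<lambda>u. F (Complex u v)) has_vector_derivative
      2 * of_real pi * \<i> * r * ?A * (b - of_real (g v))) (at u)"
  proof -
    have "((\<lambda>u. e2pi (r * (of_real u + \<i> * of_real v))) has_vector_derivative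
        2 * of_real pi * \<i> * r * e2pi (r * \<tau>)) (at u)"
    proof (rule has_vector_derivative_real_field)
      show "((\<lambda>w. e2pi (r * (w + \<i> * of_real v))) has_field_derivative
          2 * of_real pi * \<i> * r * e2pi (r * \<tau>)) (at (of_real u))"
        by (auto intro!: derivative_eq_intros simp: \<tau>_eq[symmetric] Complex_eq)
    qed
    from has_vector_derivative_mult_left[OF has_vector_derivative_mult_right[OF this, of s], of "b - of_real (g v)"]
    show ?thesis
      unfolding F_def complex.sel by (simp add: Complex_eq mult_ac)
  qed
  have ii: "\<i> * (p * (\<i> * q)) = - (p * q)" for p q
    unfolding mult.left_commute[of p] by simp
  have dv: "((\<lambda>v. F (Complex u v)) has_vector_derivative
      ?A * (- of_real g') + \<i> * (2 * of_real pi * \<i> * r * ?A * (b - of_real (g v)))) (at v)"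
  proof -
    have "((\<lambda>v. e2pi (r * (of_real u + \<i> * of_real v))) has_vector_derivative
        \<i> * (2 * of_real pi * \<i> * r * e2pi (r * \<tau>))) (at v)"
    proof (rule has_vector_derivative_real_field)
      show "((\<lambda>w. e2pi (r * (of_real u + \<i> * w))) has_field_derivative
          \<i> * (2 * of_real pi * \<i> * r * e2pi (r * \<tau>))) (at (of_real v))"
        by (auto intro!: derivative_eq_intros simp: \<tau>_eq[symmetric] Complex_eq ii)
    qed
    from has_vector_derivative_mult_right[OF this, of s]
    have 1: "((\<lambda>v. s * e2pi (r * (of_real u + \<i> * of_real v))) has_vector_derivative
        s * (\<i> * (2 * of_real pi * \<i> * r * e2pi (r * \<tau>)))) (at v)" .
    have "((\<lambda>v. complex_of_real (g v)) has_vector_derivative of_real g') (at v)"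
      using g by (intro has_vector_derivative_of_real) (simp add: has_real_derivative_iff_has_vector_derivative)
    then have 2: "((\<lambda>v. b - complex_of_real (g v)) has_vector_derivative 0 - of_real g') (at v)"
      by (intro has_vector_derivative_diff has_vector_derivative_const)
    have F_eq: "F (Complex u v) = s * e2pi (r * (of_real u + \<i> * of_real v)) * (b - of_real (g v))" for v
      by (simp add: F_def Complex_eq)
    show ?thesis
      unfolding F_eq
      by (rule has_vector_derivative_eq_rhs[OF has_vector_derivative_mult[OF 1 2]])
        (simp add: \<tau>_eq[symmetric] Complex_eq mult_ac)
  qed
  \<comment> \<open>The holomorphic contributions of the two partial derivatives cancel by the
    Cauchy-Riemann equations.\<close>
  have "d_taubar F \<tau> = - (\<i> / 2) * ?A * of_real g'"
    unfolding d_taubar_def u_def[symmetric] v_def[symmetric]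
      vector_derivative_at[OF du] vector_derivative_at[OF dv]
    by (simp add: algebra_simps)
  then have "xi F \<tau> = of_real v * of_real (- g') * (s * cnj (e2pi (r * \<tau>)))"
    by (simp add: xi_def v_def s_def ii mult_ac)
  also have "cnj (e2pi (r * \<tau>)) = e2pi (- (r * cnj \<tau>))"
    by (simp add: cnj_e2pi r_def)
  also have "of_real v * of_real (- g') * (s * e2pi (- (r * cnj \<tau>))) =
      of_real (sqrt (2 * v) * x) * (of_real (exp (- (2 * pi * v * x\<^sup>2))) * e2pi (- (r * cnj \<tau>)))"
  proof -
    have "v * (- g') * sgn x = sqrt 2 * (v / sqrt v) * (\<bar>x\<bar> * sgn x) * exp (- (2 * pi * v * x\<^sup>2))"
      by (simp add: g'_def)
    also have "\<dots> = sqrt (2 * v) * x * exp (- (2 * pi * v * x\<^sup>2))"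
      using v by (simp add: real_div_sqrt real_sqrt_mult abs_mult_sgn)
    finally have "complex_of_real (v * (- g') * sgn x) = of_real (sqrt (2 * v) * x * exp (- (2 * pi * v * x\<^sup>2)))"
      by (simp only:)
    moreover have "of_real v * of_real (- g') * (s * z) = of_real (v * (- g') * sgn x) * z" for z
      by (simp add: s_def)
    ultimately show ?thesis
      by (simp only: of_real_mult mult.assoc)
  qed
  also have "of_real (exp (- (2 * pi * v * x\<^sup>2))) = e2pi (\<i> * of_real (v * x\<^sup>2))"
    by (simp add: e2pi_def exp_of_real[symmetric] mult_ac)
  \<comment> \<open>The Gaussian from the derivative of the error function adds i v x^2 to the
    exponent; as \<tau> is its conjugate plus 2 i v, this turns the conjugate of \<tau> into \<tau>
    in the x^2 term only.\<close>
  also have "e2pi (\<i> * of_real (v * x\<^sup>2)) * e2pi (- (r * cnj \<tau>)) =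
      e2pi (of_real (x\<^sup>2 / 2) * \<tau> - of_real (y\<^sup>2 / 2) * cnj \<tau>)"
  proof -
    have "\<i> * of_real (v * x\<^sup>2) + - (r * cnj \<tau>) = of_real (x\<^sup>2 / 2) * \<tau> - of_real (y\<^sup>2 / 2) * cnj \<tau>"
      by (simp add: complex_eq_iff r_def v_def field_simps)
    then show ?thesis by (simp only: e2pi_add[symmetric])
  qed
  finally show "xi (\<lambda>\<tau>'. phi_tilde \<tau>' x y) \<tau> = phi \<tau> x y"
    by (simp only: F phi_def v_def)
qed

theorem proposition3p4:
  fixes \<tau> :: complex
  assumes "Im \<tau> > 0"
  shows "(\<lambda>(x, y). phi_tilde \<tau> x y) \<in> L_infty \<and>
    (\<forall>x y :: real.
      phi_tilde (\<tau> + 1) x y = e2pi (of_real ((y\<^sup>2 - x\<^sup>2) / 2)) * phi_tilde \<tau> x y \<and>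
      FT_tilde_well_defined (- 1 / \<tau>) x y \<and>
      FT_tilde (- 1 / \<tau>) x y = \<tau> * phi_tilde \<tau> x y \<and>
      (\<lambda>\<tau>'. phi_tilde \<tau>' x y) differentiable (at \<tau>) \<and>
      xi (\<lambda>\<tau>'. phi_tilde \<tau>' x y) \<tau> = phi \<tau> x y)"
  using phi_tilde_in_L_infty[OF assms] phi_tilde_add_one FT_tilde_well_defined_neg_inverse[OF assms]
    FT_tilde_neg_inverse[OF assms] phi_tilde_derivatives[OF assms]
  by blast

end
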